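(* Let $G$ be a star graph based on a complete graph $K_n$. Then the following are equivalent: (1) $\mathcal{B}_G$ is a vertex decomposable graph; (2) $J(G)^{(k)}$ has linear quotients for all $k\ge 1$; (3) $J(G)^{(k)}$ is a componentwise linear ideal for all $k\ge 2$; (4) $J(G)^{(k)}$ is a componentwise linear ideal for some $k\ge 2$.
   Context: Graphs are finite, simple, undirected. $N_G[x]$ is the set consisting of $x$ and its neighbors; $G\setminus U$ is the induced subgraph on $V(G)\setminus U$. $G$ is a star graph based on a complete graph $K_n$ if $G$ is connected and $V(G)=\{x_1,\dots,x_n,y_1,\dots,y_m\}$ where the complete graph on $\{x_1,\dots,x_n\}$ is a subgraph of $G$ and there is no edge between $y_i$ and $y_j$ for all $1\le i<j\le m$. (Such a graph is chordal, hence known to be vertex decomposable.) Cover ideals. In the polynomial ring $R$ over a field $\mathbb{K}$ whose variables are the vertices of $G$, the cover ideal is $J(G)=\bigcap_{\{u,v\}\in E(G)}(u,v)$, and its $k$-th symbolic power is $J(G)^{(k)}=\bigcap_{\{u,v\}\in E(G)}(u,v)^k$. A homogeneous ideal $I$ is componentwise linear if for each $\ell$ the ideal generated by all degree $\ell$ elements of $I$ has a linear resolution. A monomial ideal $I$ has linear quotients if its minimal monomial generators can be ordered $u_1,\dots,u_t$ so that for every $2\le i\le t$ the ideal $(u_1,\dots,u_{i-1}):(u_i)$ is generated by a subset of the variables. Vertex decomposability. A vertex $x$ of $G$ is a shedding vertex if no independent set of $G\setminus N_G[x]$ is a maximal independent set of $G\setminus x$. $G$ is (recursively) vertex decomposable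 if it has no edges, or it has a shedding vertex $x$ such that $G\setminus x$ and $G\setminus N_G[x]$ are both vertex decomposable. The graph $\mathcal{B}_G$. Let $G$ be a vertex decomposable graph. A shedding order of $G$ is a sequence $(a_1,\dots,a_l)$ of vertices such that $a_1$ is a shedding vertex of $G$, $a_i$ is a shedding vertex of $G\setminus\{a_1,\dots,a_{i-1}\}$ for $1<i\le l$, and $G\setminus\{a_1,\dots,a_l\}$ has no edges; the remaining vertices $\{b_1,\dots,b_r\}=V(G)\setminus\{a_1,\dots,a_l\}$ form the corresponding $i$-order. Given such a shedding order, $\mathcal{B}_G$ is the spanning bipartite subgraph of $G$ with vertex set $V(G)=\{b_1,\dots,b_r\}\sqcup\{a_1,\dots,a_l\}$ and edge set $\{\{b_i,a_j\}\in E(G): 1\le i\le r,\ 1\le j\le l\}$. One (arbitrary) shedding order of $G$ is fixed and $\mathcal{B}_G$ is formed from it. (The paper uses the following shedding orders for a star graph based on $K_n$: if some $x_i$, say $x_1$, is adjacent to no $y_j$, the shedding order $(x_2,\dots,x_n)$ with $i$-order $\{x_1,y_1,\dots,y_m\}$; if every $x_i$ is adjacent to some $y_j$, a shedding order consisting of all of $x_1,\dots,x_n$ with $i$-order $\{y_1,\dots,y_m\}$.)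
   Formalization: B_G is formed from the paper's shedding orders for star graphs only: all x_i except one x adjacent to no y_j if such an x exists, otherwise all of x_1,…,x_n; for an arbitrary shedding order of G the equivalence with (1) is false. *)

theory Defs
  imports Complex_Main "HOL-Library.Poly_Mapping"
begin

section \<open>Finite simple graphs\<close>

record 'v sgraph =
  verts :: "'v set"
  edges :: "'v set set"

definition simple_graph :: "'v sgraph \<Rightarrow> bool" where
  "simple_graph G \<longleftrightarrow>
     finite (verts G) \<and>
     edges G \<subseteq> {{u, v} | u v. u \<in> verts G \<and> v \<in> verts G \<and> u \<noteq> v}"

definition graph_connected :: "'v sgraph \<Rightarrow> bool" where
  "graph_connected G \<longleftrightarrow>
     (\<forall>u \<in> verts G. \<forall>v \<in> verts G. (u, v) \<in> {(x, y). {x, y} \<in> edges G}\<^sup>*)"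

definition closed_nbhd :: "'v sgraph \<Rightarrow> 'v \<Rightarrow> 'v set" where
  "closed_nbhd G x = insert x {y. {x, y} \<in> edges G}"

definition remove_verts :: "'v sgraph \<Rightarrow> 'v set \<Rightarrow> 'v sgraph" where
  "remove_verts G U = \<lparr> verts = verts G - U, edges = {e \<in> edges G. e \<inter> U = {}} \<rparr>"

definition independent_set :: "'v sgraph \<Rightarrow> 'v set \<Rightarrow> bool" where
  "independent_set G S \<longleftrightarrow> S \<subseteq> verts G \<and> (\<forall>u \<in> S. \<forall>v \<in> S. {u, v} \<notin> edges G)"

definition maximal_independent_set :: "'v sgraph \<Rightarrow> 'v set \<Rightarrow> bool" where
  "maximal_independent_set G S \<longleftrightarrow>
     independent_set G S \<and> (\<forall>T. independent_set G T \<and> S \<subseteq> T \<longrightarrow> T = S)"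

text \<open>
  \<open>star_graph G X Y\<close>: the graph \<open>G\<close> is a star graph based on the complete graph
  on \<open>X = {x\<^sub>1, \<dots>, x\<^sub>n}\<close>, with \<open>n = card X \<ge> 1\<close> and \<open>Y = {y\<^sub>1, \<dots>, y\<^sub>m}\<close>, where \<open>m \<ge> 0\<close>.
\<close>
definition star_graph :: "'v sgraph \<Rightarrow> 'v set \<Rightarrow> 'v set \<Rightarrow> bool" where
  "star_graph G X Y \<longleftrightarrow>
     simple_graph G \<and> graph_connected G \<and>
     verts G = X \<union> Y \<and> X \<inter> Y = {} \<and> X \<noteq> {} \<and>
     (\<forall>u \<in> X. \<forall>v \<in> X. u \<noteq> v \<longrightarrow> {u, v} \<in> edges G) \<and>
     (\<forall>u \<in> Y. \<forall>v \<in> Y. {u, v} \<notin> edges G)"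


section \<open>Vertex decomposability and shedding orders\<close>

definition shedding_vertex :: "'v sgraph \<Rightarrow> 'v \<Rightarrow> bool" where
  "shedding_vertex G x \<longleftrightarrow>
     x \<in> verts G \<and>
     \<not> (\<exists>S. independent_set (remove_verts G (closed_nbhd G x)) S \<and>
            maximal_independent_set (remove_verts G {x}) S)"

inductive vertex_decomposable :: "'v sgraph \<Rightarrow> bool" where
  no_edges: "edges G = {} \<Longrightarrow> vertex_decomposable G"
| shed: "shedding_vertex G x \<Longrightarrow>
         vertex_decomposable (remove_verts G {x}) \<Longrightarrow>
         vertex_decomposable (remove_verts G (closed_nbhd G x)) \<Longrightarrow>
         vertex_decomposable G"

definition shedding_order :: "'v sgraph \<Rightarrow> 'v list \<Rightarrow> bool" where
  "shedding_order G as \<longleftrightarrow>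
     (\<forall>i < length as. shedding_vertex (remove_verts G (set (take i as))) (as ! i)) \<and>
     edges (remove_verts G (set as)) = {}"

text \<open>
  The shedding orders used for a star graph: if some \<open>x \<in> X\<close> has no neighbour in \<open>Y\<close>, an
  order of \<open>X - {x}\<close> for such an \<open>x\<close>; otherwise an order of all of \<open>X\<close>.  The restriction is
  essential: a star graph can have other shedding orders, and vertex decomposability of the
  bipartite graph formed from a shedding order depends on that order.
\<close>
definition star_shedding_order :: "'v sgraph \<Rightarrow> 'v set \<Rightarrow> 'v set \<Rightarrow> 'v list \<Rightarrow> bool" where
  "star_shedding_order G X Y as \<longleftrightarrow>
     shedding_order G as \<and>
     (if \<exists>x \<in> X. \<forall>y \<in> Y. {x, y} \<notin> edges G
      then \<exists>x \<in> X. (\<forall>y \<in> Y. {x, y} \<notin> edges G) \<and> set as = X - {x}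
      else set as = X)"

text \<open>The graph \<open>\<B>\<^sub>G\<close> formed from the shedding order \<open>as\<close>, with \<open>i\<close>-order \<open>verts G - set as\<close>.\<close>
definition bipartite_part :: "'v sgraph \<Rightarrow> 'v list \<Rightarrow> 'v sgraph" where
  "bipartite_part G as =
     \<lparr> verts = verts G,
       edges = {{b, a} | b a. b \<in> verts G - set as \<and> a \<in> set as \<and> {b, a} \<in> edges G} \<rparr>"


section \<open>Polynomials and ideals\<close>

text \<open>
  The polynomial ring over \<open>'k\<close> whose variables are the elements of \<open>'v\<close>; exponent vectors
  are elements of \<open>'v \<Rightarrow>\<^sub>0 nat\<close>.
\<close>
type_synonym ('v, 'k) mpoly = "('v \<Rightarrow>\<^sub>0 nat) \<Rightarrow>\<^sub>0 'k"

definition monomial :: "('v \<Rightarrow>\<^sub>0 nat) \<Rightarrow> ('v, 'k::field) mpoly" where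
  "monomial m = Poly_Mapping.single m 1"

definition Var :: "'v \<Rightarrow> ('v, 'k::field) mpoly" where
  "Var v = monomial (Poly_Mapping.single v 1)"

definition mdeg :: "('v \<Rightarrow>\<^sub>0 nat) \<Rightarrow> nat" where
  "mdeg m = (\<Sum>v \<in> Poly_Mapping.keys m. Poly_Mapping.lookup m v)"

text \<open>As usual, \<open>0\<close> is homogeneous of every degree.\<close>
definition homogeneous :: "nat \<Rightarrow> ('v, 'k::field) mpoly \<Rightarrow> bool" where
  "homogeneous d p \<longleftrightarrow> (\<forall>m \<in> Poly_Mapping.keys p. mdeg m = d)"

definition ideal_gen :: "'r::comm_ring_1 set \<Rightarrow> 'r set" where
  "ideal_gen S = module.span (*) S"

definition ideal_prod :: "'r::comm_ring_1 set \<Rightarrow> 'r set \<Rightarrow> 'r set" where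
  "ideal_prod I J = ideal_gen {a * b | a b. a \<in> I \<and> b \<in> J}"

fun ideal_power :: "'r::comm_ring_1 set \<Rightarrow> nat \<Rightarrow> 'r set" where
  "ideal_power I 0 = UNIV"
| "ideal_power I (Suc k) = ideal_prod I (ideal_power I k)"

definition ideal_quotient :: "'r::comm_ring_1 set \<Rightarrow> 'r set \<Rightarrow> 'r set" where
  "ideal_quotient I J = {f. \<forall>g \<in> J. f * g \<in> I}"

definition homogeneous_ideal :: "('v, 'k::field) mpoly set \<Rightarrow> bool" where
  "homogeneous_ideal I \<longleftrightarrow> (\<exists>S. (\<forall>f \<in> S. \<exists>d. homogeneous d f) \<and> I = ideal_gen S)"

text \<open>\<open>J(G)\<^sup>(\<^sup>k\<^sup>)\<close>; for a graph without edges the intersection is the unit ideal.\<close>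
definition cover_ideal_symbolic_power ::
    "'v sgraph \<Rightarrow> nat \<Rightarrow> ('v, 'k::field) mpoly set" where
  "cover_ideal_symbolic_power G k = (\<Inter>e \<in> edges G. ideal_power (ideal_gen (Var ` e)) k)"


section \<open>Linear quotients\<close>

definition minimal_monomial_generators ::
    "('v, 'k::field) mpoly set \<Rightarrow> ('v \<Rightarrow>\<^sub>0 nat) set \<Rightarrow> bool" where
  "minimal_monomial_generators I U \<longleftrightarrow>
     ideal_gen (monomial ` U) = I \<and> (\<forall>U'. U' \<subset> U \<longrightarrow> ideal_gen (monomial ` U') \<noteq> I)"

definition has_linear_quotients :: "('v, 'k::field) mpoly set \<Rightarrow> bool" where
  "has_linear_quotients I \<longleftrightarrow>
     (\<exists>us. distinct us \<and> minimal_monomial_generators I (set us) \<and>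
        (\<forall>i. 1 \<le> i \<and> i < length us \<longrightarrow>
           (\<exists>W. ideal_quotient (ideal_gen (monomial ` set (take i us)))
                               (ideal_gen {monomial (us ! i)})
                = (ideal_gen (Var ` W) :: ('v, 'k) mpoly set))))"


section \<open>Linear resolutions and componentwise linear ideals\<close>

text \<open>
  With \<open>R\<close> the polynomial ring, \<open>linear_resolution I d b g A\<close> says that
  \[
    \cdots \to R(-d-2)^{b_2} \to R(-d-1)^{b_1} \to R(-d)^{b_0} \to I \to 0
  \]
  is an exact sequence of graded modules.  Here the last map sends the basis to
  \<open>g 0, \<dots>, g (b 0 - 1)\<close>, and \<open>A i\<close> is the matrix, with \<open>b i\<close> rows and \<open>b (Suc i)\<close>
  columns, of the map from homological degree \<open>i + 1\<close> to \<open>i\<close>.  Such maps preserve degrees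
  iff the \<open>g j\<close> are homogeneous of degree \<open>d\<close> and all matrix entries are \<open>0\<close> or linear forms,
  so the resolution is automatically minimal.  Elements of \<open>R\<^sup>n\<close> are functions on \<open>nat\<close> of which
  only the values below \<open>n\<close> matter.
\<close>
definition linear_resolution ::
    "('v, 'k::field) mpoly set \<Rightarrow> nat \<Rightarrow> (nat \<Rightarrow> nat) \<Rightarrow> (nat \<Rightarrow> ('v, 'k) mpoly) \<Rightarrow>
     (nat \<Rightarrow> nat \<Rightarrow> nat \<Rightarrow> ('v, 'k) mpoly) \<Rightarrow> bool" where
  "linear_resolution I d b g A \<longleftrightarrow>
     (\<forall>j < b 0. homogeneous d (g j)) \<and>
     (\<forall>i. \<forall>r < b i. \<forall>c < b (Suc i). homogeneous 1 (A i r c)) \<and>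
     I = {\<Sum>j < b 0. g j * w j | w. True} \<and>
     (\<forall>w. (\<Sum>j < b 0. g j * w j) = 0 \<longleftrightarrow>
          (\<exists>z. \<forall>r < b 0. w r = (\<Sum>c < b 1. A 0 r c * z c))) \<and>
     (\<forall>i w. (\<forall>r < b i. (\<Sum>c < b (Suc i). A i r c * w c) = 0) \<longleftrightarrow>
            (\<exists>z. \<forall>r < b (Suc i). w r = (\<Sum>c < b (Suc (Suc i)). A (Suc i) r c * z c)))"

definition has_linear_resolution :: "('v, 'k::field) mpoly set \<Rightarrow> bool" where
  "has_linear_resolution I \<longleftrightarrow> (\<exists>d b g A. linear_resolution I d b g A)"

definition componentwise_linear :: "('v, 'k::field) mpoly set \<Rightarrow> bool" where
  "componentwise_linear I \<longleftrightarrow>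
     homogeneous_ideal I \<and>
     (\<forall>l. has_linear_resolution (ideal_gen {f \<in> I. homogeneous l f}))"

end

theory Submission
  imports Defs
begin

text \<open>
  Let \<open>A\<close> be the set of vertices in the shedding order. Then \<open>G\<close> consists of the bipartite graph
  \<open>B = \<B>\<^sub>G\<close> between \<open>A\<close> and its complement and of the complete graph on \<open>A\<close>, and every element of
  \<open>A\<close> has a neighbour in \<open>B\<close>. All four conditions are equivalent to: for every independent
  set \<open>S\<close> of \<open>B\<close>, if \<open>B\<close> minus the closed neighbourhood of \<open>S\<close> has an edge, then it has a leaf.

  The ideal \<open>J(G)\<^sup>(\<^sup>k\<^sup>)\<close> is spanned by the monomials with exponent vectors in
  \<open>F = {f. k \<le> f u + f v for all edges uv}\<close>. If the leaf condition holds, \<open>F\<close> can be split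
  repeatedly according to whether the exponent of a variable \<open>x\<close> attains its minimum, in such a way
  that every \<open>f\<close> with minimal \<open>f x\<close> can exchange some other variable for \<open>x\<close>. On the
  generators such a splitting yields an order with linear quotients; on the monomials of a fixed
  degree it yields \<open>I = I1 + I2\<close> with \<open>I1 \<inter> I2 = x I2\<close>, so that linear resolutions of \<open>I1\<close> and
  \<open>I2\<close> give one of \<open>I\<close>.

  Conversely, let \<open>V1\<close> and \<open>V2\<close> be the non-isolated vertices on the two sides of \<open>B\<close> minus the
  closed neighbourhood of \<open>S\<close>. Multiplying \<open>\<Prod>a\<in>A. a\<^bsup>k-1\<^esup>\<close> by the neighbours of \<open>S\<close> and by
  \<open>V1\<close> or \<open>V2\<close> gives two generators of \<open>J(G)\<^sup>(\<^sup>k\<^sup>)\<close>. Linear quotients, or linear first syzygies,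
  force one of them to admit an exchange \<open>u z / t\<close> with \<open>z\<close> from the other, and then \<open>t\<close> is a leaf.
\<close>

section \<open>Splitting sets of exponent vectors\<close>

text \<open>Why the leaf condition ranges over all \<open>S\<close>: thresholds \<open>n\<close>
  with \<open>n a + n b = m - 1\<close> on every edge turn \<open>m \<le> f a + f b\<close> into the
  demand that the vertices with \<open>n w < f w\<close> cover all edges. Bounds on \<open>f\<close>
  settle part of this: vertices that cannot exceed their threshold form an independent set
  \<open>S\<close>, their neighbours have to exceed it, and the rest is \<open>B\<close> without the
  closed neighbourhood of \<open>S\<close>. A leaf there yields the next variable to split at.

  The induction needs a class of sets to which both halves of a splitting belong. Upper bounds on
  the part of each exponent that counts towards the edges provide it, as each half lowers one bound.
  The clique on \<open>A\<close> is not bipartite and has to go beforehand: either all exponents on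
  \<open>A\<close> are at least \<open>k / 2\<close>, and its conditions hold by themselves, or some
  value \<open>j < k / 2\<close> forces all others on \<open>A\<close> to be at least
  \<open>k - j\<close>.

  An exchange keeps the degree, so that one splitting restricts to every degree and serves linear
  resolutions as well as linear quotients.\<close>

text \<open>The exponents of the variables in \<open>Z\<close> are constant on the set.\<close>
inductive splittable :: "'v set \<Rightarrow> ('v \<Rightarrow> nat) set \<Rightarrow> bool" where
  empty: "splittable Z {}"
| cone: "splittable Z {f. u \<le> f \<and> (\<forall>z\<in>Z. f z = u z)}"
| split: "x \<notin> Z \<Longrightarrow> (\<And>f. f \<in> M \<Longrightarrow> c \<le> f x) \<Longrightarrow>
    splittable Z {f \<in> M. c < f x} \<Longrightarrow> splittable (insert x Z) {f \<in> M. f x = c} \<Longrightarrow>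
    (\<And>f. f \<in> M \<Longrightarrow> f x = c \<Longrightarrow> \<exists>t. t \<noteq> x \<and> 0 < f t \<and> f(x := Suc c, t := f t - 1) \<in> M) \<Longrightarrow>
    splittable Z M"

text \<open>Multiplication by the monomial with exponents \<open>s\<close> respects every rule:
  cones move by \<open>s\<close>, a threshold \<open>c\<close> at \<open>x\<close> becomes
  \<open>c + s x\<close>, and exchanges are carried along. This strips forced common factors when
  the clique conditions are reduced to bipartite ones.\<close>

lemma splittable_shift:
  assumes "splittable Z M"
  shows "splittable Z {g. s \<le> g \<and> (\<lambda>v. g v - s v) \<in> M}"
  using assms
proof (induction rule: splittable.induct)
  case (empty Z)
  then show ?case by (simp add: splittable.empty)
next
  case (cone Z u)
  have "{g. s \<le> g \<and> (\<lambda>v. g v - s v) \<in> {f. u \<le> f \<and> (\<forall>z\<in>Z. f z = u z)}}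
      = {f. (\<lambda>v. s v + u v) \<le> f \<and> (\<forall>z\<in>Z. f z = s z + u z)}" (is "?A = ?B")
  proof (intro set_eqI iffI)
    fix g assume g: "g \<in> ?A"
    then have *: "s v \<le> g v" "u v \<le> g v - s v" "v \<in> Z \<longrightarrow> g v - s v = u v" for v
      by (auto simp: le_fun_def)
    have "s v + u v \<le> g v" "v \<in> Z \<longrightarrow> g v = s v + u v" for v
      using *[of v] by linarith+
    then show "g \<in> ?B" by (simp add: le_fun_def)
  next
    fix g assume g: "g \<in> ?B"
    then have *: "s v + u v \<le> g v" "v \<in> Z \<longrightarrow> g v = s v + u v" for v
      by (auto simp: le_fun_def)
    have "s v \<le> g v" "u v \<le> g v - s v" "v \<in> Z \<longrightarrow> g v - s v = u v" for v
      using *[of v] by linarith+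
    then show "g \<in> ?A" by (simp add: le_fun_def)
  qed
  then show ?case using splittable.cone[of Z "\<lambda>v. s v + u v"] by simp
next
  case (split x Z M c)
  let ?S = "\<lambda>M. {g. s \<le> g \<and> (\<lambda>v. g v - s v) \<in> M}"
  show ?case
  proof (rule splittable.split[where x = x and c = "c + s x"])
    show "x \<notin> Z" by fact
    show "c + s x \<le> g x" if "g \<in> ?S M" for g
    proof -
      have "c \<le> g x - s x" "s x \<le> g x" using that split.hyps(2)[of "\<lambda>v. g v - s v"] by (auto simp: le_fun_def)
      then show ?thesis by linarith
    qed
    have "{f \<in> ?S M. c + s x < f x} = ?S {f \<in> M. c < f x}"
      by (auto simp: less_diff_conv)
    then show "splittable Z {f \<in> ?S M. c + s x < f x}" using split.IH(1) by simp
    have "{f \<in> ?S M. f x = c + s x} = ?S {f \<in> M. f x = c}"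
      by (auto simp: le_fun_def)
    then show "splittable (insert x Z) {f \<in> ?S M. f x = c + s x}" using split.IH(2) by simp
    fix g assume g: "g \<in> ?S M" and gx: "g x = c + s x"
    define f where "f = (\<lambda>v. g v - s v)"
    have "f \<in> M" "f x = c" using g gx by (auto simp: f_def)
    then obtain t where t: "t \<noteq> x" "0 < f t" "f(x := Suc c, t := f t - 1) \<in> M"
      using split.hyps(5) by blast
    let ?h = "g(x := Suc (c + s x), t := g t - 1)"
    have "(\<lambda>v. ?h v - s v) = f(x := Suc c, t := f t - 1)" by (auto simp: f_def)
    moreover have "s \<le> ?h" using g gx t by (auto simp: le_fun_def f_def)
    ultimately show "\<exists>t. t \<noteq> x \<and> 0 < g t \<and> g(x := Suc (c + s x), t := g t - 1) \<in> ?S M"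
      using t by (intro exI[of _ t]) (auto simp: f_def)
  qed
qed

text \<open>The lower bound at \<open>v\<close> that results from the upper bounds \<open>h\<close>
  at its neighbours; it is 0 if \<open>v\<close> has no neighbour.\<close>

definition forced :: "('v \<Rightarrow> 'v \<Rightarrow> bool) \<Rightarrow> nat \<Rightarrow> ('v \<Rightarrow> nat) \<Rightarrow> 'v \<Rightarrow> nat" where
  "forced adj m h v = (LEAST n. \<forall>w. adj v w \<longrightarrow> m \<le> n + h w)"

lemma forced_ge: "adj v w \<Longrightarrow> m \<le> forced adj m h v + h w"
proof -
  have "\<forall>w. adj v w \<longrightarrow> m \<le> forced adj m h v + h w"
    unfolding forced_def by (rule LeastI[of _ m]) simp
  then show "adj v w \<Longrightarrow> m \<le> forced adj m h v + h w" by simp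
qed

lemma forced_le: "(\<And>w. adj v w \<Longrightarrow> m \<le> n + h w) \<Longrightarrow> forced adj m h v \<le> n"
  unfolding forced_def by (rule Least_le) simp

lemma forced_antimono: "h' \<le> h \<Longrightarrow> forced adj m h v \<le> forced adj m h' v"
proof (rule forced_le)
  fix w assume "h' \<le> h" "adj v w"
  then show "m \<le> forced adj m h' v + h w"
    using forced_ge[of adj v w m h'] by (meson add_left_mono le_funD order_trans)
qed

definition closed_hull :: "('v \<Rightarrow> 'v \<Rightarrow> bool) \<Rightarrow> 'v set \<Rightarrow> 'v set" where
  "closed_hull adj S = S \<union> {w. \<exists>s\<in>S. adj s w}"

text \<open>Vacuously true if no edge avoids \<open>N\<close>.\<close>
definition has_leaf_outside :: "('v \<Rightarrow> 'v \<Rightarrow> bool) \<Rightarrow> 'v set \<Rightarrow> bool" where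
  "has_leaf_outside adj N \<longleftrightarrow> (\<exists>u v. adj u v \<and> u \<notin> N \<and> v \<notin> N) \<longrightarrow>
     (\<exists>x y. adj x y \<and> x \<notin> N \<and> y \<notin> N \<and> (\<forall>w. adj y w \<longrightarrow> w \<notin> N \<longrightarrow> w = x))"

definition leafy :: "('v \<Rightarrow> 'v \<Rightarrow> bool) \<Rightarrow> bool" where
  "leafy adj \<longleftrightarrow> (\<forall>S. (\<forall>u\<in>S. \<forall>v\<in>S. \<not> adj u v) \<longrightarrow> has_leaf_outside adj (closed_hull adj S))"

lemma leafyD:
  assumes "leafy adj" "\<And>u v. u \<in> S \<Longrightarrow> v \<in> S \<Longrightarrow> \<not> adj u v"
    "adj u v" "u \<notin> closed_hull adj S" "v \<notin> closed_hull adj S"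
  shows "\<exists>x y. adj x y \<and> x \<notin> closed_hull adj S \<and> y \<notin> closed_hull adj S \<and>
    (\<forall>w. adj y w \<longrightarrow> w \<notin> closed_hull adj S \<longrightarrow> w = x)"
proof -
  have "\<forall>u\<in>S. \<forall>v\<in>S. \<not> adj u v" using assms(2) by simp
  moreover have "\<exists>u v. adj u v \<and> u \<notin> closed_hull adj S \<and> v \<notin> closed_hull adj S"
    using assms(3-5) by auto
  ultimately show ?thesis using assms(1) by (simp add: leafy_def has_leaf_outside_def)
qed

text \<open>If the lower bounds \<open>forced\<close> violate an edge, some level has a surviving
  edge, hence a leaf \<open>y\<close> with neighbour \<open>x\<close>. All other neighbours of
  \<open>y\<close> are adjacent to \<open>S\<close> and so forced above the level, while
  \<open>x\<close> survives and is not; they lie on the same side of the bipartition, so their lower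
  bounds can be compared.\<close>

lemma bounded_leaf:
  assumes sym: "symp adj" and bip: "\<And>u v. adj u v \<Longrightarrow> u \<in> P \<longleftrightarrow> v \<notin> P" and leafy: "leafy adj"
    and h: "\<And>u v. adj u v \<Longrightarrow> m \<le> h u + h v"
    and e: "adj u v" "forced adj m h u + forced adj m h v < m"
  shows "\<exists>x y. adj x y \<and> forced adj m h x < h x \<and> forced adj m h x < m \<and>
    (\<forall>w. adj y w \<longrightarrow> w \<noteq> x \<longrightarrow> forced adj m h x < forced adj m h w)"
proof -
  let ?l = "forced adj m h"
  have symD: "adj b a" if "adj a b" for a b using sym that by (auto dest: sympD)
  have ge: "m \<le> ?l a + h b" if "adj a b" for a b by (rule forced_ge) (rule that)
  obtain u v where e: "adj u v" "?l u + ?l v < m" "u \<in> P" "v \<notin> P"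
    using e bip symD by (metis add.commute)
  txt \<open>The bounds describe, on each level of the polarization, an induced subgraph obtained by
    deleting closed neighbourhoods; \<open>n w\<close> is the position of this level in the exponent of \<open>w\<close>.\<close>
  define n where "n = (\<lambda>w. if w \<in> P then ?l u else m - Suc (?l u))"
  have n_adj: "n a + n b = m - 1" "n a < m" if "adj a b" for a b
    using bip[OF that] e(2) by (auto simp: n_def)
  have m: "0 < m" using e(2) by simp
  \<comment> \<open>The vertices that their upper bound keeps at or below the level. Two adjacent
    ones would have bounds of sum at most \<open>m - 1\<close>, so they are independent, and they
    force their neighbours above the level.\<close>
  define S where "S = {w. h w \<le> n w}"
  have indep: "\<not> adj a b" if "a \<in> S" "b \<in> S" for a b
  proof
    assume ab: "adj a b"
    have "h a + h b \<le> m - 1" using that n_adj(1)[OF ab] by (simp add: S_def)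
    then show False using h[OF ab] m by simp
  qed
  have dead: "n w < ?l w" if "adj a w" "a \<in> S" for a w
    using ge[OF symD[OF that(1)]] n_adj(1)[OF that(1)] that(2) m by (simp add: S_def)
  have dead': "w \<in> closed_hull adj S" if "n w < ?l w" for w
  proof (rule ccontr)
    assume w: "w \<notin> closed_hull adj S"
    have "?l w \<le> n w"
    proof (rule forced_le)
      fix a assume a: "adj w a"
      then have "a \<notin> S" using w symD by (auto simp: closed_hull_def)
      then have "n a < h a" by (simp add: S_def)
      then show "m \<le> n w + h a" using n_adj[OF a] by linarith
    qed
    with that show False by simp
  qed
  have alive: "w \<notin> closed_hull adj S \<longleftrightarrow> ?l w \<le> n w \<and> n w < h w" for w
    using dead dead' by (force simp: closed_hull_def S_def)
  \<comment> \<open>The level passes through \<open>?l u\<close> so that the deficient edge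
    survives: \<open>v\<close> has threshold \<open>m - Suc (?l u)\<close>, which
    \<open>?l v\<close> does not exceed because \<open>?l u + ?l v < m\<close>.\<close>
  have uv: "u \<notin> closed_hull adj S" "v \<notin> closed_hull adj S"
    unfolding alive using e ge[OF e(1)] ge[OF symD[OF e(1)]] by (auto simp: n_def)
  obtain x y where xy: "adj x y" "x \<notin> closed_hull adj S" "y \<notin> closed_hull adj S"
    and leaf: "\<And>w. adj y w \<Longrightarrow> w \<notin> closed_hull adj S \<Longrightarrow> w = x"
    using leafyD[OF leafy indep e(1) uv] by auto
  show ?thesis
  proof (intro exI conjI allI impI)
    show "adj x y" by fact
    show "?l x < h x" using xy(2) unfolding alive by linarith
    show "?l x < m" using xy(2) n_adj(2)[OF xy(1)] unfolding alive by linarith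
    fix w assume w: "adj y w" "w \<noteq> x"
    then have "w \<in> closed_hull adj S" using leaf by blast
    moreover have "w \<notin> S"
    proof
      assume "w \<in> S"
      then have "y \<in> closed_hull adj S" using symD[OF w(1)] by (auto simp: closed_hull_def)
      with xy show False by simp
    qed
    ultimately have "n w < ?l w" using dead by (auto simp: closed_hull_def)
    moreover have "n w = n x" using bip[OF w(1)] bip[OF xy(1)] by (simp add: n_def)
    moreover have "?l x \<le> n x" using xy(2) unfolding alive by simp
    ultimately show "?l x < ?l w" by simp
  qed
qed

text \<open>For \<open>Z = {}\<close>: the vectors above some vector \<open>f \<le> h\<close> with \<open>m \<le> f u + f v\<close> for all edges.\<close>
definition capped :: "('v \<Rightarrow> 'v \<Rightarrow> bool) \<Rightarrow> nat \<Rightarrow> ('v \<Rightarrow> nat) \<Rightarrow> 'v set \<Rightarrow> ('v \<Rightarrow> nat) set" where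
  "capped adj m h Z = {g. (\<forall>u v. adj u v \<longrightarrow> m \<le> min (g u) (h u) + min (g v) (h v)) \<and>
     (\<forall>z\<in>Z. g z = h z)}"

lemma sum_strict_mono_fun:
  fixes f g :: "'v::finite \<Rightarrow> nat"
  assumes "f \<le> g" "f x < g x"
  shows "sum f UNIV < sum g UNIV"
  using assms by (intro sum_strict_mono_ex1) (auto simp: le_fun_def)

text \<open>Induction on the sum of the upper bounds. If the lower bounds \<open>forced\<close>
  satisfy all edges, they are the apex of a cone. Otherwise the split is at the \<open>x\<close>
  from \<open>bounded_leaf\<close>, with \<open>c\<close> its lower bound. Each half is again
  \<open>capped\<close> with one bound lowered: at \<open>y\<close> if the exponent of
  \<open>x\<close> exceeds \<open>c\<close>, at \<open>x\<close> if it equals \<open>c\<close>. The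
  exchange takes from \<open>y\<close>.\<close>

lemma capped_splittable:
  fixes h :: "'v::finite \<Rightarrow> nat"
  assumes sym: "symp adj" and bip: "\<And>u v. adj u v \<Longrightarrow> u \<in> P \<longleftrightarrow> v \<notin> P" and leafy: "leafy adj"
    and h: "\<And>u v. adj u v \<Longrightarrow> m \<le> h u + h v"
    and Z: "\<And>z. z \<in> Z \<Longrightarrow> forced adj m h z = h z"
  shows "splittable Z (capped adj m h Z)"
  using h Z
proof (induction "sum h UNIV" arbitrary: h Z rule: less_induct)
  case less
  let ?l = "forced adj m h"
  have symD: "adj b a" if "adj a b" for a b using sym that by (auto dest: sympD)
  have irrefl: "\<not> adj a a" for a using bip by blast
  have l_le: "?l v \<le> h v" for v
    by (rule forced_le) (use less.prems(1) in simp)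
  have l_lower: "?l v \<le> g v" if "g \<in> capped adj m h Z" for g v
  proof (rule forced_le)
    fix w assume "adj v w"
    then have "m \<le> min (g v) (h v) + min (g w) (h w)" using that by (auto simp: capped_def)
    then show "m \<le> g v + h w" by linarith
  qed
  \<comment> \<open>Lowering upper bounds can only raise \<open>forced\<close>; where it has reached
    the bound, the two stay equal. This passes the assumption on \<open>Z\<close> to both
    halves.\<close>
  have fixed: "forced adj m h' z = h' z"
    if "h' \<le> h" "\<And>u v. adj u v \<Longrightarrow> m \<le> h' u + h' v" "h' z \<le> ?l z" for h' z
  proof (rule antisym)
    show "forced adj m h' z \<le> h' z" by (rule forced_le) (use that in simp)
    show "h' z \<le> forced adj m h' z" using that forced_antimono[OF that(1), of adj m z] by simp
  qed
  show ?case
  proof (cases "\<forall>u v. adj u v \<longrightarrow> m \<le> ?l u + ?l v")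
    case True
    have "capped adj m h Z = {g. ?l \<le> g \<and> (\<forall>z\<in>Z. g z = ?l z)}"
    proof (intro set_eqI iffI)
      fix g assume "g \<in> capped adj m h Z"
      then show "g \<in> {g. ?l \<le> g \<and> (\<forall>z\<in>Z. g z = ?l z)}"
        using l_lower less.prems(2) by (auto simp: le_fun_def capped_def)
    next
      fix g assume g: "g \<in> {g. ?l \<le> g \<and> (\<forall>z\<in>Z. g z = ?l z)}"
      have "?l v \<le> min (g v) (h v)" for v using g l_le by (auto simp: le_fun_def)
      then have "m \<le> min (g u) (h u) + min (g v) (h v)" if "adj u v" for u v
        using True that by (meson add_mono order_trans)
      then show "g \<in> capped adj m h Z" using g less.prems(2) by (simp add: capped_def)
    qed
    then show ?thesis using splittable.cone[of Z ?l] by simp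
  next
    case False
    then obtain u v where uv: "adj u v" "?l u + ?l v < m" by (auto simp: not_le)
    obtain x y where xy: "adj x y" "?l x < h x" "?l x < m"
      and leaf: "\<And>w. adj y w \<Longrightarrow> w \<noteq> x \<Longrightarrow> ?l x < ?l w"
      using bounded_leaf[OF sym bip leafy less.prems(1) uv] by auto
    define c where "c = ?l x"
    have hy: "m - c \<le> h y" using forced_ge[of adj x y m h] xy(1) by (simp add: c_def)
    have hw: "c < h w" if "adj y w" for w
      using xy(2) leaf[OF that] l_le[of w] by (cases "w = x") (auto simp: c_def)
    have xy_neq: "x \<noteq> y" using xy(1) irrefl by auto
    have xZ: "x \<notin> Z" using less.prems(2) xy(2) by auto
    have ly: "?l y \<le> m - Suc c"
    proof (rule forced_le)
      fix w assume "adj y w"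
      then show "m \<le> m - Suc c + h w" using hw[of w] by linarith
    qed
    then have yZ: "y \<notin> Z" using less.prems(2)[of y] hy xy(3) by (auto simp: c_def)
    \<comment> \<open>Once the exponent of \<open>x\<close> exceeds \<open>c\<close>, all neighbours
      of \<open>y\<close> exceed \<open>c\<close>, so \<open>m - Suc c\<close> at \<open>y\<close>
      is enough for every edge at \<open>y\<close>.\<close>
    define h1 where "h1 = h(y := m - Suc c)"
    have h1_le: "h1 \<le> h" using hy by (auto simp: h1_def le_fun_def)
    have h1_adj: "m \<le> h1 a + h1 b" if "adj a b" for a b
    proof -
      have "m \<le> m - Suc c + h w" if "adj y w" for w using hw[OF that] by linarith
      then show ?thesis using less.prems(1)[OF that] that symD[OF that] irrefl
        by (auto simp: h1_def add.commute)
    qed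
    have "splittable Z (capped adj m h1 Z)"
    proof (rule less.hyps)
      show "sum h1 UNIV < sum h UNIV"
        by (rule sum_strict_mono_fun[OF h1_le, of y]) (use hy xy(3) in \<open>simp add: h1_def c_def\<close>)
      show "forced adj m h1 z = h1 z" if "z \<in> Z" for z
        by (rule fixed[OF h1_le h1_adj]) (use less.prems(2)[OF that] le_funD[OF h1_le, of z] in auto)
    qed (rule h1_adj)
    moreover have "{f \<in> capped adj m h Z. c < f x} = capped adj m h1 Z"
    proof (intro set_eqI iffI)
      fix g assume g: "g \<in> {f \<in> capped adj m h Z. c < f x}"
      have big: "c < min (g w) (h w)" if "adj y w" for w
        using g hw[OF that] leaf[OF that] l_lower[of g w] by (cases "w = x") (auto simp: c_def)
      have "m \<le> min (g a) (h1 a) + min (g b) (h1 b)" if ab: "adj a b" for a b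
      proof -
        have *: "m \<le> min (g y) (m - Suc c) + min (g w) (h w)" if "adj y w" for w
        proof -
          have "m \<le> min (g y) (h y) + min (g w) (h w)" using g that by (auto simp: capped_def)
          then show ?thesis using big[OF that] by linarith
        qed
        have "m \<le> min (g a) (h a) + min (g b) (h b)" using g ab by (auto simp: capped_def)
        then show ?thesis using *[of a] *[of b] ab symD[OF ab] irrefl
          by (auto simp: h1_def add.commute)
      qed
      then show "g \<in> capped adj m h1 Z" using g yZ by (auto simp: capped_def h1_def)
    next
      fix g assume g: "g \<in> capped adj m h1 Z"
      have "m \<le> min (g a) (h a) + min (g b) (h b)" if "adj a b" for a b
      proof -
        have "m \<le> min (g a) (h1 a) + min (g b) (h1 b)" using g that by (simp add: capped_def)
        then show ?thesis using le_funD[OF h1_le, of a] le_funD[OF h1_le, of b] by linarith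
      qed
      moreover have "c < g x"
      proof -
        have "m \<le> min (g x) (h1 x) + min (g y) (h1 y)" using g xy(1) by (simp add: capped_def)
        then show ?thesis using xy(3) by (auto simp: h1_def c_def)
      qed
      moreover have "g z = h z" if "z \<in> Z" for z using g that yZ by (auto simp: capped_def h1_def)
      ultimately show "g \<in> {f \<in> capped adj m h Z. c < f x}" by (simp add: capped_def)
    qed
    ultimately have 1: "splittable Z {f \<in> capped adj m h Z. c < f x}" by simp
    define h2 where "h2 = h(x := c)"
    have h2_le: "h2 \<le> h" using xy(2) by (auto simp: h2_def le_fun_def c_def)
    have h2_adj: "m \<le> h2 a + h2 b" if "adj a b" for a b
      using less.prems(1)[OF that] that symD[OF that] irrefl forced_ge[of adj x a m h] forced_ge[of adj x b m h]
      by (auto simp: h2_def c_def add.commute)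
    have "splittable (insert x Z) (capped adj m h2 (insert x Z))"
    proof (rule less.hyps)
      show "sum h2 UNIV < sum h UNIV"
        by (rule sum_strict_mono_fun[OF h2_le, of x]) (use xy(2) in \<open>simp add: h2_def c_def\<close>)
      show "forced adj m h2 z = h2 z" if "z \<in> insert x Z" for z
        by (rule fixed[OF h2_le h2_adj]) (use less.prems(2) that xZ in \<open>auto simp: h2_def c_def\<close>)
    qed (rule h2_adj)
    moreover have "{f \<in> capped adj m h Z. f x = c} = capped adj m h2 (insert x Z)"
    proof (intro set_eqI iffI)
      fix g assume g: "g \<in> {f \<in> capped adj m h Z. f x = c}"
      then have "min (g a) (h2 a) = min (g a) (h a)" for a
        using xy(2) by (auto simp: h2_def c_def)
      then show "g \<in> capped adj m h2 (insert x Z)" using g xZ by (auto simp: capped_def h2_def)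
    next
      fix g assume g: "g \<in> capped adj m h2 (insert x Z)"
      then have "min (g a) (h2 a) = min (g a) (h a)" for a
        using xy(2) by (auto simp: h2_def c_def capped_def)
      then show "g \<in> {f \<in> capped adj m h Z. f x = c}" using g xZ by (auto simp: capped_def h2_def)
    qed
    ultimately have 2: "splittable (insert x Z) {f \<in> capped adj m h Z. f x = c}" by simp
    show ?thesis
    proof (rule splittable.split[OF xZ _ 1 2])
      show "c \<le> f x" if "f \<in> capped adj m h Z" for f using l_lower[OF that] by (simp add: c_def)
      fix f assume f: "f \<in> capped adj m h Z" and fx: "f x = c"
      have fy: "m - c \<le> f y"
      proof -
        have "m \<le> min (f x) (h x) + min (f y) (h y)" using f xy(1) by (simp add: capped_def)
        then show ?thesis using fx by linarith
      qed
      let ?f = "f(x := Suc c, y := f y - 1)"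
      \<comment> \<open>\<open>y\<close> keeps at least \<open>m - Suc c\<close>; \<open>x\<close>
        was raised to \<open>Suc c\<close>, and every other neighbour of \<open>y\<close> has a
        lower bound above \<open>c\<close>.\<close>
      have *: "m \<le> min (?f y) (h y) + min (?f w) (h w)" if w: "adj y w" for w
      proof -
        have "c < min (?f w) (h w)"
          using hw[OF w] leaf[OF w] l_lower[OF f, of w] w irrefl xy_neq by (cases "w = x") (auto simp: c_def)
        moreover have "m - Suc c \<le> min (?f y) (h y)" using fy hy by auto
        ultimately show ?thesis by linarith
      qed
      have "m \<le> min (?f a) (h a) + min (?f b) (h b)" if ab: "adj a b" for a b
      proof (cases "a = y \<or> b = y")
        case True
        then show ?thesis using *[of a] *[of b] ab symD[OF ab] by (auto simp: add.commute)
      next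
        case False
        have "m \<le> min (f a) (h a) + min (f b) (h b)" using f ab by (simp add: capped_def)
        moreover have "min (f d) (h d) \<le> min (?f d) (h d)" if "d \<noteq> y" for d
          using that fx by auto
        ultimately show ?thesis using False by (meson add_mono order_trans)
      qed
      then have "?f \<in> capped adj m h Z" using f xZ yZ unfolding capped_def by auto
      then show "\<exists>t. t \<noteq> x \<and> 0 < f t \<and> f(x := Suc c, t := f t - 1) \<in> capped adj m h Z"
        using fy xy(3) xy_neq by (intro exI[of _ y]) (auto simp: c_def)
    qed
  qed
qed

section \<open>Vertex decomposability and leaves\<close>

text \<open>Lower bounds \<open>p\<close> on \<open>A\<close> are raised one unit at a time. When
  all reach \<open>k / 2\<close>, rounded up, the clique conditions hold automatically. A value
  \<open>j\<close> below \<open>k / 2\<close> at some \<open>a\<close> pushes every other exponent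
  on \<open>A\<close>, and every neighbour of \<open>a\<close>, to \<open>k - j\<close>, so the
  clique conditions become lower bounds. After a shift, both cases are instances of
  \<open>capped_splittable\<close>. The exchange at \<open>a\<close> takes from a neighbour outside
  \<open>A\<close>, which \<open>nbr\<close> provides.\<close>

lemma clique_cover_splittable:
  fixes adj :: "'v::finite \<Rightarrow> 'v \<Rightarrow> bool"
  assumes sym: "symp adj" and bip: "\<And>u v. adj u v \<Longrightarrow> u \<in> A \<longleftrightarrow> v \<notin> A" and leafy: "leafy adj"
    and nbr: "\<And>a. a \<in> A \<Longrightarrow> \<exists>b. adj a b"
  shows "splittable {} {f. (\<forall>u v. adj u v \<longrightarrow> k \<le> f u + f v) \<and>
    (\<forall>a\<in>A. \<forall>b\<in>A. a \<noteq> b \<longrightarrow> k \<le> f a + f b)}" (is "splittable {} ?F")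
proof -
  \<comment> \<open>Half of \<open>k\<close> rounded up: \<open>2 * h\<close> is at least
    \<open>k\<close>, and every \<open>j < h\<close> satisfies \<open>2 * j < k\<close>.\<close>
  define h where "h = (k + 1) div 2"
  define F where "F = ?F"
  have symD: "adj b a" if "adj a b" for a b using sym that by (auto dest: sympD)
  have F_iff: "f \<in> F \<longleftrightarrow> (\<forall>a\<in>A. \<forall>b. adj a b \<longrightarrow> k \<le> f a + f b) \<and>
      (\<forall>a\<in>A. \<forall>b\<in>A. a \<noteq> b \<longrightarrow> k \<le> f a + f b)" for f
    unfolding F_def using bip symD by (auto simp: add.commute) (metis add.commute)
  have capped_iff: "g \<in> capped adj m q Z \<longleftrightarrow>
      (\<forall>a\<in>A. \<forall>b. adj a b \<longrightarrow> m \<le> min (g a) (q a) + min (g b) (q b)) \<and> (\<forall>z\<in>Z. g z = q z)" for g m q Z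
    unfolding capped_def using bip symD by (auto simp: add.commute) (metis add.commute)
  have main: "splittable {} {f \<in> F. \<forall>a\<in>A. p a \<le> f a}" if "\<And>a. a \<in> A \<Longrightarrow> p a \<le> h" for p
    using that
  proof (induction "\<Sum>a\<in>A. h - p a" arbitrary: p rule: less_induct)
    case less
    show ?case
    proof (cases "\<forall>a\<in>A. p a = h")
      case True
      \<comment> \<open>What an edge still demands after \<open>h\<close> has been removed from its
        endpoint in \<open>A\<close>. Upper bounds equal to the demand cut off nothing.\<close>
      define m where "m = k - h"
      define s where "s = (\<lambda>v. if v \<in> A then h else 0)"
      have "splittable {} {g. s \<le> g \<and> (\<lambda>v. g v - s v) \<in> capped adj m (\<lambda>_. m) {}}"
        by (intro splittable_shift capped_splittable[OF sym bip leafy]) auto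
      moreover have "{f \<in> F. \<forall>a\<in>A. p a \<le> f a} = {g. s \<le> g \<and> (\<lambda>v. g v - s v) \<in> capped adj m (\<lambda>_. m) {}}"
      proof -
        have s_le: "s \<le> f \<longleftrightarrow> (\<forall>a\<in>A. p a \<le> f a)" for f
          using True by (auto simp: s_def le_fun_def)
        have "f \<in> F \<longleftrightarrow> (\<lambda>v. f v - s v) \<in> capped adj m (\<lambda>_. m) {}" if "s \<le> f" for f
        proof -
          have fA: "h \<le> f a" if "a \<in> A" for a using le_funD[OF \<open>s \<le> f\<close>, of a] that by (simp add: s_def)
          have "k \<le> f a + f b" if "a \<in> A" "b \<in> A" for a b
            using fA[OF that(1)] fA[OF that(2)] by (simp add: h_def)
          moreover have "k \<le> f a + f b \<longleftrightarrow> m \<le> min (f a - s a) m + min (f b - s b) m"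
            if "a \<in> A" "adj a b" for a b
            using fA[OF that(1)] bip[OF that(2)] that(1) by (auto simp: s_def m_def)
          ultimately show ?thesis unfolding F_iff capped_iff by auto
        qed
        then show ?thesis using s_le by auto
      qed
      ultimately show ?thesis by simp
    next
      case False
      then obtain a where a: "a \<in> A" "p a < h" using less.prems by (auto simp: order.strict_iff_order)
      define j where "j = p a"
      have j: "2 * j < k" using a(2) unfolding j_def h_def by linarith
      let ?M = "{f \<in> F. \<forall>a\<in>A. p a \<le> f a}"
      have "splittable {} {f \<in> F. \<forall>b\<in>A. (p(a := Suc j)) b \<le> f b}"
      proof (rule less.hyps)
        show "(\<Sum>b\<in>A. h - (p(a := Suc j)) b) < (\<Sum>b\<in>A. h - p b)"
          by (rule sum_strict_mono_ex1) (use a in \<open>auto simp: j_def\<close>)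
      qed (use less.prems a in \<open>auto simp: j_def\<close>)
      moreover have "{f \<in> ?M. j < f a} = {f \<in> F. \<forall>b\<in>A. (p(a := Suc j)) b \<le> f b}"
        using a by (auto simp: j_def Suc_le_eq intro: less_imp_le)
      ultimately have 1: "splittable {} {f \<in> ?M. j < f a}" by simp
      \<comment> \<open>At \<open>a\<close> nothing is left to vary, hence the bound 0. Neighbours
        of \<open>a\<close> need \<open>k - j\<close>; subtracting only \<open>k - 2 * j\<close>
        there leaves the demand \<open>j\<close>. The same \<open>j\<close> remains for an edge
        between another vertex of \<open>A\<close>, reduced by \<open>k - j\<close>, and a vertex
        not adjacent to \<open>a\<close>, so one constant serves all edges.\<close>
      define q where "q = (\<lambda>_. j)(a := 0)"
      define s where "s = (\<lambda>v. if v = a then j else if v \<in> A then k - j else if adj a v then k - 2 * j else 0)"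
      have irrefl: "\<not> adj b b" for b using bip by blast
      have "splittable {a} {g. s \<le> g \<and> (\<lambda>v. g v - s v) \<in> capped adj j q {a}}"
      proof (intro splittable_shift capped_splittable[OF sym bip leafy])
        show "j \<le> q u + q v" if "adj u v" for u v using that irrefl by (auto simp: q_def)
        have "forced adj j q a \<le> 0"
          by (rule forced_le) (use irrefl in \<open>auto simp: q_def\<close>)
        then show "forced adj j q z = q z" if "z \<in> {a}" for z using that by (simp add: q_def)
      qed
      moreover have "{f \<in> ?M. f a = j} = {g. s \<le> g \<and> (\<lambda>v. g v - s v) \<in> capped adj j q {a}}"
      proof (intro set_eqI iffI)
        fix f assume "f \<in> {f \<in> ?M. f a = j}"
        then have f: "\<And>u v. u \<in> A \<Longrightarrow> adj u v \<Longrightarrow> k \<le> f u + f v"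
          "\<And>u v. u \<in> A \<Longrightarrow> v \<in> A \<Longrightarrow> u \<noteq> v \<Longrightarrow> k \<le> f u + f v" and fa: "f a = j"
          by (auto simp: F_iff)
        have fA: "k - j \<le> f u" if "u \<in> A" "u \<noteq> a" for u using f(2)[OF a(1) that(1)] that fa by simp
        have fN: "k - j \<le> f u" if "adj a u" for u using f(1)[OF a(1) that(1)] fa by simp
        have "s \<le> f" using fA fN fa by (force simp: s_def le_fun_def)
        moreover have "j \<le> min (f u - s u) (q u) + min (f v - s v) (q v)" if "u \<in> A" "adj u v" for u v
        proof -
          have v: "v \<notin> A" "v \<noteq> a" using bip[OF that(2)] that(1) a(1) by auto
          show ?thesis
          proof (cases "adj a v")
            case True
            then have "j \<le> f v - s v" using fN[OF True] v j by (simp add: s_def)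
            then show ?thesis using v by (simp add: q_def)
          next
            case False
            then have "u \<noteq> a" using that by auto
            moreover have "j \<le> min (f u - (k - j)) j + min (f v) j"
              using f(1)[OF that] fA[OF that(1) \<open>u \<noteq> a\<close>] j by linarith
            ultimately show ?thesis using False v that(1) by (simp add: s_def q_def)
          qed
        qed
        ultimately show "f \<in> {g. s \<le> g \<and> (\<lambda>v. g v - s v) \<in> capped adj j q {a}}"
          unfolding capped_iff using fa by (auto simp: s_def q_def)
      next
        fix f assume "f \<in> {g. s \<le> g \<and> (\<lambda>v. g v - s v) \<in> capped adj j q {a}}"
        then have s: "s \<le> f" and f: "\<And>u v. u \<in> A \<Longrightarrow> adj u v \<Longrightarrow> j \<le> min (f u - s u) (q u) + min (f v - s v) (q v)"
          and fa0: "f a - s a = q a"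
          unfolding capped_iff by auto
        have fa: "f a = j" using fa0 le_funD[OF s, of a] by (simp add: s_def q_def)
        have fA: "k - j \<le> f u" if "u \<in> A" "u \<noteq> a" for u using le_funD[OF s, of u] that by (simp add: s_def)
        have fN: "k - j \<le> f u" if "adj a u" for u
        proof -
          have "u \<notin> A" "u \<noteq> a" using bip[OF that] a by auto
          then show ?thesis using f[OF a(1) that] fa that le_funD[OF s, of u] j by (auto simp: s_def q_def)
        qed
        have "k \<le> f u + f v" if "u \<in> A" "adj u v" for u v
        proof (cases "u = a")
          case True
          then show ?thesis using fN[of v] fa that by simp
        next
          case False
          have v: "v \<notin> A" "v \<noteq> a" using bip[OF that(2)] that(1) a(1) by auto
          show ?thesis
          proof (cases "adj a v")
            case True
            then show ?thesis using fN[of v] fA[OF that(1) False] j by simp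
          next
            case 2: False
            then show ?thesis using f[OF that] fA[OF that(1) False] False v that(1) by (auto simp: s_def q_def)
          qed
        qed
        moreover have "k \<le> f u + f v" if "u \<in> A" "v \<in> A" "u \<noteq> v" for u v
          using fA[of u] fA[of v] that fa j by (cases "u = a"; cases "v = a") auto
        moreover have "p u \<le> f u" if "u \<in> A" for u
        proof (cases "u = a")
          case True
          then show ?thesis using fa by (simp add: j_def)
        next
          case False
          have "h \<le> k - j" using j unfolding h_def by linarith
          then show ?thesis using fA[OF that False] less.prems[OF that] by linarith
        qed
        ultimately show "f \<in> {f \<in> ?M. f a = j}" unfolding F_iff using fa by simp
      qed
      ultimately have 2: "splittable (insert a {}) {f \<in> ?M. f a = j}" by simp
      show ?thesis
      proof (rule splittable.split[OF _ _ 1 2])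
        show "j \<le> f a" if "f \<in> ?M" for f using that a by (auto simp: j_def)
        fix f assume fM: "f \<in> ?M" and fa: "f a = j"
        then have f: "\<And>u v. u \<in> A \<Longrightarrow> adj u v \<Longrightarrow> k \<le> f u + f v"
          "\<And>u v. u \<in> A \<Longrightarrow> v \<in> A \<Longrightarrow> u \<noteq> v \<Longrightarrow> k \<le> f u + f v" and fp: "\<And>u. u \<in> A \<Longrightarrow> p u \<le> f u"
          by (auto simp: F_iff)
        obtain b where b: "adj a b" using nbr[OF a(1)] by auto
        have bA: "b \<notin> A" "b \<noteq> a" using bip[OF b] a(1) by auto
        have fb: "k - j \<le> f b" using f(1)[OF a(1) b] fa by simp
        \<comment> \<open>An edge from \<open>b\<close> to another vertex of \<open>A\<close> keeps
          a sum of at least \<open>(k - j) + (k - j - 1)\<close>, and this is at least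
          \<open>k\<close> because \<open>2 * j < k\<close>.\<close>
        let ?f = "f(a := Suc j, b := f b - 1)"
        have "k \<le> ?f u + ?f v" if "u \<in> A" "adj u v" for u v
        proof (cases "v = b")
          case True
          show ?thesis
          proof (cases "u = a")
            case False
            then have "k - j \<le> f u" using f(2)[OF a(1) that(1)] fa by simp
            then show ?thesis using True False bA that fb j by auto
          qed (use True bA fb in auto)
        next
          case False
          then show ?thesis using f(1)[OF that] fa bA that by (auto simp: fun_upd_def)
        qed
        moreover have "k \<le> ?f u + ?f v" if "u \<in> A" "v \<in> A" "u \<noteq> v" for u v
        proof -
          have "f w \<le> ?f w" if "w \<in> A" for w using that bA fa by auto
          then show ?thesis using f(2)[OF that] that by (meson add_mono order_trans)
        qed
        moreover have "p u \<le> ?f u" if "u \<in> A" for u using fp[OF that] that bA fa by auto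
        ultimately have "?f \<in> ?M" unfolding F_iff by blast
        then show "\<exists>t. t \<noteq> a \<and> 0 < f t \<and> f(a := Suc j, t := f t - 1) \<in> ?M"
          using bA fb j by (intro exI[of _ b]) auto
      qed simp
    qed
  qed
  show ?thesis using main[of "\<lambda>_. 0"] unfolding F_def by simp
qed

section \<open>Vertex decomposability of bipartite graphs as a leaf condition\<close>

abbreviation adjacent :: "'v sgraph \<Rightarrow> 'v \<Rightarrow> 'v \<Rightarrow> bool" where
  "adjacent H u v \<equiv> {u, v} \<in> edges H"

lemma remove_verts_sel [simp]:
  "verts (remove_verts H U) = verts H - U"
  "{u, v} \<in> edges (remove_verts H U) \<longleftrightarrow> {u, v} \<in> edges H \<and> u \<notin> U \<and> v \<notin> U"
  by (auto simp: remove_verts_def)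

lemma remove_verts_remove_verts: "remove_verts (remove_verts H U) W = remove_verts H (U \<union> W)"
  by (auto simp: remove_verts_def)

lemma symp_adjacent: "symp (adjacent H)"
  by (simp add: symp_def insert_commute)

text \<open>Members of \<open>S\<close> inside \<open>U\<close> contribute nothing beyond
  \<open>U\<close>, so outside \<open>U\<close> the closed neighbourhood of \<open>S\<close> is that
  of \<open>S - U\<close> in the smaller graph, and the surviving edges are the same.\<close>

lemma has_leaf_outside_remove:
  assumes "leafy (adjacent (remove_verts H U))" "U \<subseteq> closed_hull (adjacent H) S"
    and indep: "\<And>u v. u \<in> S \<Longrightarrow> v \<in> S \<Longrightarrow> \<not> adjacent H u v"
    and nbrs: "\<And>s w. s \<in> S \<Longrightarrow> s \<in> U \<Longrightarrow> adjacent H s w \<Longrightarrow> w \<in> U"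
  shows "has_leaf_outside (adjacent H) (closed_hull (adjacent H) S)"
proof -
  let ?H' = "remove_verts H U"
  have hull: "closed_hull (adjacent H) S = U \<union> closed_hull (adjacent ?H') (S - U)"
    using assms(2) nbrs by (auto simp: closed_hull_def)
  have "has_leaf_outside (adjacent ?H') (closed_hull (adjacent ?H') (S - U))"
    using assms(1) indep unfolding leafy_def by auto
  then show ?thesis unfolding has_leaf_outside_def hull by auto
qed

text \<open>Without such a leaf, some independent set avoiding the closed neighbourhood of
  \<open>x\<close> would be maximal after removal of \<open>x\<close>: it consists of
  \<open>S\<close>, the other survivors on the side of \<open>x\<close>, and the survivors on the
  opposite side that have no surviving neighbour except possibly \<open>x\<close>.\<close>

lemma shedding_leaf:
  assumes shed: "shedding_vertex H x"
    and wf: "\<And>u v. adjacent H u v \<Longrightarrow> u \<in> verts H"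
    and bip: "\<And>u v. adjacent H u v \<Longrightarrow> u \<in> P \<longleftrightarrow> v \<notin> P"
    and indep: "\<And>u v. u \<in> S \<Longrightarrow> v \<in> S \<Longrightarrow> \<not> adjacent H u v"
    and x: "x \<notin> closed_hull (adjacent H) S"
  shows "\<exists>y. adjacent H x y \<and> y \<notin> closed_hull (adjacent H) S \<and>
    (\<forall>w. adjacent H y w \<longrightarrow> w \<notin> closed_hull (adjacent H) S \<longrightarrow> w = x)"
proof (rule ccontr)
  let ?N = "closed_hull (adjacent H) S"
  assume no: "\<not> ?thesis"
  have symD: "adjacent H b a" if "adjacent H a b" for a b using that by (simp add: insert_commute)
  define T where "T = (S \<inter> verts H) \<union>
    {w \<in> verts H. w \<notin> ?N \<and> w \<noteq> x \<and> (w \<in> P \<longleftrightarrow> x \<in> P)} \<union>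
    {y \<in> verts H. y \<notin> ?N \<and> (y \<in> P \<longleftrightarrow> x \<notin> P) \<and> (\<forall>w. adjacent H y w \<longrightarrow> w \<notin> ?N \<longrightarrow> w = x)}"
  have S_nbr: "w \<in> ?N" if "s \<in> S" "adjacent H s w" for s w using that by (auto simp: closed_hull_def)
  have x_T: "t \<noteq> x \<and> \<not> adjacent H x t" if t: "t \<in> T" for t
  proof -
    consider "t \<in> S" | "t \<noteq> x" "t \<in> P \<longleftrightarrow> x \<in> P"
      | "t \<notin> ?N" "t \<in> P \<longleftrightarrow> x \<notin> P" "\<forall>w. adjacent H t w \<longrightarrow> w \<notin> ?N \<longrightarrow> w = x"
      using t by (auto simp: T_def)
    then show ?thesis
    proof cases
      case 1
      then show ?thesis using x S_nbr symD by (auto simp: closed_hull_def)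
    next
      case 2
      then show ?thesis using bip[of x t] by auto
    next
      case 3
      then show ?thesis using no by auto
    qed
  qed
  have T_indep: "\<not> adjacent H a b" if ab: "a \<in> T" "b \<in> T" for a b
  proof
    assume adj: "adjacent H a b"
    show False
    proof (cases "a \<in> S \<or> b \<in> S")
      case True
      then show False
        using ab adj indep S_nbr symD[OF adj] by (auto simp: T_def)
    next
      case False
      then have "a \<notin> ?N" "b \<notin> ?N" using ab by (auto simp: T_def)
      moreover have "a \<noteq> x" "b \<noteq> x" using x_T ab by auto
      ultimately show False using False ab bip[OF adj] adj symD[OF adj] by (auto simp: T_def)
    qed
  qed
  have T_verts: "T \<subseteq> verts H" by (auto simp: T_def)
  have "independent_set (remove_verts H (closed_nbhd H x)) T"
    using T_verts T_indep x_T by (auto simp: independent_set_def closed_nbhd_def)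
  moreover have "maximal_independent_set (remove_verts H {x}) T"
    unfolding maximal_independent_set_def
  proof (intro conjI allI impI)
    show "independent_set (remove_verts H {x}) T"
      using T_verts T_indep x_T by (auto simp: independent_set_def)
    fix T' assume T': "independent_set (remove_verts H {x}) T' \<and> T \<subseteq> T'"
    then have T'_indep: "\<not> adjacent H a b" if "a \<in> T'" "b \<in> T'" for a b
      using that by (auto simp: independent_set_def)
    \<comment> \<open>A vertex missing from \<open>T\<close> is adjacent to \<open>S\<close>, or has
      a surviving neighbour on the side of \<open>x\<close> that is in \<open>T\<close>.\<close>
    have "w \<in> T" if w: "w \<in> T'" for w
    proof (rule ccontr)
      assume wT: "w \<notin> T"
      have wv: "w \<in> verts H" "w \<noteq> x" using w T' by (auto simp: independent_set_def)
      show False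
      proof (cases "w \<in> ?N")
        case True
        then obtain s where "s \<in> S" "adjacent H s w" using wT wv by (auto simp: closed_hull_def T_def)
        then show False using T'_indep[of s w] w wf T' by (auto simp: T_def)
      next
        case False
        then obtain w' where w': "adjacent H w w'" "w' \<notin> ?N" "w' \<noteq> x" "w \<in> P \<longleftrightarrow> x \<notin> P"
          using wT wv unfolding T_def by blast
        then have "w' \<in> T" using bip[OF w'(1)] wf[OF symD[OF w'(1)]] by (auto simp: T_def)
        then show False using T'_indep[OF w, of w'] w'(1) T' by auto
      qed
    qed
    then show "T' = T" using T' by auto
  qed
  ultimately show False using shed by (auto simp: shedding_vertex_def)
qed

text \<open>If \<open>x\<close> lies in \<open>S\<close>, its closed neighbourhood can be removed;
  if \<open>x\<close> is adjacent to \<open>S\<close>, the vertex \<open>x\<close> alone can; in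
  both cases the leaf comes from the smaller graph. If \<open>x\<close> survives,
  \<open>shedding_leaf\<close> gives it directly.\<close>

lemma vertex_decomposable_imp_leafy:
  assumes "vertex_decomposable H"
    and "\<And>u v. adjacent H u v \<Longrightarrow> u \<in> verts H"
    and "\<And>u v. adjacent H u v \<Longrightarrow> u \<in> P \<longleftrightarrow> v \<notin> P"
  shows "leafy (adjacent H)"
  using assms
proof (induction rule: vertex_decomposable.induct)
  case (no_edges H)
  then show ?case by (simp add: leafy_def has_leaf_outside_def)
next
  case (shed H x)
  have 1: "leafy (adjacent (remove_verts H {x}))"
    using shed.prems by (intro shed.IH) auto
  have 2: "leafy (adjacent (remove_verts H (closed_nbhd H x)))"
    using shed.prems by (intro shed.IH) (auto simp: closed_nbhd_def)
  show ?case
    unfolding leafy_def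
  proof (intro allI impI)
    fix S assume "\<forall>u\<in>S. \<forall>v\<in>S. \<not> adjacent H u v"
    then have S: "\<And>u v. u \<in> S \<Longrightarrow> v \<in> S \<Longrightarrow> \<not> adjacent H u v" by auto
    let ?N = "closed_hull (adjacent H) S"
    consider "x \<in> S" | "x \<notin> S" "x \<in> ?N" | "x \<notin> ?N" by (auto simp: closed_hull_def)
    then show "has_leaf_outside (adjacent H) ?N"
    proof cases
      case 1
      show ?thesis
        by (rule has_leaf_outside_remove[OF 2 _ S])
          (use 1 S in \<open>auto simp: closed_nbhd_def closed_hull_def insert_commute\<close>)
    next
      case x: 2
      show ?thesis
        by (rule has_leaf_outside_remove[OF 1 _ S]) (use x in auto)
    next
      case 3
      have "\<exists>y. adjacent H x y \<and> y \<notin> ?N \<and> (\<forall>w. adjacent H y w \<longrightarrow> w \<notin> ?N \<longrightarrow> w = x)"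
        by (rule shedding_leaf[where P = P, OF shed.hyps(1)]) (fact shed.prems S 3)+
      then show ?thesis using 3 unfolding has_leaf_outside_def by blast
    qed
  qed
qed

text \<open>The neighbour \<open>z\<close> of a leaf \<open>t\<close> is shedding: an independent
  set that avoids the closed neighbourhood of \<open>z\<close> can be enlarged by \<open>t\<close>.
  Removing \<open>z\<close> isolates \<open>t\<close>, which then joins \<open>S\<close>; removing
  the closed neighbourhood of \<open>z\<close> puts \<open>z\<close> into \<open>S\<close>. Isolated
  vertices may stay behind, so \<open>T\<close> is only confined between the open and the closed
  neighbourhood of \<open>S\<close>.\<close>

lemma leafy_imp_vertex_decomposable_remove:
  fixes H :: "'v::finite sgraph"
  assumes V: "verts H = UNIV" and irrefl: "\<And>u. \<not> adjacent H u u" and leafy: "leafy (adjacent H)"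
    and simple: "edges H \<subseteq> {{u, v} | u v. True}"
    and S: "\<And>u v. u \<in> S \<Longrightarrow> v \<in> S \<Longrightarrow> \<not> adjacent H u v"
    and nbrs: "\<And>s w. s \<in> S \<Longrightarrow> adjacent H s w \<Longrightarrow> w \<in> T" and T: "T \<subseteq> closed_hull (adjacent H) S"
  shows "vertex_decomposable (remove_verts H T)"
  using S nbrs T
proof (induction "card (- T)" arbitrary: S T rule: less_induct)
  case less
  let ?N = "closed_hull (adjacent H) S"
  have symD: "adjacent H b a" if "adjacent H a b" for a b using that by (simp add: insert_commute)
  have alive: "u \<notin> ?N" if "u \<notin> T" "v \<notin> T" "adjacent H u v" for u v
    using that less.prems(2) by (auto simp: closed_hull_def)
  show ?case
  proof (cases "edges (remove_verts H T) = {}")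
    case True
    then show ?thesis by (rule vertex_decomposable.no_edges)
  next
    case False
    then obtain e where "e \<in> edges (remove_verts H T)" by auto
    moreover from this obtain u v where "e = {u, v}" using simple by (auto simp: remove_verts_def)
    ultimately have uv: "adjacent H u v" "u \<notin> T" "v \<notin> T" by auto
    have "has_leaf_outside (adjacent H) ?N" using leafy less.prems(1) unfolding leafy_def by blast
    then obtain z t where zt: "adjacent H z t" "z \<notin> ?N" "t \<notin> ?N"
      and leaf: "\<And>w. adjacent H t w \<Longrightarrow> w \<notin> ?N \<Longrightarrow> w = z"
      using uv alive[OF uv(2,3,1)] alive[OF uv(3,2) symD[OF uv(1)]]
      unfolding has_leaf_outside_def by metis
    have zT: "z \<notin> T" "t \<notin> T" using zt less.prems(3) by auto
    have leafT: "w = z" if "adjacent H t w" "w \<notin> T" for w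
      using leaf[OF that(1)] alive[OF that(2) zT(2) symD[OF that(1)]] by auto
    have S_t: "\<not> adjacent H s t" "\<not> adjacent H s z" if "s \<in> S" for s
      using that zt by (auto simp: closed_hull_def)
    let ?H = "remove_verts H T"
    have shed: "shedding_vertex ?H z"
      unfolding shedding_vertex_def
    proof (intro conjI notI)
      show "z \<in> verts ?H" using V zT by simp
      assume "\<exists>I. independent_set (remove_verts ?H (closed_nbhd ?H z)) I \<and>
          maximal_independent_set (remove_verts ?H {z}) I"
      then obtain I where I: "independent_set (remove_verts ?H (closed_nbhd ?H z)) I"
        and max: "maximal_independent_set (remove_verts ?H {z}) I" by auto
      have "t \<notin> I" using I zt(1) zT by (auto simp: independent_set_def closed_nbhd_def)
      have "independent_set (remove_verts ?H {z}) I" using max by (simp add: maximal_independent_set_def)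
      then have "I \<subseteq> - T - {z}" and I_indep: "\<And>a b. a \<in> I \<Longrightarrow> b \<in> I \<Longrightarrow> \<not> adjacent H a b"
        by (auto simp: independent_set_def)
      then have tI: "\<not> adjacent H t a" if "a \<in> I" for a using leafT that by blast
      have "t \<noteq> z" using zt(1) irrefl by auto
      then have "independent_set (remove_verts ?H {z}) (insert t I)"
        unfolding independent_set_def
        using V zT \<open>I \<subseteq> _\<close> I_indep tI irrefl by (auto simp: insert_commute)
      then have "insert t I = I" using max unfolding maximal_independent_set_def by blast
      then show False using \<open>t \<notin> I\<close> by auto
    qed
    have "vertex_decomposable (remove_verts H (T \<union> {z}))"
    proof (rule less.hyps[of _ "insert t S"])
      show "card (- (T \<union> {z})) < card (- T)" using zT by (intro psubset_card_mono) auto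
      show "\<not> adjacent H u v" if "u \<in> insert t S" "v \<in> insert t S" for u v
        using that less.prems(1) irrefl S_t symD by blast
      show "w \<in> T \<union> {z}" if "s \<in> insert t S" "adjacent H s w" for s w
        using that less.prems(2) leafT by auto
      show "T \<union> {z} \<subseteq> closed_hull (adjacent H) (insert t S)"
        using less.prems(3) symD[OF zt(1)] by (auto simp: closed_hull_def)
    qed
    moreover have "vertex_decomposable (remove_verts H (T \<union> closed_nbhd ?H z))"
    proof (rule less.hyps[of _ "insert z S"])
      show "card (- (T \<union> closed_nbhd ?H z)) < card (- T)"
        using zT by (intro psubset_card_mono) (auto simp: closed_nbhd_def)
      show "\<not> adjacent H u v" if "u \<in> insert z S" "v \<in> insert z S" for u v
        using that less.prems(1) irrefl S_t symD by blast
      show "w \<in> T \<union> closed_nbhd ?H z" if "s \<in> insert z S" "adjacent H s w" for s w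
        using that less.prems(2) zT by (auto simp: closed_nbhd_def)
      show "T \<union> closed_nbhd ?H z \<subseteq> closed_hull (adjacent H) (insert z S)"
        using less.prems(3) by (auto simp: closed_hull_def closed_nbhd_def)
    qed
    ultimately show ?thesis
      using vertex_decomposable.shed[OF shed] by (simp add: remove_verts_remove_verts)
  qed
qed

lemma vertex_decomposable_iff_leafy:
  fixes H :: "'v::finite sgraph"
  assumes V: "verts H = UNIV" and simple: "edges H \<subseteq> {{u, v} | u v. True}"
    and bip: "\<And>u v. adjacent H u v \<Longrightarrow> u \<in> P \<longleftrightarrow> v \<notin> P"
  shows "vertex_decomposable H \<longleftrightarrow> leafy (adjacent H)"
proof
  show "leafy (adjacent H)" if "vertex_decomposable H"
    using vertex_decomposable_imp_leafy[OF that _ bip] V by simp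
  assume "leafy (adjacent H)"
  moreover have "\<not> adjacent H u u" for u using bip by blast
  ultimately have "vertex_decomposable (remove_verts H {})"
    using V simple by (intro leafy_imp_vertex_decomposable_remove[where S = "{}"]) (auto simp: closed_hull_def)
  moreover have "remove_verts H {} = H" by (simp add: remove_verts_def)
  ultimately show "vertex_decomposable H" by simp
qed

section \<open>Monomial ideals\<close>

abbreviation lookup where "lookup \<equiv> Poly_Mapping.lookup"
abbreviation keys where "keys \<equiv> Poly_Mapping.keys"
abbreviation single where "single \<equiv> Poly_Mapping.single"

lemma module_times: "module ((*) :: 'r::comm_ring_1 \<Rightarrow> 'r \<Rightarrow> 'r)"
  by standard (simp_all add: algebra_simps)

lemmas span_times_minimal = module.span_minimal[OF module_times]
lemmas span_times_scale = module.span_scale[OF module_times]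
lemmas span_times_base = module.span_base[OF module_times]
lemmas span_times_sum = module.span_sum[OF module_times]
lemmas subspace_times_def = module.subspace_def[OF module_times]

lemma poly_eq_sum_single: "p = (\<Sum>k\<in>keys p. single k (lookup p k))"
proof (rule poly_mapping_eqI)
  fix m
  have "lookup (\<Sum>k\<in>keys p. single k (lookup p k)) m = (\<Sum>k\<in>keys p. if k = m then lookup p k else 0)"
    by (simp add: lookup_sum lookup_single when_def)
  also have "\<dots> = lookup p m" by (simp add: in_keys_iff)
  finally show "lookup p m = lookup (\<Sum>k\<in>keys p. single k (lookup p k)) m" by simp
qed

lemma adds_iff: "(\<exists>k. m = k + s) \<longleftrightarrow> lookup s \<le> lookup m" for m s :: "'v \<Rightarrow>\<^sub>0 nat"
proof
  assume "lookup s \<le> lookup m"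
  then have "m = (m - s) + s"
    by (intro poly_mapping_eqI) (simp add: lookup_add lookup_minus le_fun_def)
  then show "\<exists>k. m = k + s" by blast
qed (auto simp: lookup_add le_fun_def)

lemma lookup_times_single:
  fixes p :: "('v, 'k::field) mpoly"
  shows "lookup (p * single s a) m = (if lookup s \<le> lookup m then lookup p (m - s) * a else 0)"
proof -
  have "p * single s a = (\<Sum>k\<in>keys p. single (k + s) (lookup p k * a))"
    by (subst poly_eq_sum_single[of p]) (simp add: sum_distrib_right mult_single)
  then have *: "lookup (p * single s a) m = (\<Sum>k\<in>keys p. if k + s = m then lookup p k * a else 0)"
    by (simp add: lookup_sum lookup_single when_def)
  show ?thesis
  proof (cases "lookup s \<le> lookup m")
    case True
    then obtain k where k: "m = k + s" using adds_iff by blast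
    then have "lookup (p * single s a) m = (\<Sum>k'\<in>keys p. if k' = k then lookup p k' * a else 0)"
      unfolding * by (intro sum.cong) auto
    then show ?thesis using True k by (simp add: in_keys_iff)
  next
    case False
    then have "k + s \<noteq> m" for k using adds_iff by metis
    then show ?thesis unfolding * using False by simp
  qed
qed

lemma lookup_times:
  fixes p q :: "('v, 'k::field) mpoly"
  shows "lookup (p * q) m = (\<Sum>s\<in>keys q. if lookup s \<le> lookup m then lookup p (m - s) * lookup q s else 0)"
proof -
  have "p * q = (\<Sum>s\<in>keys q. p * single s (lookup q s))"
    by (subst poly_eq_sum_single[of q]) (simp add: sum_distrib_left)
  then show ?thesis by (simp add: lookup_sum lookup_times_single)
qed

lemma lookup_times_monomial_add:
  "lookup (p * monomial s) (m + s) = lookup p m" "lookup (monomial s * p) (s + m) = lookup p m"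
  by (simp_all add: monomial_def lookup_times_single mult.commute[of _ p] le_fun_def lookup_add
      add.commute[of s])

lemma monomial_times: "monomial (s + t) = monomial s * monomial t"
  by (simp add: monomial_def mult_single)

lemma keys_monomial [simp]: "keys (monomial m) = {m}"
  by (simp add: monomial_def)

lemma keys_timesE:
  assumes "m \<in> keys (p * q)"
  obtains a b where "a \<in> keys p" "b \<in> keys q" "m = a + b"
  using assms keys_mult[of p q] by auto

lemma in_keys_sumE:
  assumes "m \<in> keys (sum f A)"
  obtains a where "a \<in> A" "m \<in> keys (f a)"
  using assms Poly_Mapping.keys_sum[of f A] by auto

lemma monomial_times_cancel:
  fixes p :: "('v, 'k::field) mpoly"
  assumes "monomial s * p = 0"
  shows "p = 0"
proof (rule poly_mapping_eqI)
  fix m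
  have "lookup (monomial s * p) (s + m) = 0" using assms by simp
  then show "lookup p m = lookup 0 m" by (simp add: lookup_times_monomial_add)
qed

text \<open>Defined for every \<open>F\<close>, and an ideal as soon as \<open>F\<close> is
  up-closed. Exponents are plain functions so that the combinatorial part applies directly.\<close>

definition mon_ideal :: "('v \<Rightarrow> nat) set \<Rightarrow> ('v, 'k::field) mpoly set" where
  "mon_ideal F = {p. \<forall>m\<in>keys p. lookup m \<in> F}"

definition up_closed :: "('v \<Rightarrow> nat) set \<Rightarrow> bool" where
  "up_closed F \<longleftrightarrow> (\<forall>f g. f \<in> F \<longrightarrow> f \<le> g \<longrightarrow> g \<in> F)"

definition up :: "('v \<Rightarrow> nat) set \<Rightarrow> ('v \<Rightarrow> nat) set" where
  "up S = {g. \<exists>f\<in>S. f \<le> g}"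

lemma up_closed_up: "up_closed (up S)"
  unfolding up_closed_def up_def by (blast intro: order_trans)

lemma lookup_plus: "lookup (a + b) = (\<lambda>v. lookup a v + lookup b v)"
  by (auto simp: lookup_add)

lemma subspace_mon_ideal:
  assumes "up_closed F"
  shows "module.subspace (*) (mon_ideal F)"
  unfolding subspace_times_def
proof (intro conjI ballI allI)
  show "0 \<in> mon_ideal F" by (simp add: mon_ideal_def)
  show "p + q \<in> mon_ideal F" if "p \<in> mon_ideal F" "q \<in> mon_ideal F" for p q
    using that keys_add[of p q] by (auto simp: mon_ideal_def)
  show "c * p \<in> mon_ideal F" if "p \<in> mon_ideal F" for c p
    unfolding mon_ideal_def
  proof (intro CollectI ballI)
    fix m assume "m \<in> keys (c * p)"
    then obtain a b where "a \<in> keys c" "b \<in> keys p" "m = a + b" by (rule keys_timesE)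
    moreover have "lookup b \<le> lookup (a + b)" by (simp add: le_fun_def lookup_add)
    ultimately show "lookup m \<in> F" using that assms by (auto simp: mon_ideal_def up_closed_def)
  qed
qed

lemma single_add_eq: "single (l + s) c = single l c * monomial s"
  by (simp add: monomial_def mult_single)

lemma ideal_gen_monomial: "ideal_gen (monomial ` S) = mon_ideal (up (lookup ` S))"
proof
  show "ideal_gen (monomial ` S) \<subseteq> mon_ideal (up (lookup ` S))"
    unfolding ideal_gen_def
    by (intro span_times_minimal subspace_mon_ideal up_closed_up) (auto simp: mon_ideal_def up_def)
  show "mon_ideal (up (lookup ` S)) \<subseteq> ideal_gen (monomial ` S)"
  proof
    fix p assume p: "p \<in> mon_ideal (up (lookup ` S))"
    have "single k (lookup p k) \<in> module.span (*) (monomial ` S)" if k: "k \<in> keys p" for k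
    proof -
      obtain s where "s \<in> S" "lookup s \<le> lookup k" using p k by (force simp: mon_ideal_def up_def)
      then obtain l where "k = l + s" using adds_iff by blast
      then have "single k (lookup p k) = single l (lookup p k) * monomial s"
        by (metis single_add_eq)
      then show ?thesis using \<open>s \<in> S\<close> by (auto intro: span_times_scale span_times_base)
    qed
    then have "(\<Sum>k\<in>keys p. single k (lookup p k)) \<in> module.span (*) (monomial ` S)"
      by (rule span_times_sum)
    then show "p \<in> ideal_gen (monomial ` S)"
      unfolding ideal_gen_def poly_eq_sum_single[symmetric] .
  qed
qed

lemma ideal_gen_family:
  "ideal_gen (g ` {..<b}) = {\<Sum>j<b. g j * w j | w. True}" for g :: "nat \<Rightarrow> 'r::comm_ring_1"
proof
  let ?R = "{\<Sum>j<b. g j * w j | w. True}"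
  have "module.subspace (*) ?R"
    unfolding subspace_times_def
  proof (intro conjI ballI allI)
    show "0 \<in> ?R" by (auto intro!: exI[of _ "\<lambda>_. 0"])
    show "p + q \<in> ?R" if pq: "p \<in> ?R" "q \<in> ?R" for p q
    proof -
      obtain v w where "p = (\<Sum>j<b. g j * v j)" "q = (\<Sum>j<b. g j * w j)" using pq by auto
      then have "p + q = (\<Sum>j<b. g j * (v j + w j))" by (simp add: distrib_left sum.distrib)
      then show ?thesis by auto
    qed
    show "c * p \<in> ?R" if p: "p \<in> ?R" for c p
    proof -
      obtain v where "p = (\<Sum>j<b. g j * v j)" using p by auto
      then have "c * p = (\<Sum>j<b. g j * (c * v j))" by (simp add: sum_distrib_left ac_simps)
      then show ?thesis by auto
    qed
  qed
  moreover have "g ` {..<b} \<subseteq> ?R"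
  proof
    fix y assume "y \<in> g ` {..<b}"
    then obtain i where i: "i < b" "y = g i" by auto
    then have "y = (\<Sum>j<b. g j * (if j = i then 1 else 0))" by (simp add: if_distrib cong: if_cong)
    then show "y \<in> ?R" by (intro CollectI exI[of _ "\<lambda>j. if j = i then 1 else 0"] conjI TrueI)
  qed
  ultimately show "ideal_gen (g ` {..<b}) \<subseteq> ?R"
    unfolding ideal_gen_def by (intro span_times_minimal)
  show "?R \<subseteq> ideal_gen (g ` {..<b})"
  proof clarify
    fix w
    show "(\<Sum>j<b. g j * w j) \<in> ideal_gen (g ` {..<b})"
      unfolding ideal_gen_def
    proof (rule span_times_sum)
      fix j assume "j \<in> {..<b}"
      then have "w j * g j \<in> module.span (*) (g ` {..<b})"
        by (intro span_times_scale span_times_base) auto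
      then show "g j * w j \<in> module.span (*) (g ` {..<b})" by (simp add: mult.commute)
    qed
  qed
qed

lemma Var_ideal:
  "ideal_gen (Var ` W :: ('v, 'k::field) mpoly set) = mon_ideal {f. \<exists>v\<in>W. 0 < f v}"
proof -
  have "(Var ` W :: ('v, 'k) mpoly set) = monomial ` (\<lambda>v. single v 1) ` W" by (auto simp: Var_def)
  moreover have "up (lookup ` (\<lambda>v. single v 1) ` W) = {f. \<exists>v\<in>W. 0 < f v}"
    by (auto simp: up_def le_fun_def lookup_single when_def Suc_le_eq)
  ultimately show ?thesis by (simp only: ideal_gen_monomial)
qed

text \<open>Dividing a monomial of degree at least \<open>Suc k\<close> in the two variables by one
  that occurs leaves degree at least \<open>k\<close>; this is the step from \<open>k\<close> to
  \<open>Suc k\<close>.\<close>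

lemma Var_edge_power:
  fixes u v :: 'v
  assumes "u \<noteq> v"
  shows "(ideal_power (ideal_gen (Var ` {u, v})) k :: ('v, 'k::field) mpoly set) = mon_ideal {f. k \<le> f u + f v}"
proof (induction k)
  case 0
  then show ?case by (simp add: mon_ideal_def)
next
  case (Suc k)
  let ?E = "\<lambda>k. {f. k \<le> f u + f v}"
  let ?V = "mon_ideal {f. \<exists>x\<in>{u, v}. 0 < f x} :: ('v, 'k) mpoly set"
  have up: "up_closed (?E k)" for k
    unfolding up_closed_def le_fun_def mem_Collect_eq by (meson add_mono order_trans)
  have "ideal_prod ?V (mon_ideal (?E k)) \<subseteq> mon_ideal (?E (Suc k))"
    unfolding ideal_prod_def ideal_gen_def
  proof (intro span_times_minimal subspace_mon_ideal up subsetI)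
    fix y assume "y \<in> {a * b | a b. a \<in> ?V \<and> b \<in> mon_ideal (?E k)}"
    then obtain a b where ab: "y = a * b" "a \<in> ?V" "b \<in> mon_ideal (?E k)"
      by auto
    show "y \<in> mon_ideal (?E (Suc k))"
      unfolding mon_ideal_def
    proof (intro CollectI ballI)
      fix m assume "m \<in> keys y"
      then obtain i j where "i \<in> keys a" "j \<in> keys b" "m = i + j" using ab(1) by (auto elim: keys_timesE)
      then show "Suc k \<le> lookup m u + lookup m v"
        using ab(2,3) by (force simp: mon_ideal_def lookup_add)
    qed
  qed
  moreover have "mon_ideal (?E (Suc k)) \<subseteq> ideal_prod ?V (mon_ideal (?E k))"
  proof
    fix p :: "('v, 'k) mpoly" assume p: "p \<in> mon_ideal (?E (Suc k))"
    let ?P = "{a * b | a b. a \<in> ?V \<and> b \<in> mon_ideal (?E k)} :: ('v, 'k) mpoly set"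
    have "single m (lookup p m) \<in> module.span (*) ?P" if "m \<in> keys p" for m
    proof -
      have m: "Suc k \<le> lookup m u + lookup m v" using p that by (simp add: mon_ideal_def)
      then have "0 < lookup m u \<or> 0 < lookup m v" by linarith
      then obtain x where x: "x \<in> {u, v}" "0 < lookup m x" by auto
      then have "lookup (single x 1) \<le> lookup m" by (auto simp: le_fun_def lookup_single when_def)
      then obtain l where l: "m = l + single x 1" using adds_iff by blast
      have "k \<le> lookup l u + lookup l v"
        using m x(1) assms by (auto simp: l lookup_add lookup_single when_def split: if_splits)
      then have "monomial (single x 1) * monomial l \<in> ?P"
        using x(1) by (intro CollectI exI[of _ "monomial (single x 1)"] exI[of _ "monomial l"])
          (auto simp: mon_ideal_def)
      then have "single 0 (lookup p m) * (monomial (single x 1) * monomial l) \<in> module.span (*) ?P"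
        by (intro span_times_scale span_times_base)
      also have "single 0 (lookup p m) * (monomial (single x 1) * monomial l) = single m (lookup p m)"
        by (simp add: l monomial_def mult_single add.commute)
      finally show ?thesis .
    qed
    then have "(\<Sum>k\<in>keys p. single k (lookup p k)) \<in> module.span (*) ?P"
      by (rule span_times_sum)
    then show "p \<in> ideal_prod ?V (mon_ideal (?E k))"
      unfolding ideal_prod_def ideal_gen_def poly_eq_sum_single[symmetric] .
  qed
  ultimately show ?case unfolding ideal_power.simps(2) Suc.IH unfolding Var_ideal by (rule subset_antisym)
qed

definition edge_exponents :: "'v sgraph \<Rightarrow> nat \<Rightarrow> ('v \<Rightarrow> nat) set" where
  "edge_exponents G k = {f. \<forall>u v. {u, v} \<in> edges G \<longrightarrow> k \<le> f u + f v}"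

lemma cover_ideal_symbolic_power_eq:
  fixes G :: "'v sgraph"
  assumes "simple_graph G"
  shows "(cover_ideal_symbolic_power G k :: ('v, 'k::field) mpoly set) = mon_ideal (edge_exponents G k)"
proof -
  have "(ideal_power (ideal_gen (Var ` e)) k :: ('v, 'k) mpoly set) = mon_ideal {f. \<forall>u v. e = {u, v} \<longrightarrow> k \<le> f u + f v}"
    if eG: "e \<in> edges G" for e
  proof -
    obtain u v where e: "e = {u, v}" "u \<noteq> v" using assms eG by (auto simp: simple_graph_def)
    have "{f. \<forall>a b. e = {a, b} \<longrightarrow> k \<le> f a + f b} = {f. k \<le> f u + f v}"
      using e by (auto simp: doubleton_eq_iff add.commute)
    then show ?thesis unfolding e(1) by (simp only: Var_edge_power[OF e(2)])
  qed
  then have "(cover_ideal_symbolic_power G k :: ('v, 'k) mpoly set) = (\<Inter>e\<in>edges G. mon_ideal {f. \<forall>u v. e = {u, v} \<longrightarrow> k \<le> f u + f v})"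
    unfolding cover_ideal_symbolic_power_def by simp
  also have "\<dots> = mon_ideal (edge_exponents G k)"
    by (auto simp: mon_ideal_def edge_exponents_def)
  finally show ?thesis .
qed

section \<open>Degrees and homogeneous components\<close>

lemma mdeg_eq_sum: "mdeg m = sum (lookup m) UNIV" for m :: "'v::finite \<Rightarrow>\<^sub>0 nat"
  unfolding mdeg_def by (rule sum.mono_neutral_left) (auto simp: in_keys_iff)

lemma mdeg_add: "mdeg (a + b) = mdeg a + mdeg b" for a b :: "'v::finite \<Rightarrow>\<^sub>0 nat"
  by (simp add: mdeg_eq_sum lookup_add sum.distrib)

lemma homogeneous_0 [simp]: "homogeneous d 0"
  by (simp add: homogeneous_def)

lemma homogeneous_uminus: "homogeneous d p \<Longrightarrow> homogeneous d (- p)"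
  by (simp add: homogeneous_def in_keys_iff)

lemma homogeneous_sum: "(\<And>a. a \<in> A \<Longrightarrow> homogeneous d (f a)) \<Longrightarrow> homogeneous d (sum f A)"
  by (auto simp: homogeneous_def elim!: in_keys_sumE)

lemma homogeneous_times:
  "homogeneous d p \<Longrightarrow> homogeneous e q \<Longrightarrow> homogeneous (d + e) (p * q)"
  for p q :: "('v::finite, 'k::field) mpoly"
  by (auto simp: homogeneous_def mdeg_add elim!: keys_timesE)

lemma homogeneous_monomial: "homogeneous d (monomial m) \<longleftrightarrow> mdeg m = d"
  by (simp add: homogeneous_def)

lemma homogeneous_Var: "homogeneous 1 (Var v)"
  by (simp add: Var_def homogeneous_monomial mdeg_def)

definition hcomp :: "nat \<Rightarrow> ('v, 'k::field) mpoly \<Rightarrow> ('v, 'k) mpoly" where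
  "hcomp d p = (\<Sum>m\<in>{m \<in> keys p. mdeg m = d}. single m (lookup p m))"

lemma lookup_hcomp: "lookup (hcomp d p) m = (if mdeg m = d then lookup p m else 0)"
proof -
  have "lookup (hcomp d p) m = (\<Sum>k\<in>{m \<in> keys p. mdeg m = d}. if k = m then lookup p k else 0)"
    by (simp add: hcomp_def lookup_sum lookup_single when_def)
  then show ?thesis by (simp add: in_keys_iff)
qed

lemma homogeneous_hcomp: "homogeneous d (hcomp d p)"
  by (auto simp: homogeneous_def in_keys_iff lookup_hcomp split: if_splits)

lemma hcomp_homogeneous: "homogeneous d p \<Longrightarrow> hcomp e p = (if e = d then p else 0)"
  by (rule poly_mapping_eqI) (auto simp: homogeneous_def lookup_hcomp in_keys_iff)

lemma hcomp_sum: "hcomp d (sum f A) = (\<Sum>a\<in>A. hcomp d (f a))"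
  by (rule poly_mapping_eqI) (simp add: lookup_hcomp lookup_sum)

lemma hcomp_times:
  fixes g p :: "('v::finite, 'k::field) mpoly"
  assumes "homogeneous e g"
  shows "hcomp (e + d) (g * p) = g * hcomp d p"
proof -
  have "hcomp (e + d) (g * single k c) = (if mdeg k = d then g * single k c else 0)" for k c
  proof -
    have "homogeneous (mdeg k) (single k c)" by (simp add: homogeneous_def)
    from hcomp_homogeneous[OF homogeneous_times[OF assms this]] show ?thesis by auto
  qed
  moreover have "g * p = (\<Sum>k\<in>keys p. g * single k (lookup p k))"
    by (subst poly_eq_sum_single[of p]) (simp add: sum_distrib_left)
  ultimately have "hcomp (e + d) (g * p) = (\<Sum>k\<in>keys p. if mdeg k = d then g * single k (lookup p k) else 0)"
    by (simp add: hcomp_sum)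
  also have "\<dots> = g * hcomp d p"
    by (simp add: hcomp_def sum_distrib_left sum.inter_filter[symmetric])
  finally show ?thesis .
qed

text \<open>Makes lifts of linear vectors linear again: the coefficients are replaced by their
  components of the right degree.\<close>

lemma hcomp_lincomb:
  fixes g w :: "nat \<Rightarrow> ('v::finite, 'k::field) mpoly"
  assumes "\<And>j. j < b \<Longrightarrow> homogeneous e (g j)" "homogeneous (e + d) (\<Sum>j<b. g j * w j)"
  shows "(\<Sum>j<b. g j * hcomp d (w j)) = (\<Sum>j<b. g j * w j)"
proof -
  have "(\<Sum>j<b. g j * w j) = hcomp (e + d) (\<Sum>j<b. g j * w j)"
    using hcomp_homogeneous[OF assms(2)] by simp
  also have "\<dots> = (\<Sum>j<b. g j * hcomp d (w j))"
    unfolding hcomp_sum by (intro sum.cong) (simp_all add: hcomp_times assms(1))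
  finally show ?thesis by simp
qed

section \<open>Linear resolutions\<close>

text \<open>
  \<open>linear_syzygies b S\<close>: the submodule \<open>S\<close> of \<open>R\<^sup>b\<close> has a resolution all of whose matrices
  consist of linear forms.
\<close>
coinductive linear_syzygies :: "nat \<Rightarrow> (nat \<Rightarrow> ('v, 'k::field) mpoly) set \<Rightarrow> bool" where
  step: "(\<And>r c. r < b \<Longrightarrow> c < b' \<Longrightarrow> homogeneous 1 (N r c)) \<Longrightarrow>
    S = {w. \<exists>z. \<forall>r<b. w r = (\<Sum>c<b'. N r c * z c)} \<Longrightarrow>
    linear_syzygies b' {z. \<forall>r<b. (\<Sum>c<b'. N r c * z c) = 0} \<Longrightarrow>
    linear_syzygies b S"

lemma linear_syzygies_unfold:
  assumes "linear_syzygies b S"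
  shows "\<exists>b' N. (\<forall>r<b. \<forall>c<b'. homogeneous 1 (N r c)) \<and>
    S = {w. \<exists>z. \<forall>r<b. w r = (\<Sum>c<b'. N r c * z c)} \<and>
    linear_syzygies b' {z. \<forall>r<b. (\<Sum>c<b'. N r c * z c) = 0}"
  using assms
proof cases
  case (step b' N)
  then show ?thesis by (intro exI[of _ b'] exI[of _ N] conjI) auto
qed

text \<open>A coinductive derivation provides only the next matrix; dependent choice turns it into
  the infinite sequences of ranks and matrices.\<close>

lemma linear_syzygies_imp_resolution:
  fixes g :: "nat \<Rightarrow> ('v, 'k::field) mpoly"
  assumes lin: "linear_syzygies b {w. (\<Sum>j<b. g j * w j) = 0}"
    and hom: "\<And>j. j < b \<Longrightarrow> homogeneous d (g j)"
  shows "has_linear_resolution (ideal_gen (g ` {..<b}))"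
proof -
  \<comment> \<open>A state \<open>(b, b', N)\<close> is a matrix with its numbers of rows and
    columns. Exactness says that the image of each state is the kernel of the preceding one.\<close>
  define ker :: "nat \<times> nat \<times> (nat \<Rightarrow> nat \<Rightarrow> ('v, 'k) mpoly) \<Rightarrow> (nat \<Rightarrow> ('v, 'k) mpoly) set"
    where "ker = (\<lambda>(b, b', N). {z. \<forall>r<b. (\<Sum>c<b'. N r c * z c) = 0})"
  define im :: "nat \<times> nat \<times> (nat \<Rightarrow> nat \<Rightarrow> ('v, 'k) mpoly) \<Rightarrow> (nat \<Rightarrow> ('v, 'k) mpoly) set"
    where "im = (\<lambda>(b, b', N). {w. \<exists>z. \<forall>r<b. w r = (\<Sum>c<b'. N r c * z c)})"
  define ok where "ok = (\<lambda>s. (\<forall>r<fst s. \<forall>c<fst (snd s). homogeneous 1 (snd (snd s) r c)) \<and>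
    linear_syzygies (fst (snd s)) (ker s))"
  have ex: "\<exists>s. ok s \<and> fst s = b \<and> im s = S" if "linear_syzygies b S" for b S
    using that
  proof cases
    case (step b' N)
    then show ?thesis
      by (intro exI[of _ "(b, b', N)"]) (simp add: ok_def ker_def im_def)
  qed
  have "\<exists>f. \<forall>n. (ok (f n) \<and> (n = 0 \<longrightarrow> fst (f n) = b \<and> im (f n) = {w. (\<Sum>j<b. g j * w j) = 0})) \<and>
      (fst (f (Suc n)) = fst (snd (f n)) \<and> im (f (Suc n)) = ker (f n))"
  proof (rule dependent_nat_choice)
    show "\<exists>x. ok x \<and> (0 = 0 \<longrightarrow> fst x = b \<and> im x = {w. (\<Sum>j<b. g j * w j) = 0})"
      using ex[OF lin] by auto
    show "\<exists>y. (ok y \<and> (Suc n = 0 \<longrightarrow> fst y = b \<and> im y = {w. (\<Sum>j<b. g j * w j) = 0})) \<and>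
        fst y = fst (snd x) \<and> im y = ker x"
      if "ok x \<and> (n = 0 \<longrightarrow> fst x = b \<and> im x = {w. (\<Sum>j<b. g j * w j) = 0})" for x n
    proof -
      have "linear_syzygies (fst (snd x)) (ker x)" using that by (simp add: ok_def)
      from ex[OF this] show ?thesis by auto
    qed
  qed
  then obtain f where F: "\<forall>n. (ok (f n) \<and> (n = 0 \<longrightarrow> fst (f n) = b \<and> im (f n) = {w. (\<Sum>j<b. g j * w j) = 0})) \<and>
      (fst (f (Suc n)) = fst (snd (f n)) \<and> im (f (Suc n)) = ker (f n))" by blast
  have f: "\<And>n. ok (f n)" "fst (f 0) = b" "im (f 0) = {w. (\<Sum>j<b. g j * w j) = 0}"
    "\<And>n. fst (f (Suc n)) = fst (snd (f n))" "\<And>n. im (f (Suc n)) = ker (f n)"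
    using F F[rule_format, of 0] by simp_all
  define B where "B = (\<lambda>n. fst (f n))"
  define A where "A = (\<lambda>n. snd (snd (f n)))"
  have im: "im (f n) = {w. \<exists>z. \<forall>r<B n. w r = (\<Sum>c<B (Suc n). A n r c * z c)}" for n
    unfolding im_def B_def A_def f(4) by (simp add: case_prod_unfold)
  have ker: "ker (f n) = {z. \<forall>r<B n. (\<Sum>c<B (Suc n). A n r c * z c) = 0}" for n
    unfolding ker_def B_def A_def f(4) by (simp add: case_prod_unfold)
  have "linear_resolution (ideal_gen (g ` {..<b})) d B g A"
    unfolding linear_resolution_def
  proof (intro conjI allI impI)
    show "homogeneous d (g j)" if "j < B 0" for j using that hom f(2) by (simp add: B_def)
    show "homogeneous 1 (A i r c)" if "r < B i" "c < B (Suc i)" for i r c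
      using f(1)[of i] that f(4) unfolding ok_def B_def A_def by auto
    show "ideal_gen (g ` {..<b}) = {\<Sum>j<B 0. g j * w j | w. True}"
      using f(2) ideal_gen_family[of g b] by (simp add: B_def)
    show "(\<Sum>j<B 0. g j * w j) = 0 \<longleftrightarrow> (\<exists>z. \<forall>r<B 0. w r = (\<Sum>c<B 1. A 0 r c * z c))" for w
      using f(2,3) im[of 0] by (auto simp: B_def set_eq_iff)
    show "(\<forall>r<B i. (\<Sum>c<B (Suc i). A i r c * w c) = 0) \<longleftrightarrow>
        (\<exists>z. \<forall>r<B (Suc i). w r = (\<Sum>c<B (Suc (Suc i)). A (Suc i) r c * z c))" for i w
      using f(5)[of i] unfolding im[of "Suc i"] ker[of i] by (simp add: set_eq_iff)
  qed
  then show ?thesis unfolding has_linear_resolution_def by blast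
qed

section \<open>Extensions of modules with linear syzygies\<close>

lemma sum_lessThan_add: "(\<Sum>c<a + b. f c) = (\<Sum>c<a. f c) + (\<Sum>c<b. f (a + c))"
  for f :: "nat \<Rightarrow> 'a::comm_monoid_add" and a b :: nat
  by (induction b) (simp_all add: add.assoc)

definition append_fun :: "nat \<Rightarrow> (nat \<Rightarrow> 'a) \<Rightarrow> (nat \<Rightarrow> 'a) \<Rightarrow> nat \<Rightarrow> 'a" where
  "append_fun a f g = (\<lambda>i. if i < a then f i else g (i - a))"

lemma append_fun_sel [simp]:
  "i < a \<Longrightarrow> append_fun a f g i = f i" "append_fun a f g (a + i) = g i"
  by (simp_all add: append_fun_def)

lemma all_lessThan_add: "(\<forall>i<a + b. P i) \<longleftrightarrow> (\<forall>i<a. P i) \<and> (\<forall>i<b. P (a + i))" for a b :: nat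
proof safe
  fix i assume "\<forall>i<a. P i" "\<forall>i<b. P (a + i)" "i < a + b"
  then show "P i" by (cases "i < a") (auto dest: spec[of _ "i - a"])
qed auto

text \<open>The last conjunct makes membership depend on the coordinates below \<open>b\<close>
  alone, since elements of the free module are represented by functions on all of
  \<open>nat\<close>.\<close>

definition fin_submodule :: "nat \<Rightarrow> (nat \<Rightarrow> 'r::comm_ring_1) set \<Rightarrow> bool" where
  "fin_submodule b S \<longleftrightarrow> (\<lambda>_. 0) \<in> S \<and> (\<forall>v\<in>S. \<forall>w\<in>S. (\<lambda>i. v i + w i) \<in> S) \<and>
     (\<forall>r. \<forall>w\<in>S. (\<lambda>i. w i * r) \<in> S) \<and> (\<forall>v w. v \<in> S \<longrightarrow> (\<forall>i<b. v i = w i) \<longrightarrow> w \<in> S)"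

lemma fin_submoduleD:
  assumes "fin_submodule b S"
  shows "(\<lambda>_. 0) \<in> S" "v \<in> S \<Longrightarrow> w \<in> S \<Longrightarrow> (\<lambda>i. v i + w i) \<in> S"
    "w \<in> S \<Longrightarrow> (\<lambda>i. w i * r) \<in> S" "v \<in> S \<Longrightarrow> (\<And>i. i < b \<Longrightarrow> v i = w i) \<Longrightarrow> w \<in> S"
  using assms by (auto simp: fin_submodule_def)

lemma fin_submodule_sum:
  fixes n :: nat
  assumes "fin_submodule b S" "\<And>c. c < n \<Longrightarrow> W c \<in> S"
  shows "(\<lambda>i. \<Sum>c<n. W c i * z c) \<in> S"
  using assms(2)
proof (induction n)
  case 0
  then show ?case using fin_submoduleD(1)[OF assms(1)] by simp
next
  case (Suc n)
  then show ?case
    using fin_submoduleD(2)[OF assms(1), of "\<lambda>i. \<Sum>c<n. W c i * z c" "\<lambda>i. W n i * z n"]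
      fin_submoduleD(3)[OF assms(1), of "W n" "z n"] by simp
qed

lemma fin_submodule_kernel:
  fixes a b :: nat
  shows "fin_submodule b {z. \<forall>r<a. (\<Sum>c<b. N r c * z c) = 0}"
  by (auto simp: fin_submodule_def distrib_left sum.distrib mult.assoc[symmetric] sum_distrib_right[symmetric])

lemma linear_syzygies_column:
  fixes N :: "nat \<Rightarrow> nat \<Rightarrow> 'r::comm_ring_1"
  assumes "S = {w. \<exists>z. \<forall>r<b. w r = (\<Sum>c<b'. N r c * z c)}" "c < b'"
  shows "(\<lambda>r. N r c) \<in> S"
  unfolding assms(1)
proof (intro CollectI exI[of _ "\<lambda>c'. if c' = c then 1 else 0"] allI impI)
  show "N r c = (\<Sum>c'<b'. N r c' * (if c' = c then 1 else 0))" for r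
    using assms(2) by (simp add: if_distrib cong: if_cong)
qed

text \<open>
  \<open>0 \<rightarrow> S1 \<rightarrow> S \<rightarrow> S2 \<rightarrow> 0\<close> is exact, where the maps are inclusion of and projection to blocks
  of \<open>R\<^bsup>b1 + b2\<^esup>\<close>, and vectors of linear forms can be lifted to such vectors.
\<close>
definition block_extension ::
    "nat \<Rightarrow> nat \<Rightarrow> (nat \<Rightarrow> ('v, 'k::field) mpoly) set \<Rightarrow> (nat \<Rightarrow> ('v, 'k) mpoly) set \<Rightarrow>
     (nat \<Rightarrow> ('v, 'k) mpoly) set \<Rightarrow> bool" where
  "block_extension b1 b2 S1 S2 S \<longleftrightarrow> fin_submodule (b1 + b2) S \<and>
     (\<forall>w. append_fun b1 w (\<lambda>_. 0) \<in> S \<longleftrightarrow> w \<in> S1) \<and>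
     (\<forall>w\<in>S. (\<lambda>i. w (b1 + i)) \<in> S2) \<and>
     (\<forall>w\<in>S2. \<exists>v. append_fun b1 v w \<in> S) \<and>
     (\<forall>w\<in>S2. (\<forall>i<b2. homogeneous 1 (w i)) \<longrightarrow>
        (\<exists>v. (\<forall>i<b1. homogeneous 1 (v i)) \<and> append_fun b1 v w \<in> S))"

text \<open>A graded horseshoe construction: the generators of \<open>S2\<close> are lifted to
  vectors of linear forms in \<open>S\<close>, which gives a block triangular matrix with
  \<open>N1\<close> and \<open>N2\<close> on the diagonal. Its kernel is again a block extension, so
  the step can be repeated.\<close>

lemma block_extension_step:
  fixes S :: "(nat \<Rightarrow> ('v::finite, 'k::field) mpoly) set"
  assumes ext: "block_extension b1 b2 S1 S2 S"
    and N1: "\<And>r c. r < b1 \<Longrightarrow> c < c1 \<Longrightarrow> homogeneous 1 (N1 r c)"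
      "S1 = {w. \<exists>z. \<forall>r<b1. w r = (\<Sum>c<c1. N1 r c * z c)}"
    and N2: "\<And>r c. r < b2 \<Longrightarrow> c < c2 \<Longrightarrow> homogeneous 1 (N2 r c)"
      "S2 = {w. \<exists>z. \<forall>r<b2. w r = (\<Sum>c<c2. N2 r c * z c)}"
  shows "\<exists>N. (\<forall>r<b1 + b2. \<forall>c<c1 + c2. homogeneous 1 (N r c)) \<and>
    S = {w. \<exists>z. \<forall>r<b1 + b2. w r = (\<Sum>c<c1 + c2. N r c * z c)} \<and>
    block_extension c1 c2 {z. \<forall>r<b1. (\<Sum>c<c1. N1 r c * z c) = 0}
      {z. \<forall>r<b2. (\<Sum>c<c2. N2 r c * z c) = 0} {z. \<forall>r<b1 + b2. (\<Sum>c<c1 + c2. N r c * z c) = 0}"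
proof -
  have sub: "fin_submodule (b1 + b2) S"
    and incl: "\<And>w. append_fun b1 w (\<lambda>_. 0) \<in> S \<longleftrightarrow> w \<in> S1"
    and proj: "\<And>w. w \<in> S \<Longrightarrow> (\<lambda>i. w (b1 + i)) \<in> S2"
    and lift: "\<And>w. w \<in> S2 \<Longrightarrow> (\<And>i. i < b2 \<Longrightarrow> homogeneous 1 (w i)) \<Longrightarrow>
      \<exists>v. (\<forall>i<b1. homogeneous 1 (v i)) \<and> append_fun b1 v w \<in> S"
    using ext unfolding block_extension_def by blast+
  have "\<forall>c<c2. \<exists>v. (\<forall>i<b1. homogeneous 1 (v i)) \<and> append_fun b1 v (\<lambda>r. N2 r c) \<in> S"
    using lift linear_syzygies_column[OF N2(2)] N2(1) by blast
  then obtain L where L: "\<And>r c. c < c2 \<Longrightarrow> r < b1 \<Longrightarrow> homogeneous 1 (L c r)"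
    "\<And>c. c < c2 \<Longrightarrow> append_fun b1 (L c) (\<lambda>r. N2 r c) \<in> S"
    by metis
  \<comment> \<open>The columns are those of \<open>N1\<close> padded by zeros, then those of
    \<open>N2\<close> with their lifts \<open>L\<close> on top.\<close>
  define N where "N = (\<lambda>r. append_fun c1 (\<lambda>c. append_fun b1 (\<lambda>r. N1 r c) (\<lambda>_. 0) r)
    (\<lambda>c. append_fun b1 (L c) (\<lambda>r. N2 r c) r))"
  have N_sum: "(\<Sum>c<c1 + c2. N r c * z c) =
      (\<Sum>c<c1. append_fun b1 (\<lambda>r. N1 r c) (\<lambda>_. 0) r * z c) +
      (\<Sum>c<c2. append_fun b1 (L c) (\<lambda>r. N2 r c) r * z (c1 + c))" for r z
    unfolding sum_lessThan_add by (simp add: N_def)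
  have top: "(\<Sum>c<c1 + c2. N r c * z c) = (\<Sum>c<c1. N1 r c * z c) + (\<Sum>c<c2. L c r * z (c1 + c))"
    if "r < b1" for r z using that by (simp add: N_sum)
  have bot: "(\<Sum>c<c1 + c2. N (b1 + r) c * z c) = (\<Sum>c<c2. N2 r c * z (c1 + c))" for r z
    by (simp add: N_sum)
  have ker_iff: "(\<forall>r<b1 + b2. (\<Sum>c<c1 + c2. N r c * z c) = 0) \<longleftrightarrow>
      (\<forall>r<b1. (\<Sum>c<c1. N1 r c * z c) + (\<Sum>c<c2. L c r * z (c1 + c)) = 0) \<and>
      (\<forall>r<b2. (\<Sum>c<c2. N2 r c * z (c1 + c)) = 0)" for z
    unfolding all_lessThan_add bot using top by auto
  have N_hom: "homogeneous 1 (N r c)" if "r < b1 + b2" "c < c1 + c2" for r c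
  proof (cases "r < b1"; cases "c < c1")
    assume "r < b1" "\<not> c < c1"
    then show ?thesis using L(1)[of "c - c1" r] that by (simp add: N_def append_fun_def)
  next
    assume "\<not> r < b1" "\<not> c < c1"
    then show ?thesis using N2(1)[of "r - b1" "c - c1"] that by (simp add: N_def append_fun_def)
  qed (use N1(1) in \<open>auto simp: N_def append_fun_def\<close>)
  \<comment> \<open>\<open>L\<close> sends the kernel of \<open>N2\<close> into \<open>S1\<close>,
    the image of \<open>N1\<close>; hence the kernel of \<open>N\<close> maps onto that of
    \<open>N2\<close>.\<close>
  have in_S1: "\<exists>z. \<forall>r<b1. (\<Sum>c<c2. L c r * z2 c) = (\<Sum>c<c1. N1 r c * z c)"
    if "\<forall>r<b2. (\<Sum>c<c2. N2 r c * z2 c) = 0" for z2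
  proof -
    let ?y = "\<lambda>r. \<Sum>c<c2. append_fun b1 (L c) (\<lambda>r. N2 r c) r * z2 c"
    have "?y \<in> S" by (rule fin_submodule_sum[OF sub L(2)])
    moreover have "?y i = append_fun b1 (\<lambda>r. \<Sum>c<c2. L c r * z2 c) (\<lambda>_. 0) i" if "i < b1 + b2" for i
      using that \<open>\<forall>r<b2. _ r = 0\<close> by (auto simp: append_fun_def)
    ultimately have "append_fun b1 (\<lambda>r. \<Sum>c<c2. L c r * z2 c) (\<lambda>_. 0) \<in> S"
      by (rule fin_submoduleD(4)[OF sub])
    then show ?thesis unfolding incl N1(2) by simp
  qed
  show ?thesis
  proof (intro exI[of _ N] conjI)
    show "\<forall>r<b1 + b2. \<forall>c<c1 + c2. homogeneous 1 (N r c)" using N_hom by blast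
    show "S = {w. \<exists>z. \<forall>r<b1 + b2. w r = (\<Sum>c<c1 + c2. N r c * z c)}"
    proof (intro set_eqI iffI)
      fix w assume w: "w \<in> S"
      obtain z2 where z2: "\<forall>r<b2. w (b1 + r) = (\<Sum>c<c2. N2 r c * z2 c)"
        using proj[OF w] unfolding N2(2) by auto
      define y where "y = (\<lambda>r. \<Sum>c<c2. append_fun b1 (L c) (\<lambda>r. N2 r c) r * z2 c)"
      have y: "y \<in> S" unfolding y_def by (rule fin_submodule_sum[OF sub L(2)])
      have "(\<lambda>i. w i + y i * (- 1)) \<in> S"
        by (rule fin_submoduleD(2)[OF sub w fin_submoduleD(3)[OF sub y]])
      moreover have "w i + y i * (- 1) = append_fun b1 (\<lambda>i. w i - y i) (\<lambda>_. 0) i" if "i < b1 + b2" for i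
        using that z2[rule_format, of "i - b1"] by (auto simp: append_fun_def y_def)
      ultimately have "append_fun b1 (\<lambda>i. w i - y i) (\<lambda>_. 0) \<in> S"
        by (rule fin_submoduleD(4)[OF sub])
      then obtain z1 where z1: "\<forall>r<b1. w r - y r = (\<Sum>c<c1. N1 r c * z1 c)"
        unfolding incl N1(2) by auto
      have "w r = (\<Sum>c<c1 + c2. N r c * append_fun c1 z1 z2 c)" if "r < b1" for r
      proof -
        have "w r = (\<Sum>c<c1. N1 r c * z1 c) + y r" using z1 that by (metis diff_add_cancel)
        then show ?thesis using that unfolding top[OF that] by (simp add: y_def)
      qed
      moreover have "w (b1 + r) = (\<Sum>c<c1 + c2. N (b1 + r) c * append_fun c1 z1 z2 c)" if "r < b2" for r
        using z2 that unfolding bot by simp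
      ultimately show "w \<in> {w. \<exists>z. \<forall>r<b1 + b2. w r = (\<Sum>c<c1 + c2. N r c * z c)}"
        unfolding mem_Collect_eq all_lessThan_add by blast
    next
      fix w assume "w \<in> {w. \<exists>z. \<forall>r<b1 + b2. w r = (\<Sum>c<c1 + c2. N r c * z c)}"
      then obtain z where z: "\<forall>r<b1 + b2. w r = (\<Sum>c<c1 + c2. N r c * z c)" by auto
      have "append_fun b1 (\<lambda>r. N1 r c) (\<lambda>_. 0) \<in> S" if "c < c1" for c
        unfolding incl using linear_syzygies_column[OF N1(2) that] .
      then have "(\<lambda>r. \<Sum>c<c1. append_fun b1 (\<lambda>r. N1 r c) (\<lambda>_. 0) r * z c) \<in> S"
        by (rule fin_submodule_sum[OF sub])
      moreover have "(\<lambda>r. \<Sum>c<c2. append_fun b1 (L c) (\<lambda>r. N2 r c) r * z (c1 + c)) \<in> S"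
        by (rule fin_submodule_sum[OF sub L(2)])
      ultimately have "(\<lambda>r. \<Sum>c<c1 + c2. N r c * z c) \<in> S"
        unfolding N_sum by (rule fin_submoduleD(2)[OF sub])
      then show "w \<in> S" by (rule fin_submoduleD(4)[OF sub]) (use z in auto)
    qed
    show "block_extension c1 c2 {z. \<forall>r<b1. (\<Sum>c<c1. N1 r c * z c) = 0}
       {z. \<forall>r<b2. (\<Sum>c<c2. N2 r c * z c) = 0} {z. \<forall>r<b1 + b2. (\<Sum>c<c1 + c2. N r c * z c) = 0}"
      unfolding block_extension_def
    proof (intro conjI ballI allI impI)
      show "fin_submodule (c1 + c2) {z. \<forall>r<b1 + b2. (\<Sum>c<c1 + c2. N r c * z c) = 0}"
        by (rule fin_submodule_kernel)
      show "append_fun c1 w (\<lambda>_. 0) \<in> {z. \<forall>r<b1 + b2. (\<Sum>c<c1 + c2. N r c * z c) = 0} \<longleftrightarrow>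
          w \<in> {z. \<forall>r<b1. (\<Sum>c<c1. N1 r c * z c) = 0}" for w
        unfolding mem_Collect_eq ker_iff by simp
      show "(\<lambda>i. w (c1 + i)) \<in> {z. \<forall>r<b2. (\<Sum>c<c2. N2 r c * z c) = 0}"
        if "w \<in> {z. \<forall>r<b1 + b2. (\<Sum>c<c1 + c2. N r c * z c) = 0}" for w
        using that unfolding mem_Collect_eq ker_iff by simp
      fix z2 assume z2: "z2 \<in> {z. \<forall>r<b2. (\<Sum>c<c2. N2 r c * z c) = 0}"
      then obtain z1 where z1: "\<forall>r<b1. (\<Sum>c<c2. L c r * z2 c) = (\<Sum>c<c1. N1 r c * z1 c)"
        using in_S1 by blast
      then show "\<exists>v. append_fun c1 v z2 \<in> {z. \<forall>r<b1 + b2. (\<Sum>c<c1 + c2. N r c * z c) = 0}"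
        using z2 unfolding mem_Collect_eq ker_iff
        by (intro exI[of _ "\<lambda>c. - z1 c"]) (simp add: sum_negf)
      \<comment> \<open>\<open>L\<close> applied to the linear vector \<open>z2\<close> consists of
        quadrics, so the linear parts of \<open>z1\<close> suffice.\<close>
      assume hom: "\<forall>i<c2. homogeneous 1 (z2 i)"
      have "(\<Sum>c<c2. L c r * z2 c) = (\<Sum>c<c1. N1 r c * hcomp 1 (z1 c))" if "r < b1" for r
      proof -
        have "homogeneous (1 + 1) (\<Sum>c<c2. L c r * z2 c)"
          by (intro homogeneous_sum homogeneous_times) (use L(1) hom that in auto)
        then show ?thesis
          using z1 that hcomp_lincomb[of c1 1 "N1 r" 1 z1] N1(1) by auto
      qed
      then show "\<exists>v. (\<forall>i<c1. homogeneous 1 (v i)) \<and>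
          append_fun c1 v z2 \<in> {z. \<forall>r<b1 + b2. (\<Sum>c<c1 + c2. N r c * z c) = 0}"
        using z2 unfolding mem_Collect_eq ker_iff
        by (intro exI[of _ "\<lambda>c. - hcomp 1 (z1 c)"])
          (simp add: sum_negf homogeneous_uminus homogeneous_hcomp)
    qed
  qed
qed

text \<open>Coinduction whose invariant is being a block extension of two modules with linear
  syzygies; \<open>block_extension_step\<close> preserves it.\<close>

lemma linear_syzygies_extension:
  fixes S :: "(nat \<Rightarrow> ('v::finite, 'k::field) mpoly) set"
  assumes "linear_syzygies b1 S1" "linear_syzygies b2 S2" "block_extension b1 b2 S1 S2 S"
  shows "linear_syzygies (b1 + b2) S"
proof -
  define b where "b = b1 + b2"
  have "\<exists>b1 b2 S1 S2. b = b1 + b2 \<and> linear_syzygies b1 S1 \<and> linear_syzygies b2 S2 \<and>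
      block_extension b1 b2 S1 S2 S"
    using assms b_def by blast
  then have "linear_syzygies b S"
  proof (coinduction arbitrary: b S)
    case (linear_syzygies b S)
    then obtain b1 b2 S1 S2 where b: "b = b1 + b2" and S1: "linear_syzygies b1 S1"
      and S2: "linear_syzygies b2 S2" and ext: "block_extension b1 b2 S1 S2 S" by blast
    obtain c1 N1 where N1: "\<forall>r<b1. \<forall>c<c1. homogeneous 1 (N1 r c)"
      "S1 = {w. \<exists>z. \<forall>r<b1. w r = (\<Sum>c<c1. N1 r c * z c)}"
      and K1: "linear_syzygies c1 {z. \<forall>r<b1. (\<Sum>c<c1. N1 r c * z c) = 0}"
      using linear_syzygies_unfold[OF S1] by (elim exE conjE)
    obtain c2 N2 where N2: "\<forall>r<b2. \<forall>c<c2. homogeneous 1 (N2 r c)"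
      "S2 = {w. \<exists>z. \<forall>r<b2. w r = (\<Sum>c<c2. N2 r c * z c)}"
      and K2: "linear_syzygies c2 {z. \<forall>r<b2. (\<Sum>c<c2. N2 r c * z c) = 0}"
      using linear_syzygies_unfold[OF S2] by (elim exE conjE)
    have "\<exists>N. (\<forall>r<b1 + b2. \<forall>c<c1 + c2. homogeneous 1 (N r c)) \<and>
        S = {w. \<exists>z. \<forall>r<b1 + b2. w r = (\<Sum>c<c1 + c2. N r c * z c)} \<and>
        block_extension c1 c2 {z. \<forall>r<b1. (\<Sum>c<c1. N1 r c * z c) = 0}
          {z. \<forall>r<b2. (\<Sum>c<c2. N2 r c * z c) = 0} {z. \<forall>r<b1 + b2. (\<Sum>c<c1 + c2. N r c * z c) = 0}"
      by (rule block_extension_step[OF ext _ N1(2) _ N2(2)]) (use N1(1) N2(1) in blast)+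
    then obtain N where N: "\<forall>r<b1 + b2. \<forall>c<c1 + c2. homogeneous 1 (N r c)"
      "S = {w. \<exists>z. \<forall>r<b1 + b2. w r = (\<Sum>c<c1 + c2. N r c * z c)}"
      "block_extension c1 c2 {z. \<forall>r<b1. (\<Sum>c<c1. N1 r c * z c) = 0}
         {z. \<forall>r<b2. (\<Sum>c<c2. N2 r c * z c) = 0} {z. \<forall>r<b1 + b2. (\<Sum>c<c1 + c2. N r c * z c) = 0}"
      by (elim exE conjE)
    show ?case
    proof (rule exI[of _ b], rule exI[of _ "c1 + c2"], rule exI[of _ N], rule exI[of _ S], intro conjI)
      show "b = b" "S = S" by simp_all
      show "\<forall>r c. r < b \<longrightarrow> c < c1 + c2 \<longrightarrow> homogeneous 1 (N r c)" using N(1) b by blast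
      show "S = {w. \<exists>z. \<forall>r<b. w r = (\<Sum>c<c1 + c2. N r c * z c)}" using N(2) b by blast
      show "(\<exists>d S. c1 + c2 = d \<and> {z. \<forall>r<b. (\<Sum>c<c1 + c2. N r c * z c) = 0} = S \<and>
          (\<exists>b1 b2 S1 S2. d = b1 + b2 \<and> linear_syzygies b1 S1 \<and> linear_syzygies b2 S2 \<and>
            block_extension b1 b2 S1 S2 S)) \<or>
        linear_syzygies (c1 + c2) {z. \<forall>r<b. (\<Sum>c<c1 + c2. N r c * z c) = 0}"
        unfolding b using K1 K2 N(3) by blast
    qed
  qed
  then show ?thesis by (simp add: b_def)
qed

lemma sum_delta_lessThan:
  "r < b \<Longrightarrow> (\<Sum>c<b. (if c = r then a else 0) * z c) = a * z r" for a :: "'r::comm_ring_1" and b :: nat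
  by (simp add: if_distrib[of "\<lambda>t. t * _"] cong: if_cong)

text \<open>With \<open>I1 = (g1)\<close> and \<open>I2 = (g2)\<close>, the assumptions say that \<open>I1 \<inter> I2 = x I2\<close>.\<close>
lemma linear_syzygies_ideal_sum:
  fixes g1 g2 :: "nat \<Rightarrow> ('v::finite, 'k::field) mpoly"
  assumes lin1: "linear_syzygies b1 {w. (\<Sum>j<b1. g1 j * w j) = 0}"
    and lin2: "linear_syzygies b2 {w. (\<Sum>j<b2. g2 j * w j) = 0}"
    and hom: "\<And>j. j < b1 \<Longrightarrow> homogeneous d (g1 j)" "\<And>j. j < b2 \<Longrightarrow> homogeneous d (g2 j)"
    and inter: "\<And>w1 w2. (\<Sum>j<b1. g1 j * w1 j) + (\<Sum>j<b2. g2 j * w2 j) = 0 \<Longrightarrow>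
      \<exists>v. (\<Sum>j<b2. g2 j * w2 j) = Var x * (\<Sum>j<b2. g2 j * v j)"
    and incl: "\<And>j. j < b2 \<Longrightarrow> \<exists>w. Var x * g2 j = (\<Sum>i<b1. g1 i * w i)"
  shows "linear_syzygies (b1 + b2) {w. (\<Sum>j<b1 + b2. append_fun b1 g1 g2 j * w j) = 0}"
proof -
  let ?S1 = "{w. (\<Sum>j<b1. g1 j * w j) = 0}" and ?S2 = "{w. (\<Sum>j<b2. g2 j * w j) = 0}"
  \<comment> \<open>The kernel of the map from \<open>R^b2\<close> onto
    \<open>(I1 + I2) / I1\<close>, which is \<open>I2 / x I2\<close>; so it equals the syzygies of
    \<open>g2\<close> plus \<open>x R^b2\<close>.\<close>
  define S3 where "S3 = {w. \<exists>v. (\<Sum>j<b1. g1 j * v j) + (\<Sum>j<b2. g2 j * w j) = 0}"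
  obtain c2 N2 where N2: "\<forall>r<b2. \<forall>c<c2. homogeneous 1 (N2 r c)"
    "?S2 = {w. \<exists>z. \<forall>r<b2. w r = (\<Sum>c<c2. N2 r c * z c)}"
    and K2: "linear_syzygies c2 {z. \<forall>r<b2. (\<Sum>c<c2. N2 r c * z c) = 0}"
    using linear_syzygies_unfold[OF lin2] by (elim exE conjE)
  have S2D: "\<exists>z. \<forall>r<b2. w r = (\<Sum>c<c2. N2 r c * z c)" if "(\<Sum>j<b2. g2 j * w j) = 0" for w
    using N2(2) that by blast
  have S2I: "(\<Sum>j<b2. g2 j * w j) = 0" if "\<And>r. r < b2 \<Longrightarrow> w r = (\<Sum>c<c2. N2 r c * z c)" for w z
    using N2(2) that by blast
  \<comment> \<open>Generators of \<open>S3\<close>: the columns of \<open>N2\<close>, then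
    \<open>x\<close> times the unit vectors.\<close>
  define N where "N = (\<lambda>r. append_fun c2 (N2 r) (\<lambda>c. if c = r then Var x else 0))"
  have N: "(\<Sum>c<c2 + b2. N r c * z c) = (\<Sum>c<c2. N2 r c * z c) + Var x * z (c2 + r)" if "r < b2" for r z
    using that by (simp add: N_def sum_lessThan_add sum_delta_lessThan)
  have scale: "(\<Sum>j<b2. g2 j * (a * v j)) = a * (\<Sum>j<b2. g2 j * v j)" for a v
    by (simp add: sum_distrib_left ac_simps)
  have S3_iff: "w \<in> S3 \<longleftrightarrow> (\<exists>z. \<forall>r<b2. w r = (\<Sum>c<c2 + b2. N r c * z c))" for w
  proof
    assume "w \<in> S3"
    then obtain v where v: "(\<Sum>j<b2. g2 j * w j) = Var x * (\<Sum>j<b2. g2 j * v j)"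
      using inter unfolding S3_def by blast
    then have "(\<Sum>j<b2. g2 j * (w j - Var x * v j)) = 0"
      by (simp add: right_diff_distrib sum_subtractf scale)
    from S2D[OF this] obtain z where z: "\<forall>r<b2. w r - Var x * v r = (\<Sum>c<c2. N2 r c * z c)" by blast
    have "w r = (\<Sum>c<c2 + b2. N r c * append_fun c2 z v c)" if "r < b2" for r
    proof -
      have "w r = (\<Sum>c<c2. N2 r c * z c) + Var x * v r" using z that by (metis diff_add_cancel)
      then show ?thesis unfolding N[OF that] by simp
    qed
    then show "\<exists>z. \<forall>r<b2. w r = (\<Sum>c<c2 + b2. N r c * z c)" by blast
  next
    assume "\<exists>z. \<forall>r<b2. w r = (\<Sum>c<c2 + b2. N r c * z c)"
    then obtain z where "\<forall>r<b2. w r = (\<Sum>c<c2 + b2. N r c * z c)" by blast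
    then have z: "w r = (\<Sum>c<c2. N2 r c * z c) + Var x * z (c2 + r)" if "r < b2" for r
      using N[OF that] that by simp
    have "\<forall>j. \<exists>w. j < b2 \<longrightarrow> Var x * g2 j = (\<Sum>i<b1. g1 i * w i)" using incl by blast
    from choice[OF this] obtain W where "\<forall>j. j < b2 \<longrightarrow> Var x * g2 j = (\<Sum>i<b1. g1 i * W j i)" ..
    then have W: "Var x * g2 j = (\<Sum>i<b1. g1 i * W j i)" if "j < b2" for j using that by simp
    have "(\<Sum>j<b2. g2 j * w j) = (\<Sum>j<b2. g2 j * (\<Sum>c<c2. N2 j c * z c)) + (\<Sum>j<b2. Var x * g2 j * z (c2 + j))"
      by (simp add: z distrib_left sum.distrib ac_simps)
    also have "(\<Sum>j<b2. g2 j * (\<Sum>c<c2. N2 j c * z c)) = 0" by (rule S2I) simp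
    also have "(\<Sum>j<b2. Var x * g2 j * z (c2 + j)) = (\<Sum>j<b2. \<Sum>i<b1. g1 i * (W j i * z (c2 + j)))"
      by (simp add: W sum_distrib_right mult.assoc)
    also have "\<dots> = (\<Sum>i<b1. g1 i * (\<Sum>j<b2. W j i * z (c2 + j)))"
      by (subst sum.swap) (simp add: sum_distrib_left)
    finally have "(\<Sum>i<b1. g1 i * - (\<Sum>j<b2. W j i * z (c2 + j))) + (\<Sum>j<b2. g2 j * w j) = 0"
      by (simp add: sum_negf)
    then show "w \<in> S3" unfolding S3_def by (intro CollectI exI)
  qed
  have "linear_syzygies b2 S3"
  proof (rule linear_syzygies.step)
    show "homogeneous 1 (N r c)" if "r < b2" "c < c2 + b2" for r c
      using that N2(1) homogeneous_Var[of x] by (auto simp: N_def append_fun_def)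
    show "S3 = {w. \<exists>z. \<forall>r<b2. w r = (\<Sum>c<c2 + b2. N r c * z c)}" using S3_iff by blast
    have ker: "(\<forall>r<b2. (\<Sum>c<c2 + b2. N r c * z c) = 0) \<longleftrightarrow>
        (\<forall>r<b2. (\<Sum>c<c2. N2 r c * z c) + Var x * z (c2 + r) = 0)" for z
      using N by auto
    \<comment> \<open>A kernel vector \<open>(z, v)\<close> satisfies \<open>N2 z + x v = 0\<close>.
      As \<open>x\<close> is not a zero divisor, the possible \<open>v\<close> are exactly the
      syzygies of \<open>g2\<close>, and those with \<open>v = 0\<close> give the kernel of
      \<open>N2\<close>; both have linear syzygies.\<close>
    show "linear_syzygies (c2 + b2) {z. \<forall>r<b2. (\<Sum>c<c2 + b2. N r c * z c) = 0}"
    proof (rule linear_syzygies_extension[OF K2 lin2], unfold block_extension_def, intro conjI ballI allI impI)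
      show "fin_submodule (c2 + b2) {z. \<forall>r<b2. (\<Sum>c<c2 + b2. N r c * z c) = 0}"
        by (rule fin_submodule_kernel)
      show "append_fun c2 w (\<lambda>_. 0) \<in> {z. \<forall>r<b2. (\<Sum>c<c2 + b2. N r c * z c) = 0} \<longleftrightarrow>
          w \<in> {z. \<forall>r<b2. (\<Sum>c<c2. N2 r c * z c) = 0}" for w
        unfolding mem_Collect_eq ker by simp
      show "(\<lambda>i. w (c2 + i)) \<in> ?S2" if "w \<in> {z. \<forall>r<b2. (\<Sum>c<c2 + b2. N r c * z c) = 0}" for w
      proof -
        have w: "\<forall>r<b2. (\<Sum>c<c2. N2 r c * w c) + Var x * w (c2 + r) = 0"
          using that unfolding mem_Collect_eq ker .
        have "Var x * w (c2 + r) = (\<Sum>c<c2. N2 r c * - w c)" if "r < b2" for r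
          using w[rule_format, OF that] by (simp add: sum_negf eq_neg_iff_add_eq_0 add.commute[of "Var x * _"])
        then have "(\<Sum>r<b2. g2 r * (Var x * w (c2 + r))) = 0" by (rule S2I)
        then have "Var x * (\<Sum>r<b2. g2 r * w (c2 + r)) = 0" by (simp only: scale)
        then show ?thesis unfolding mem_Collect_eq Var_def by (rule monomial_times_cancel)
      qed
      fix v assume v: "v \<in> ?S2"
      then have "(\<Sum>r<b2. g2 r * (Var x * v r)) = 0" by (simp add: scale)
      from S2D[OF this] obtain z where z: "\<forall>r<b2. Var x * v r = (\<Sum>c<c2. N2 r c * z c)" by blast
      then show "\<exists>u. append_fun c2 u v \<in> {z. \<forall>r<b2. (\<Sum>c<c2 + b2. N r c * z c) = 0}"
        unfolding mem_Collect_eq ker by (intro exI[of _ "\<lambda>c. - z c"]) (simp add: sum_negf)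
      assume hom_v: "\<forall>i<b2. homogeneous 1 (v i)"
      have "Var x * v r = (\<Sum>c<c2. N2 r c * hcomp 1 (z c))" if "r < b2" for r
      proof -
        have "homogeneous (1 + 1) (\<Sum>c<c2. N2 r c * z c)"
          using homogeneous_times[OF homogeneous_Var[of x], of 1 "v r"] hom_v z that by simp
        then show ?thesis using z that hcomp_lincomb[of c2 1 "N2 r" 1 z] N2(1) by auto
      qed
      then show "\<exists>u. (\<forall>i<c2. homogeneous 1 (u i)) \<and>
          append_fun c2 u v \<in> {z. \<forall>r<b2. (\<Sum>c<c2 + b2. N r c * z c) = 0}"
        unfolding mem_Collect_eq ker
        by (intro exI[of _ "\<lambda>c. - hcomp 1 (z c)"]) (simp add: sum_negf homogeneous_uminus homogeneous_hcomp)
    qed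
  qed
  moreover have iff: "(\<Sum>j<b1 + b2. append_fun b1 g1 g2 j * w j) = 0 \<longleftrightarrow>
      (\<Sum>j<b1. g1 j * w j) + (\<Sum>j<b2. g2 j * w (b1 + j)) = 0" for w
    by (simp add: sum_lessThan_add)
  have "block_extension b1 b2 ?S1 S3 {w. (\<Sum>j<b1 + b2. append_fun b1 g1 g2 j * w j) = 0}"
    unfolding block_extension_def
  proof (intro conjI ballI allI impI)
    show "fin_submodule (b1 + b2) {w. (\<Sum>j<b1 + b2. append_fun b1 g1 g2 j * w j) = 0}"
      using fin_submodule_kernel[of "b1 + b2" 1 "\<lambda>_. append_fun b1 g1 g2"] by simp
    show "append_fun b1 w (\<lambda>_. 0) \<in> {w. (\<Sum>j<b1 + b2. append_fun b1 g1 g2 j * w j) = 0} \<longleftrightarrow> w \<in> ?S1" for w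
      unfolding mem_Collect_eq iff by simp
    show "(\<lambda>i. w (b1 + i)) \<in> S3" if "w \<in> {w. (\<Sum>j<b1 + b2. append_fun b1 g1 g2 j * w j) = 0}" for w
      using that unfolding mem_Collect_eq iff S3_def by blast
    fix w assume "w \<in> S3"
    then obtain v where v: "(\<Sum>j<b1. g1 j * v j) + (\<Sum>j<b2. g2 j * w j) = 0" by (auto simp: S3_def)
    then show "\<exists>v. append_fun b1 v w \<in> {w. (\<Sum>j<b1 + b2. append_fun b1 g1 g2 j * w j) = 0}"
      unfolding mem_Collect_eq iff by (intro exI[of _ v]) simp
    assume hom_w: "\<forall>i<b2. homogeneous 1 (w i)"
    \<comment> \<open>For linear \<open>w\<close> the combination of \<open>g2\<close> has degree
      \<open>d + 1\<close>, so the linear parts of \<open>v\<close> already balance it.\<close>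
    have "homogeneous (d + 1) (- (\<Sum>j<b2. g2 j * w j))"
      by (intro homogeneous_uminus homogeneous_sum homogeneous_times) (use hom(2) hom_w in auto)
    then have "homogeneous (d + 1) (\<Sum>j<b1. g1 j * v j)" using v by (simp add: eq_neg_iff_add_eq_0[symmetric])
    then have "(\<Sum>j<b1. g1 j * hcomp 1 (v j)) = (\<Sum>j<b1. g1 j * v j)"
      using hcomp_lincomb hom(1) by blast
    then show "\<exists>v. (\<forall>i<b1. homogeneous 1 (v i)) \<and>
        append_fun b1 v w \<in> {w. (\<Sum>j<b1 + b2. append_fun b1 g1 g2 j * w j) = 0}"
      unfolding mem_Collect_eq iff using v
      by (intro exI[of _ "\<lambda>j. hcomp 1 (v j)"]) (simp add: homogeneous_hcomp)
  qed
  ultimately show ?thesis using linear_syzygies_extension[OF lin1] by blast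
qed

lemma linear_syzygies_zero: "linear_syzygies 0 UNIV"
proof (coinduction)
  case linear_syzygies
  show ?case
    by (rule exI[of _ 0], rule exI[of _ 0], rule exI[of _ "\<lambda>_ _. 0"], rule exI[of _ UNIV]) simp
qed

lemma linear_syzygies_singleton:
  "linear_syzygies 1 {w. w 0 = 0}"
  by (rule linear_syzygies.step[of 1 0 "\<lambda>_ _. 0"]) (simp_all add: linear_syzygies_zero)

definition expo :: "('v::finite \<Rightarrow> nat) \<Rightarrow> 'v \<Rightarrow>\<^sub>0 nat" where
  "expo f = Abs_poly_mapping f"

lemma lookup_expo [simp]: "lookup (expo f) = f"
  by (simp add: expo_def)

lemma expo_lookup [simp]: "expo (lookup m) = m"
  by (rule poly_mapping_eqI) simp

lemma expo_upd: "expo (f(x := Suc (f x))) = single x 1 + expo f"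
  by (rule poly_mapping_eqI) (simp add: lookup_add lookup_single when_def)

lemma mdeg_expo: "mdeg (expo f) = sum f UNIV"
  by (simp add: mdeg_eq_sum)

lemma lookup_image_expo [simp]: "lookup ` expo ` M = M"
  by (force simp: image_image)

text \<open>The type argument fixes the field, which \<open>M\<close> does not determine.\<close>

definition linear_generators :: "'k::field itself \<Rightarrow> ('v::finite \<Rightarrow> nat) set \<Rightarrow> bool" where
  "linear_generators k M \<longleftrightarrow> (\<exists>fs. set fs = M \<and>
     linear_syzygies (length fs) {w :: nat \<Rightarrow> ('v, 'k) mpoly. (\<Sum>j<length fs. monomial (expo (fs ! j)) * w j) = 0})"

lemma linear_generators_empty: "linear_generators k {}"
  unfolding linear_generators_def by (intro exI[of _ "[]"]) (simp add: linear_syzygies_zero)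

lemma linear_generators_singleton: "linear_generators (k :: 'k::field itself) {f :: 'v::finite \<Rightarrow> nat}"
proof -
  have "{w :: nat \<Rightarrow> ('v, 'k) mpoly. monomial (expo f) * w 0 = 0} = {w. w 0 = 0}"
    using monomial_times_cancel by fastforce
  then show ?thesis
    unfolding linear_generators_def
    by (intro exI[of _ "[f]"]) (simp add: linear_syzygies_singleton[unfolded One_nat_def])
qed

lemma ideal_gen_nth:
  "({\<Sum>j<length fs. monomial (expo (fs ! j)) * w j | w. True} :: ('v::finite, 'k::field) mpoly set)
     = mon_ideal (up (set fs))"
proof -
  have "(ideal_gen ((\<lambda>j. monomial (expo (fs ! j))) ` {..<length fs}) :: ('v, 'k) mpoly set) = mon_ideal (up (set fs))"
  proof -
    have "(\<lambda>j. monomial (expo (fs ! j)) :: ('v, 'k) mpoly) ` {..<length fs} = monomial ` expo ` set fs"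
      by (auto simp: set_conv_nth)
    then show ?thesis by (simp only: ideal_gen_monomial lookup_image_expo)
  qed
  then show ?thesis unfolding ideal_gen_family by simp
qed

lemma in_mon_ideal_nth_iff:
  "p \<in> mon_ideal (up (set fs)) \<longleftrightarrow> (\<exists>w. p = (\<Sum>j<length fs. monomial (expo (fs ! j)) * w j))"
  unfolding ideal_gen_nth[symmetric] by auto

lemma mon_ideal_divide:
  fixes p :: "('v::finite, 'k::field) mpoly"
  assumes p: "p \<in> mon_ideal F" and x: "\<And>f. f \<in> F \<Longrightarrow> 0 < f x \<and> f(x := f x - 1) \<in> F'"
  shows "\<exists>q\<in>mon_ideal F'. p = Var x * q"
proof -
  let ?q = "\<Sum>m\<in>keys p. single (m - single x 1) (lookup p m)"
  have e: "m = (m - single x 1) + single x 1" if "m \<in> keys p" for m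
  proof -
    have "0 < lookup m x" using p x that by (auto simp: mon_ideal_def)
    then show ?thesis by (intro poly_mapping_eqI) (auto simp: lookup_add lookup_minus lookup_single when_def)
  qed
  have "p = (\<Sum>m\<in>keys p. Var x * single (m - single x 1) (lookup p m))"
    by (subst poly_eq_sum_single[of p], intro sum.cong refl, subst (1) e)
      (simp_all add: Var_def monomial_def mult_single add.commute)
  also have "\<dots> = Var x * ?q" by (simp add: sum_distrib_left)
  finally have "p = Var x * ?q" .
  moreover have "?q \<in> mon_ideal F'"
    unfolding mon_ideal_def
  proof (intro CollectI ballI)
    fix k assume "k \<in> keys ?q"
    then obtain m where m: "m \<in> keys p" "k \<in> keys (single (m - single x 1) (lookup p m))"
      by (rule in_keys_sumE)
    then have "k = m - single x 1" by (simp split: if_splits)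
    then have "lookup k = (lookup m)(x := lookup m x - 1)"
      by (auto simp: lookup_minus lookup_single when_def fun_eq_iff)
    moreover have "lookup m \<in> F" using p m(1) by (simp add: mon_ideal_def)
    ultimately show "lookup k \<in> F'" using x by simp
  qed
  ultimately show ?thesis by blast
qed

text \<open>A monomial in both ideals has exponent above \<open>c\<close> at \<open>x\<close> and is
  a multiple of one with exponent \<open>c\<close> there, so division by \<open>x\<close> stays in
  the second ideal. Conversely, the exchange puts \<open>x\<close> times each generator of the
  second ideal into the first. These are the assumptions of
  \<open>linear_syzygies_ideal_sum\<close>.\<close>

lemma linear_generators_split:
  fixes M :: "('v::finite \<Rightarrow> nat) set"
  assumes deg: "\<And>f. f \<in> M \<Longrightarrow> sum f UNIV = d" and c: "\<And>f. f \<in> M \<Longrightarrow> c \<le> f x"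
    and M1: "linear_generators k {f \<in> M. c < f x}" and M2: "linear_generators k {f \<in> M. f x = c}"
    and ex: "\<And>f. f \<in> M \<Longrightarrow> f x = c \<Longrightarrow> \<exists>t. t \<noteq> x \<and> 0 < f t \<and> f(x := Suc c, t := f t - 1) \<in> M"
  shows "linear_generators (k :: 'k::field itself) M"
proof -
  obtain fs where fs: "set fs = {f \<in> M. c < f x}" and lin1:
    "linear_syzygies (length fs) {w :: nat \<Rightarrow> ('v, 'k) mpoly. (\<Sum>j<length fs. monomial (expo (fs ! j)) * w j) = 0}"
    using M1 unfolding linear_generators_def by blast
  obtain hs where hs: "set hs = {f \<in> M. f x = c}" and lin2:
    "linear_syzygies (length hs) {w :: nat \<Rightarrow> ('v, 'k) mpoly. (\<Sum>j<length hs. monomial (expo (hs ! j)) * w j) = 0}"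
    using M2 unfolding linear_generators_def by blast
  let ?g1 = "\<lambda>j. monomial (expo (fs ! j)) :: ('v, 'k) mpoly"
  let ?g2 = "\<lambda>j. monomial (expo (hs ! j)) :: ('v, 'k) mpoly"
  have in1: "fs ! j \<in> M" "c < (fs ! j) x" if "j < length fs" for j
    using fs nth_mem[OF that] by auto
  have in2: "hs ! j \<in> M" "(hs ! j) x = c" if "j < length hs" for j
    using hs nth_mem[OF that] by auto
  have "linear_syzygies (length fs + length hs)
      {w :: nat \<Rightarrow> ('v, 'k) mpoly. (\<Sum>j<length fs + length hs. append_fun (length fs) ?g1 ?g2 j * w j) = 0}"
  proof (rule linear_syzygies_ideal_sum[OF lin1 lin2, where d = d and x = x])
    show "homogeneous d (?g1 j)" if "j < length fs" for j
      using in1(1)[OF that] by (simp add: homogeneous_monomial mdeg_expo deg)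
    show "homogeneous d (?g2 j)" if "j < length hs" for j
      using in2(1)[OF that] by (simp add: homogeneous_monomial mdeg_expo deg)
    show "\<exists>v. (\<Sum>j<length hs. ?g2 j * w2 j) = Var x * (\<Sum>j<length hs. ?g2 j * v j)"
      if eq: "(\<Sum>j<length fs. ?g1 j * w1 j) + (\<Sum>j<length hs. ?g2 j * w2 j) = 0" for w1 w2
    proof -
      let ?p = "\<Sum>j<length hs. ?g2 j * w2 j"
      have "?p \<in> mon_ideal (up (set hs))" unfolding in_mon_ideal_nth_iff by blast
      moreover have "- ?p \<in> mon_ideal (up (set fs))"
        unfolding in_mon_ideal_nth_iff
        by (rule exI[of _ w1]) (use eq in \<open>simp add: eq_neg_iff_add_eq_0[symmetric]\<close>)
      then have "?p \<in> mon_ideal (up (set fs))" by (simp add: mon_ideal_def in_keys_iff)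
      ultimately have "?p \<in> mon_ideal (up (set hs) \<inter> up (set fs))" by (simp add: mon_ideal_def)
      then have "\<exists>q\<in>mon_ideal (up (set hs)). ?p = Var x * q"
      proof (rule mon_ideal_divide)
        fix f assume "f \<in> up (set hs) \<inter> up (set fs)"
        then obtain h1 h2 where h: "h1 \<in> set hs" "h1 \<le> f" "h2 \<in> set fs" "h2 \<le> f" by (auto simp: up_def)
        then have "c < f x" "h1 x = c" using fs hs le_funD[OF h(4), of x] by auto
        then have "h1 \<le> f(x := f x - 1)" using h(2) by (auto simp: le_fun_def)
        then show "0 < f x \<and> f(x := f x - 1) \<in> up (set hs)" using h(1) \<open>c < f x\<close> by (auto simp: up_def)
      qed
      then obtain q where q: "q \<in> mon_ideal (up (set hs))" "?p = Var x * q" by (elim bexE)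
      obtain v where v: "q = (\<Sum>j<length hs. ?g2 j * v j)" using q(1) unfolding in_mon_ideal_nth_iff by (elim exE)
      show ?thesis by (rule exI[of _ v]) (unfold q(2) v, rule refl)
    qed
    show "\<exists>w. Var x * ?g2 j = (\<Sum>i<length fs. ?g1 i * w i)" if j: "j < length hs" for j
    proof -
      let ?f = "hs ! j"
      obtain t where t: "t \<noteq> x" "0 < ?f t" "?f(x := Suc c, t := ?f t - 1) \<in> M"
        using ex[OF in2[OF j]] by auto
      have "?f(x := Suc c, t := ?f t - 1) \<in> set fs" unfolding fs using t by simp
      moreover have "?f(x := Suc c, t := ?f t - 1) \<le> ?f(x := Suc (?f x))"
        using in2(2)[OF j] by (auto simp: le_fun_def)
      ultimately have "monomial (expo (?f(x := Suc (?f x)))) \<in> mon_ideal (up (set fs))"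
        by (auto simp: mon_ideal_def up_def)
      then have "Var x * ?g2 j \<in> mon_ideal (up (set fs))"
        unfolding Var_def expo_upd monomial_times .
      then show ?thesis unfolding in_mon_ideal_nth_iff .
    qed
  qed
  moreover have "append_fun (length fs) ?g1 ?g2 = (\<lambda>j. monomial (expo ((fs @ hs) ! j)))"
    by (auto simp: append_fun_def nth_append)
  moreover have "set (fs @ hs) = M" using fs hs c by (auto simp: le_less)
  ultimately show ?thesis
    unfolding linear_generators_def by (intro exI[of _ "fs @ hs"]) simp
qed

lemma linear_generators_imp_resolution:
  assumes "linear_generators (k :: 'k::field itself) M" "\<And>f. f \<in> M \<Longrightarrow> sum f UNIV = d"
  shows "has_linear_resolution (mon_ideal (up M) :: ('v::finite, 'k) mpoly set)"
proof -
  obtain fs where fs: "set fs = M" and lin: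
    "linear_syzygies (length fs) {w :: nat \<Rightarrow> ('v, 'k) mpoly. (\<Sum>j<length fs. monomial (expo (fs ! j)) * w j) = 0}"
    using assms(1) unfolding linear_generators_def by blast
  have "has_linear_resolution (ideal_gen ((\<lambda>j. monomial (expo (fs ! j)) :: ('v, 'k) mpoly) ` {..<length fs}))"
  proof (rule linear_syzygies_imp_resolution[OF lin])
    show "homogeneous d (monomial (expo (fs ! j)) :: ('v, 'k) mpoly)" if "j < length fs" for j
      using nth_mem[OF that] fs assms(2) by (simp add: homogeneous_monomial mdeg_expo)
  qed
  then show ?thesis unfolding ideal_gen_family ideal_gen_nth fs .
qed

section \<open>Componentwise linearity and linear quotients of split ideals\<close>

lemma sum_fun_upd: "sum (f(x := a)) UNIV + f x = sum f UNIV + a" for f :: "'v::finite \<Rightarrow> nat"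
proof -
  have "sum (f(x := a)) (UNIV - {x}) = sum f (UNIV - {x})" by (intro sum.cong) auto
  then show ?thesis
    using sum.remove[of UNIV x f] sum.remove[of UNIV x "f(x := a)"] by simp
qed

lemma sum_exchange:
  fixes f :: "'v::finite \<Rightarrow> nat"
  assumes "t \<noteq> x" "0 < f t"
  shows "sum (f(x := Suc (f x), t := f t - 1)) UNIV = sum f UNIV"
  using sum_fun_upd[of f x "Suc (f x)"] sum_fun_upd[of "f(x := Suc (f x))" t "f t - 1"] assms by simp

lemma sum_eq_imp_eq:
  fixes f g :: "'v::finite \<Rightarrow> nat"
  assumes "f \<le> g" "sum g UNIV \<le> sum f UNIV"
  shows "g = f"
proof (rule ext, rule ccontr)
  fix x assume "g x \<noteq> f x"
  then have "f x < g x" using assms(1) by (simp add: le_fun_def order.strict_iff_order)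
  then show False using sum_strict_mono_fun[OF assms(1)] assms(2) by fastforce
qed

text \<open>Up to the factor \<open>u\<close>, these are all monomials of a fixed degree in the
  variables outside \<open>Z\<close>. Splitting at such a variable either raises \<open>u\<close> or
  enlarges \<open>Z\<close>; as \<open>d\<close> exceeds the degree of \<open>u\<close>, another
  variable has room for the exchange.\<close>

lemma linear_generators_cone:
  fixes u :: "'v::finite \<Rightarrow> nat"
  shows "linear_generators k {f. u \<le> f \<and> (\<forall>z\<in>Z. f z = u z) \<and> sum f UNIV = d}"
proof (induction "(d - sum u UNIV) + card (- Z)" arbitrary: u Z rule: less_induct)
  case less
  let ?M = "{f. u \<le> f \<and> (\<forall>z\<in>Z. f z = u z) \<and> sum f UNIV = d}"
  have mono: "sum u UNIV \<le> sum f UNIV" if "u \<le> f" for f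
    using that by (intro sum_mono) (simp add: le_fun_def)
  consider "d < sum u UNIV" | "d = sum u UNIV" | "sum u UNIV < d" "Z = UNIV"
    | x where "sum u UNIV < d" "x \<notin> Z" by (metis UNIV_eq_I linorder_neqE_nat)
  then show ?case
  proof cases
    case 1
    then have "?M = {}" using mono by fastforce
    then show ?thesis by (simp only: linear_generators_empty)
  next
    case 2
    then have "?M = {u}" using sum_eq_imp_eq[of u] by auto
    then show ?thesis by (simp only: linear_generators_singleton)
  next
    case 3
    then have "f = u" if "\<forall>z\<in>Z. f z = u z" for f using that by auto
    then have "?M = {}" using 3 by auto
    then show ?thesis by (simp only: linear_generators_empty)
  next
    case (4 x)
    show ?thesis
    proof (rule linear_generators_split)
      show "sum f UNIV = d" "u x \<le> f x" if "f \<in> ?M" for f using that by (auto simp: le_fun_def)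
      have "sum (u(x := Suc (u x))) UNIV = Suc (sum u UNIV)" using sum_fun_upd[of u x "Suc (u x)"] by simp
      then have "linear_generators k {f. u(x := Suc (u x)) \<le> f \<and> (\<forall>z\<in>Z. f z = (u(x := Suc (u x))) z) \<and> sum f UNIV = d}"
        using 4 by (intro less.hyps) auto
      moreover have "{f. u(x := Suc (u x)) \<le> f \<and> (\<forall>z\<in>Z. f z = (u(x := Suc (u x))) z) \<and> sum f UNIV = d}
          = {f \<in> ?M. u x < f x}"
        using 4(2) by (auto simp: le_fun_def Suc_le_eq split: if_splits intro: less_imp_le)
      ultimately show "linear_generators k {f \<in> ?M. u x < f x}" by simp
      have "card (- insert x Z) < card (- Z)" using 4(2) by (intro psubset_card_mono) auto
      then have "linear_generators k {f. u \<le> f \<and> (\<forall>z\<in>insert x Z. f z = u z) \<and> sum f UNIV = d}"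
        by (intro less.hyps) simp
      moreover have "{f. u \<le> f \<and> (\<forall>z\<in>insert x Z. f z = u z) \<and> sum f UNIV = d} = {f \<in> ?M. f x = u x}"
        by auto
      ultimately show "linear_generators k {f \<in> ?M. f x = u x}" by simp
      fix f assume f: "f \<in> ?M" "f x = u x"
      have "\<not> f \<le> u"
      proof
        assume "f \<le> u"
        then have "f = u" using f(1) by (simp add: order_antisym)
        then show False using f(1) 4(1) by simp
      qed
      then obtain t where t: "u t < f t" by (auto simp: le_fun_def not_le)
      then have "t \<noteq> x" "t \<notin> Z" using f by auto
      moreover have "f(x := Suc (u x), t := f t - 1) \<in> ?M"
        using f t \<open>t \<noteq> x\<close> \<open>t \<notin> Z\<close> 4(2) sum_exchange[of t x f] by (auto simp: le_fun_def)
      ultimately show "\<exists>t. t \<noteq> x \<and> 0 < f t \<and> f(x := Suc (u x), t := f t - 1) \<in> ?M"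
        using t by (intro exI[of _ t]) auto
    qed
  qed
qed

text \<open>Exchanges preserve the degree, so a splitting of \<open>M\<close> is also a splitting of
  its part of degree \<open>d\<close>.\<close>

lemma splittable_linear_generators:
  fixes M :: "('v::finite \<Rightarrow> nat) set"
  assumes "splittable Z M"
  shows "linear_generators k {f \<in> M. sum f UNIV = d}"
  using assms
proof (induction rule: splittable.induct)
  case (empty Z)
  then show ?case by (simp add: linear_generators_empty)
next
  case (cone Z u)
  then show ?case using linear_generators_cone[of k u Z d] by (simp add: conj_assoc)
next
  case (split x Z M c)
  show ?case
  proof (rule linear_generators_split[where x = x and c = c and d = d])
    have eq: "{f \<in> {f \<in> M. sum f UNIV = d}. P f} = {f \<in> {f \<in> M. P f}. sum f UNIV = d}" for P by auto
    show "linear_generators k {f \<in> {f \<in> M. sum f UNIV = d}. c < f x}" unfolding eq by (rule split.IH(1))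
    show "linear_generators k {f \<in> {f \<in> M. sum f UNIV = d}. f x = c}" unfolding eq by (rule split.IH(2))
    fix f assume f: "f \<in> {f \<in> M. sum f UNIV = d}" "f x = c"
    then obtain t where t: "t \<noteq> x" "0 < f t" "f(x := Suc c, t := f t - 1) \<in> M"
      using split.hyps(5) by blast
    then show "\<exists>t. t \<noteq> x \<and> 0 < f t \<and> f(x := Suc c, t := f t - 1) \<in> {f \<in> M. sum f UNIV = d}"
      using sum_exchange[of t x f] f by auto
  qed (use split.hyps(2) in auto)
qed

lemma up_eq: "up_closed F \<Longrightarrow> up F = F"
  by (auto simp: up_def up_closed_def)

lemma ideal_gen_monomial_expo: "ideal_gen (monomial ` expo ` M) = mon_ideal (up M)"
  by (simp only: ideal_gen_monomial lookup_image_expo)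

lemma ideal_gen_homogeneous_part:
  fixes F :: "('v::finite \<Rightarrow> nat) set"
  shows "ideal_gen {f \<in> mon_ideal F. homogeneous l f} = mon_ideal (up {f \<in> F. sum f UNIV = l})" (is "ideal_gen ?H = mon_ideal (up ?M)")
proof
  show "ideal_gen ?H \<subseteq> mon_ideal (up ?M)"
    unfolding ideal_gen_def
  proof (intro span_times_minimal subspace_mon_ideal up_closed_up subsetI)
    fix p assume "p \<in> ?H"
    then show "p \<in> mon_ideal (up ?M)"
      by (auto simp: mon_ideal_def homogeneous_def mdeg_eq_sum up_def)
  qed
  have "monomial ` expo ` ?M \<subseteq> ?H"
    by (auto simp: mon_ideal_def homogeneous_monomial mdeg_expo)
  then show "mon_ideal (up ?M) \<subseteq> ideal_gen ?H"
    unfolding ideal_gen_monomial_expo[symmetric] ideal_gen_def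
    by (rule module.span_mono[OF module_times])
qed

lemma splittable_componentwise_linear:
  fixes F :: "('v::finite \<Rightarrow> nat) set"
  assumes "splittable {} F" "up_closed F"
  shows "componentwise_linear (mon_ideal F :: ('v, 'k::field) mpoly set)"
  unfolding componentwise_linear_def
proof (intro conjI allI)
  show "homogeneous_ideal (mon_ideal F :: ('v, 'k) mpoly set)"
    unfolding homogeneous_ideal_def
    by (intro exI[of _ "monomial ` expo ` F"])
      (auto simp: ideal_gen_monomial_expo up_eq[OF assms(2)] homogeneous_monomial simp del: image_image)
  show "has_linear_resolution (ideal_gen {f \<in> mon_ideal F :: ('v, 'k) mpoly set. homogeneous l f})" for l
    unfolding ideal_gen_homogeneous_part
    by (rule linear_generators_imp_resolution[OF splittable_linear_generators[OF assms(1)]]) simp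
qed

section \<open>Minimal generators in an order with linear quotients\<close>

definition minimals :: "('v \<Rightarrow> nat) set \<Rightarrow> ('v \<Rightarrow> nat) set" where
  "minimals M = {f \<in> M. \<forall>g\<in>M. g \<le> f \<longrightarrow> g = f}"

lemma minimals_below:
  fixes f :: "'v::finite \<Rightarrow> nat"
  assumes "f \<in> M"
  shows "\<exists>g\<in>minimals M. g \<le> f"
  using assms
proof (induction "sum f UNIV" arbitrary: f rule: less_induct)
  case less
  show ?case
  proof (cases "f \<in> minimals M")
    case False
    then obtain g where g: "g \<in> M" "g \<le> f" "g \<noteq> f" using less.prems by (auto simp: minimals_def)
    then have "sum g UNIV < sum f UNIV" using sum_eq_imp_eq[OF g(2)] by fastforce
    from less.hyps[OF this g(1)] show ?thesis using g(2) by (meson order_trans)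
  qed auto
qed

text \<open>Combinatorial form of linear quotients: every earlier monomial, divided by its common
  factor with \<open>fs ! i\<close>, is a multiple of a variable \<open>z\<close> such that some
  earlier monomial divides \<open>z\<close> times \<open>fs ! i\<close>. These variables generate
  the colon ideal.\<close>

definition quotient_order :: "('v \<Rightarrow> nat) list \<Rightarrow> bool" where
  "quotient_order fs \<longleftrightarrow> (\<forall>i<length fs. \<forall>j<i. \<exists>z. (fs ! i) z < (fs ! j) z \<and>
     (\<exists>r<i. fs ! r \<le> (fs ! i)(z := Suc ((fs ! i) z))))"

text \<open>A generator \<open>f\<close> with \<open>c < f x\<close> stays minimal in
  \<open>M\<close>: a vector \<open>g \<le> f\<close> with \<open>g x = c\<close> could be exchanged
  to one below \<open>f\<close> in the first part, hence equal to \<open>f\<close>, although its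
  exponent at \<open>t\<close> is less than \<open>g t\<close>.\<close>

lemma minimals_split:
  fixes M :: "('v \<Rightarrow> nat) set"
  assumes c: "\<And>f. f \<in> M \<Longrightarrow> c \<le> f x"
    and ex: "\<And>f. f \<in> M \<Longrightarrow> f x = c \<Longrightarrow> \<exists>t. t \<noteq> x \<and> 0 < f t \<and> f(x := Suc c, t := f t - 1) \<in> M"
  shows "minimals M = minimals {f \<in> M. c < f x} \<union> minimals {f \<in> M. f x = c}"
proof (intro set_eqI iffI)
  fix f assume "f \<in> minimals M"
  then show "f \<in> minimals {f \<in> M. c < f x} \<union> minimals {f \<in> M. f x = c}"
    using c[of f] by (auto simp: minimals_def le_less)
next
  fix f assume f: "f \<in> minimals {f \<in> M. c < f x} \<union> minimals {f \<in> M. f x = c}"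
  have "g = f" if g: "g \<in> M" "g \<le> f" for g
  proof (cases "f x = c")
    case True
    then have "f \<in> minimals {f \<in> M. f x = c}" using f by (auto simp: minimals_def)
    moreover have "g x = c" using c[OF g(1)] le_funD[OF g(2), of x] True by simp
    ultimately show ?thesis using g by (auto simp: minimals_def)
  next
    case False
    then have f1: "f \<in> minimals {f \<in> M. c < f x}" using f by (auto simp: minimals_def)
    show ?thesis
    proof (cases "g x = c")
      case False
      then show ?thesis using f1 g c[OF g(1)] by (auto simp: minimals_def)
    next
      case True
      then obtain t where t: "t \<noteq> x" "0 < g t" "g(x := Suc c, t := g t - 1) \<in> M" using ex g(1) by blast
      let ?h = "g(x := Suc c, t := g t - 1)"
      have "c < f x" using f1 by (simp add: minimals_def)
      then have "?h \<le> f" using g(2) by (auto simp: le_fun_def intro: le_trans[OF diff_le_self])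
      moreover have "?h \<in> {f \<in> M. c < f x}" using t by simp
      ultimately have "?h = f" using f1 by (simp only: minimals_def mem_Collect_eq)
      then have "f t = g t - 1" by (metis fun_upd_same)
      then have False using t(2) le_funD[OF g(2), of t] by simp
      then show ?thesis ..
    qed
  qed
  then show "f \<in> minimals M" using f by (auto simp: minimals_def)
qed

text \<open>Generators with exponent above \<open>c\<close> at \<open>x\<close> are listed before
  those with exponent \<open>c\<close>. For a pair across the two lists the variable is
  \<open>x\<close>: a minimal generator below the exchanged vector divides \<open>x\<close> times
  the later one.\<close>

lemma splittable_quotient_order:
  fixes M :: "('v::finite \<Rightarrow> nat) set"
  assumes "splittable Z M"
  shows "\<exists>fs. distinct fs \<and> set fs = minimals M \<and> quotient_order fs"
  using assms
proof (induction rule: splittable.induct)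
  case (empty Z)
  then show ?case by (intro exI[of _ "[]"]) (simp add: minimals_def quotient_order_def)
next
  case (cone Z u)
  have "minimals {f. u \<le> f \<and> (\<forall>z\<in>Z. f z = u z)} = {u}"
    by (auto simp: minimals_def intro: order_antisym)
  then show ?case by (intro exI[of _ "[u]"]) (simp add: quotient_order_def)
next
  case (split x Z M c)
  obtain fs where fs: "distinct fs" "set fs = minimals {f \<in> M. c < f x}" "quotient_order fs"
    using split.IH(1) by blast
  obtain hs where hs: "distinct hs" "set hs = minimals {f \<in> M. f x = c}" "quotient_order hs"
    using split.IH(2) by blast
  have "distinct (fs @ hs)" using fs(1,2) hs(1,2) by (auto simp: minimals_def)
  moreover have "set (fs @ hs) = minimals M"
  proof -
    have "minimals M = minimals {f \<in> M. c < f x} \<union> minimals {f \<in> M. f x = c}"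
      by (rule minimals_split) (use split.hyps(2,5) in blast)+
    then show ?thesis using fs(2) hs(2) by simp
  qed
  moreover have "quotient_order (fs @ hs)"
    unfolding quotient_order_def
  proof (intro allI impI)
    fix i j assume i: "i < length (fs @ hs)" and j: "j < i"
    show "\<exists>z. ((fs @ hs) ! i) z < ((fs @ hs) ! j) z \<and>
      (\<exists>r<i. (fs @ hs) ! r \<le> ((fs @ hs) ! i)(z := Suc (((fs @ hs) ! i) z)))"
    proof (cases "i < length fs")
      case True
      then obtain z r where zr: "(fs ! i) z < (fs ! j) z" "r < i" "fs ! r \<le> (fs ! i)(z := Suc ((fs ! i) z))"
        using fs(3)[unfolded quotient_order_def, rule_format, OF True j] by auto
      then show ?thesis using True j by (intro exI[of _ z] conjI exI[of _ r]) (simp_all add: nth_append)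
    next
      case False
      define i' where "i' = i - length fs"
      have i': "i' < length hs" "i = length fs + i'" using False i by (auto simp: i'_def)
      let ?f = "hs ! i'"
      have f: "?f \<in> M" "?f x = c" using nth_mem[OF i'(1)] hs(2) by (auto simp: minimals_def)
      show ?thesis
      proof (cases "j < length fs")
        case True
        obtain t where t: "t \<noteq> x" "0 < ?f t" "?f(x := Suc c, t := ?f t - 1) \<in> M"
          using split.hyps(5)[OF f] by blast
        then obtain g where g: "g \<in> minimals {f \<in> M. c < f x}" "g \<le> ?f(x := Suc c, t := ?f t - 1)"
          using minimals_below[of "?f(x := Suc c, t := ?f t - 1)" "{f \<in> M. c < f x}"] by auto
        then obtain r where r: "r < length fs" "fs ! r = g" using fs(2) by (metis in_set_conv_nth)
        have "g \<le> ?f(x := Suc (?f x))"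
          using g(2) f(2) by (rule_tac order_trans) (auto simp: le_fun_def)
        moreover have "?f x < (fs ! j) x" using nth_mem[OF True] fs(2) f(2) by (auto simp: minimals_def)
        ultimately show ?thesis
          using True r i' by (intro exI[of _ x] conjI exI[of _ r]) (simp_all add: nth_append)
      next
        case j': False
        then have "j - length fs < i'" using j i' by linarith
        then obtain z r where zr: "?f z < (hs ! (j - length fs)) z" "r < i'" "hs ! r \<le> ?f(z := Suc (?f z))"
          using hs(3) i'(1) unfolding quotient_order_def by blast
        then show ?thesis
          using i' j' by (intro exI[of _ z] conjI exI[of _ "length fs + r"]) (simp_all add: nth_append)
      qed
    qed
  qed
  ultimately show ?case by blast
qed

lemma mem_mon_ideal_times_monomial:
  "p * monomial u \<in> mon_ideal F \<longleftrightarrow> (\<forall>m\<in>keys p. lookup (m + u) \<in> F)"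
  for p :: "('v, 'k::field) mpoly"
proof -
  have "keys (p * monomial u) = (\<lambda>m. m + u) ` keys p"
  proof (intro set_eqI iffI)
    fix m assume "m \<in> keys (p * monomial u)"
    then show "m \<in> (\<lambda>m. m + u) ` keys p" by (auto elim!: keys_timesE)
  next
    fix m assume "m \<in> (\<lambda>m. m + u) ` keys p"
    then show "m \<in> keys (p * monomial u)" by (auto simp: in_keys_iff lookup_times_monomial_add)
  qed
  then show ?thesis by (auto simp: mon_ideal_def)
qed

lemma ideal_quotient_principal:
  fixes u :: "'v \<Rightarrow>\<^sub>0 nat" and F :: "('v \<Rightarrow> nat) set"
  assumes "up_closed F"
  shows "ideal_quotient (mon_ideal F) (ideal_gen {monomial u}) =
    (mon_ideal {f. (\<lambda>v. f v + lookup u v) \<in> F} :: ('v, 'k::field) mpoly set)"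
proof -
  have sub: "module.subspace (*) (mon_ideal F :: ('v, 'k) mpoly set)"
    by (rule subspace_mon_ideal[OF assms])
  have "(\<forall>g\<in>ideal_gen {monomial u}. p * g \<in> mon_ideal F) \<longleftrightarrow> p * monomial u \<in> mon_ideal F"
    for p :: "('v, 'k) mpoly"
  proof
    assume "\<forall>g\<in>ideal_gen {monomial u}. p * g \<in> mon_ideal F"
    then show "p * monomial u \<in> mon_ideal F" by (simp add: ideal_gen_def span_times_base)
  next
    assume p: "p * monomial u \<in> mon_ideal F"
    have "module.subspace (*) {g. p * g \<in> mon_ideal F}"
      using sub unfolding subspace_times_def
      by (simp add: distrib_left mult.left_commute)
    then have "module.span (*) {monomial u} \<subseteq> {g. p * g \<in> mon_ideal F}"
      by (intro span_times_minimal) (use p in auto)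
    then show "\<forall>g\<in>ideal_gen {monomial u}. p * g \<in> mon_ideal F" by (auto simp: ideal_gen_def)
  qed
  then show ?thesis
    unfolding ideal_quotient_def mem_mon_ideal_times_monomial
    by (simp add: mon_ideal_def lookup_plus)
qed

lemma quotient_order_linear_quotients:
  fixes F :: "('v::finite \<Rightarrow> nat) set"
  assumes fs: "distinct fs" "set fs = minimals F" "quotient_order fs" and F: "up_closed F"
  shows "has_linear_quotients (mon_ideal F :: ('v, 'k::field) mpoly set)"
  unfolding has_linear_quotients_def
proof (intro exI[of _ "map expo fs"] conjI allI impI)
  have inj: "inj_on expo S" for S :: "('v \<Rightarrow> nat) set"
    by (rule inj_on_inverseI[of _ lookup]) simp
  show "distinct (map expo fs)" using fs(1) inj by (simp add: distinct_map)
  have up_min: "up (minimals F) = F"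
  proof
    show "up (minimals F) \<subseteq> F" using F by (auto simp: up_def up_closed_def minimals_def)
    show "F \<subseteq> up (minimals F)" using minimals_below[of _ F] by (force simp: up_def)
  qed
  show "minimal_monomial_generators (mon_ideal F :: ('v, 'k) mpoly set) (set (map expo fs))"
    unfolding minimal_monomial_generators_def
  proof (intro conjI allI impI notI)
    show "ideal_gen (monomial ` set (map expo fs)) = (mon_ideal F :: ('v, 'k) mpoly set)"
      using up_min fs(2) by (simp only: set_map ideal_gen_monomial_expo)
    fix U' assume U': "U' \<subset> set (map expo fs)"
      and eq: "ideal_gen (monomial ` U') = (mon_ideal F :: ('v, 'k) mpoly set)"
    obtain f where f: "f \<in> minimals F" "expo f \<notin> U'" using U' fs(2) by auto
    then have "(monomial (expo f) :: ('v, 'k) mpoly) \<in> mon_ideal (up (lookup ` U'))"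
      using eq unfolding ideal_gen_monomial by (simp add: mon_ideal_def minimals_def)
    then obtain s where s: "s \<in> U'" "lookup s \<le> f" by (auto simp: mon_ideal_def up_def)
    then obtain g where "g \<in> minimals F" "s = expo g" using U' fs(2) by auto
    then have "g = f" using f(1) s(2) by (auto simp: minimals_def)
    then show False using f(2) s(1) \<open>s = expo g\<close> by simp
  qed
  fix i assume "1 \<le> i \<and> i < length (map expo fs)"
  then have i: "i < length fs" by simp
  define W where "W = {z. \<exists>r<i. fs ! r \<le> (fs ! i)(z := Suc ((fs ! i) z))}"
  have "{f. (\<lambda>v. f v + (fs ! i) v) \<in> up (set (take i fs))} = {f. \<exists>v\<in>W. 0 < f v}"
  proof (intro set_eqI iffI)
    fix f assume "f \<in> {f. (\<lambda>v. f v + (fs ! i) v) \<in> up (set (take i fs))}"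
    then obtain j where j: "j < i" "fs ! j \<le> (\<lambda>v. f v + (fs ! i) v)"
      using i by (auto simp: up_def in_set_conv_nth)
    then obtain z where z: "(fs ! i) z < (fs ! j) z" "z \<in> W"
      using fs(3)[unfolded quotient_order_def, rule_format, OF i j(1)] by (auto simp: W_def)
    then have "0 < f z" using le_funD[OF j(2), of z] by simp
    then show "f \<in> {f. \<exists>v\<in>W. 0 < f v}" using z by auto
  next
    fix f :: "'v \<Rightarrow> nat" assume "f \<in> {f. \<exists>v\<in>W. 0 < f v}"
    then obtain v r where v: "0 < f v" "r < i" "fs ! r \<le> (fs ! i)(v := Suc ((fs ! i) v))"
      by (auto simp: W_def)
    then have "fs ! r \<le> (\<lambda>v. f v + (fs ! i) v)"
      by (rule_tac order_trans[OF v(3)]) (auto simp: le_fun_def)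
    moreover have "fs ! r \<in> set (take i fs)" using v(2) i by (auto simp: in_set_conv_nth)
    ultimately show "f \<in> {f. (\<lambda>v. f v + (fs ! i) v) \<in> up (set (take i fs))}" by (auto simp: up_def)
  qed
  moreover have "ideal_gen (monomial ` set (take i (map expo fs))) =
      (mon_ideal (up (set (take i fs))) :: ('v, 'k) mpoly set)"
    by (simp only: take_map set_map ideal_gen_monomial_expo)
  ultimately show "\<exists>W. ideal_quotient (ideal_gen (monomial ` set (take i (map expo fs))))
      (ideal_gen {monomial (map expo fs ! i)}) = (ideal_gen (Var ` W) :: ('v, 'k) mpoly set)"
    using i by (intro exI[of _ W]) (simp add: ideal_quotient_principal up_closed_up Var_ideal)
qed

text \<open>The monomial \<open>u z / t\<close> is in the ideal, where \<open>z\<close> comes from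
  the excess of \<open>v\<close> over \<open>u\<close> and \<open>t\<close> is any other variable of
  \<open>u\<close>.\<close>

definition exchange :: "('v \<Rightarrow> nat) set \<Rightarrow> ('v \<Rightarrow> nat) \<Rightarrow> ('v \<Rightarrow> nat) \<Rightarrow> bool" where
  "exchange F u v \<longleftrightarrow> (\<exists>z t. z \<noteq> t \<and> u z < v z \<and> 0 < u t \<and> u(z := Suc (u z), t := u t - 1) \<in> F)"

lemma minimal_generators_antichain:
  assumes "minimal_monomial_generators (I :: ('v, 'k::field) mpoly set) U" "a \<in> U" "b \<in> U" "lookup a \<le> lookup b"
  shows "a = b"
proof (rule ccontr)
  assume "a \<noteq> b"
  have "up (lookup ` (U - {b})) = up (lookup ` U)"
  proof
    show "up (lookup ` U) \<subseteq> up (lookup ` (U - {b}))"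
    proof
      fix f assume "f \<in> up (lookup ` U)"
      then obtain s where s: "s \<in> U" "lookup s \<le> f" by (auto simp: up_def)
      show "f \<in> up (lookup ` (U - {b}))"
      proof (cases "s = b")
        case True
        then have "lookup a \<le> f" using s assms(4) by (simp add: order_trans)
        then show ?thesis using assms(2) \<open>a \<noteq> b\<close> by (auto simp: up_def)
      qed (use s in \<open>auto simp: up_def\<close>)
    qed
  qed (auto simp: up_def)
  then have "ideal_gen (monomial ` (U - {b})) = I"
    using assms(1) unfolding minimal_monomial_generators_def ideal_gen_monomial by simp
  then show False using assms(1,3) unfolding minimal_monomial_generators_def by blast
qed

text \<open>Of the two generators, the later one, say \<open>u\<close>, can be exchanged. The colon
  ideal contains \<open>v / gcd(u, v)\<close>, hence a variable \<open>z\<close> dividing it, so an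
  earlier generator divides \<open>u z\<close>. Minimal generators are incomparable, so that
  generator has a smaller exponent than \<open>u\<close> at some \<open>t\<close>. The order is not
  known, hence the disjunction.\<close>

lemma linear_quotients_exchange:
  fixes F :: "('v::finite \<Rightarrow> nat) set"
  assumes lq: "has_linear_quotients (mon_ideal F :: ('v, 'k::field) mpoly set)" and F: "up_closed F"
    and uv: "u \<in> minimals F" "v \<in> minimals F" "u \<noteq> v"
  shows "exchange F u v \<or> exchange F v u"
proof -
  obtain us where us: "distinct us" "minimal_monomial_generators (mon_ideal F :: ('v, 'k) mpoly set) (set us)"
    and col: "\<forall>i. 1 \<le> i \<and> i < length us \<longrightarrow> (\<exists>W. ideal_quotient (ideal_gen (monomial ` set (take i us)))
                               (ideal_gen {monomial (us ! i)}) = (ideal_gen (Var ` W) :: ('v, 'k) mpoly set))"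
    using lq unfolding has_linear_quotients_def by blast
  have gen: "(mon_ideal (up (lookup ` set us)) :: ('v, 'k) mpoly set) = mon_ideal F"
    using us(2) unfolding minimal_monomial_generators_def ideal_gen_monomial by simp
  have us_F: "lookup s \<in> F" if "s \<in> set us" for s
  proof -
    have "(monomial s :: ('v, 'k) mpoly) \<in> mon_ideal (up (lookup ` set us))"
      using that by (auto simp: mon_ideal_def up_def)
    then show ?thesis unfolding gen by (simp add: mon_ideal_def)
  qed
  have in_us: "\<exists>i<length us. us ! i = expo f" if f: "f \<in> minimals F" for f
  proof -
    have "(monomial (expo f) :: ('v, 'k) mpoly) \<in> mon_ideal (up (lookup ` set us))"
      unfolding gen using f by (simp add: mon_ideal_def minimals_def)
    then obtain s where s: "s \<in> set us" "lookup s \<le> f" by (auto simp: mon_ideal_def up_def)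
    then have "lookup s = f" using f us_F by (auto simp: minimals_def)
    then have "s = expo f" by (metis expo_lookup)
    then show ?thesis using s(1) by (metis in_set_conv_nth)
  qed
  have main: "exchange F u v"
    if ij: "i < length us" "us ! i = expo u" "j < i" "us ! j = expo v" for i j u v
  proof -
    let ?E = "up (lookup ` set (take i us))"
    obtain W where W: "ideal_quotient (ideal_gen (monomial ` set (take i us)))
        (ideal_gen {monomial (us ! i)}) = (ideal_gen (Var ` W) :: ('v, 'k) mpoly set)"
      using col ij(1,3) by (metis One_nat_def Suc_leI not_gr_zero not_less_zero)
    then have W: "(mon_ideal {f. (\<lambda>x. f x + u x) \<in> ?E} :: ('v, 'k) mpoly set) = mon_ideal {f. \<exists>x\<in>W. 0 < f x}"
      using ij(2) by (simp add: ideal_gen_monomial ideal_quotient_principal up_closed_up Var_ideal)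
    have W_iff: "(\<lambda>x. f x + u x) \<in> ?E \<longleftrightarrow> (\<exists>x\<in>W. 0 < f x)" for f
    proof -
      have "(monomial (expo f) :: ('v, 'k) mpoly) \<in> mon_ideal {f. (\<lambda>x. f x + u x) \<in> ?E} \<longleftrightarrow>
        (monomial (expo f) :: ('v, 'k) mpoly) \<in> mon_ideal {f. \<exists>x\<in>W. 0 < f x}" unfolding W ..
      then show ?thesis by (simp add: mon_ideal_def)
    qed
    have "us ! j \<in> set (take i us)" using ij by (auto simp: in_set_conv_nth)
    then have "(\<lambda>x. (v x - u x) + u x) \<in> ?E"
      using ij(4) by (auto simp: up_def le_fun_def intro!: bexI[of _ "us ! j"])
    then obtain z where z: "z \<in> W" "u z < v z" unfolding W_iff by auto
    then have "(\<lambda>x. (if x = z then 1 else 0) + u x) \<in> ?E" unfolding W_iff by auto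
    then obtain r where r: "r < i" "lookup (us ! r) \<le> (\<lambda>x. (if x = z then 1 else 0) + u x)"
      using ij(1) by (auto simp: up_def in_set_conv_nth)
    let ?g = "lookup (us ! r)"
    have r_us: "us ! r \<in> set us" "us ! i \<in> set us" using r(1) ij(1) by auto
    have neq: "us ! r \<noteq> us ! i" using us(1) r(1) ij(1) by (simp add: nth_eq_iff_index_eq)
    then have "\<not> u \<le> ?g"
      using minimal_generators_antichain[OF us(2) r_us(2,1)] ij(2) by auto
    then obtain t where t: "?g t < u t" by (auto simp: le_fun_def not_le)
    have "\<not> ?g \<le> u"
      using minimal_generators_antichain[OF us(2) r_us] ij(2) neq by auto
    then obtain x where x: "u x < ?g x" by (auto simp: le_fun_def not_le)
    have "x = z" using x le_funD[OF r(2), of x] by (auto split: if_splits)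
    then have "z \<noteq> t" using x t by auto
    have "?g \<le> u(z := Suc (u z), t := u t - 1)"
    proof (rule le_funI)
      fix y show "?g y \<le> (u(z := Suc (u z), t := u t - 1)) y"
        using le_funD[OF r(2), of y] t by (auto split: if_splits)
    qed
    then have "u(z := Suc (u z), t := u t - 1) \<in> F"
      using us_F[OF r_us(1)] F unfolding up_closed_def by blast
    then show ?thesis unfolding exchange_def using \<open>z \<noteq> t\<close> z(2) t by force
  qed
  obtain i j where ij: "i < length us" "us ! i = expo u" "j < length us" "us ! j = expo v"
    using in_us uv(1,2) by blast
  have "i \<noteq> j" using ij uv(3) lookup_expo by metis
  then show ?thesis using main[of i u j v] main[of j v i u] ij by (meson linorder_neqE_nat)
qed

section \<open>Exchange property of linear resolutions\<close>

lemma mdeg_1E: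
  fixes s :: "'v::finite \<Rightarrow>\<^sub>0 nat"
  assumes "mdeg s = 1"
  obtains t where "s = single t 1"
proof -
  have "sum (lookup s) UNIV = 1" using assms by (simp add: mdeg_eq_sum)
  then obtain t where t: "lookup s t = 1" "\<forall>x. x \<noteq> t \<longrightarrow> lookup s x = 0"
    using sum_eq_1_iff[of UNIV "lookup s"] by auto
  then have "s = single t 1" by (intro poly_mapping_eqI) (auto simp: lookup_single when_def)
  then show ?thesis by (rule that)
qed

lemma mdeg_0D: "mdeg s = 0 \<Longrightarrow> s = 0" for s :: "'v::finite \<Rightarrow>\<^sub>0 nat"
  by (rule poly_mapping_eqI) (simp add: mdeg_eq_sum)

lemma lookup_scalar_times: "lookup (single 0 a * p) m = a * lookup p m" for p :: "('v, 'k::field) mpoly"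
  by (simp add: mult.commute[of "single 0 a"] lookup_times_single le_fun_def)

lemma lookup_times_lowest:
  fixes g p :: "('v::finite, 'k::field) mpoly"
  assumes "homogeneous l g" "mdeg m = l"
  shows "lookup (g * p) m = lookup g m * lookup p 0"
proof -
  have "(if lookup s \<le> lookup m then lookup g (m - s) * lookup p s else 0)
      = (if s = 0 then lookup g m * lookup p 0 else 0)" for s
  proof (cases "lookup s \<le> lookup m \<and> lookup g (m - s) \<noteq> 0")
    case True
    then obtain k where k: "m = k + s" using adds_iff by blast
    then have "mdeg k = l" using True assms(1) by (auto simp: homogeneous_def in_keys_iff)
    then have "mdeg s = 0" using k assms(2) by (simp add: mdeg_add)
    then have "s = 0" by (rule mdeg_0D)
    then show ?thesis by (simp add: le_fun_def)
  qed (auto simp: le_fun_def)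
  then show ?thesis by (simp add: lookup_times in_keys_iff)
qed

text \<open>The relation between \<open>u\<close> and \<open>v\<close> with coefficients
  \<open>v / gcd(u, v)\<close> and \<open>u / gcd(u, v)\<close> must be a combination of linear
  syzygies. Its coefficient at \<open>u\<close> is a product of variables in which \<open>v\<close>
  exceeds \<open>u\<close>; without an exchange, no such variable occurs at \<open>u\<close> in a
  linear syzygy. The generators \<open>g\<close> of the resolution need not be monomials, so this is
  read off from coefficients.\<close>

lemma linear_resolution_exchange:
  fixes M :: "('v::finite \<Rightarrow> nat) set"
  assumes res: "has_linear_resolution (mon_ideal (up M) :: ('v, 'k::field) mpoly set)"
    and deg: "\<And>f. f \<in> M \<Longrightarrow> sum f UNIV = l" and uv: "u \<in> M" "v \<in> M" "u \<noteq> v"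
  shows "exchange M u v"
proof (rule ccontr)
  assume no: "\<not> ?thesis"
  obtain d b g A where "linear_resolution (mon_ideal (up M) :: ('v, 'k) mpoly set) d b g A"
    using res unfolding has_linear_resolution_def by (elim exE)
  note res = this[unfolded linear_resolution_def]
  have hom_g: "homogeneous d (g j)" if "j < b 0" for j using res that by simp
  have hom_A: "homogeneous 1 (A 0 r c)" if "r < b 0" "c < b 1" for r c using res that by simp
  have gens: "mon_ideal (up M) = {\<Sum>j<b 0. g j * w j | w. True}" using res by (elim conjE)
  have syz: "(\<Sum>j<b 0. g j * w j) = 0 \<longleftrightarrow> (\<exists>z. \<forall>r<b 0. w r = (\<Sum>c<b 1. A 0 r c * z c))" for w
    using res by (elim conjE) (erule allE)
  have in_gens: "\<exists>w. p = (\<Sum>j<b 0. g j * w j)" if p: "p \<in> mon_ideal (up M)" for p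
    using p unfolding gens by (elim CollectE exE conjE) (rule exI)
  have g_in: "g j \<in> mon_ideal (up M)" if "j < b 0" for j
    unfolding gens ideal_gen_family[symmetric] ideal_gen_def
    by (rule span_times_base) (use that in simp)
  have up_deg: "l \<le> sum f UNIV" if f: "f \<in> up M" for f
  proof -
    obtain h where h: "h \<in> M" "h \<le> f" using f by (auto simp: up_def)
    then have "sum h UNIV \<le> sum f UNIV" by (intro sum_mono) (simp add: le_fun_def)
    then show ?thesis using deg[OF h(1)] by simp
  qed
  have mono_in: "(monomial (expo f) :: ('v, 'k) mpoly) \<in> mon_ideal (up M)" if "f \<in> M" for f
    using that by (auto simp: mon_ideal_def up_def)
  obtain p where p: "monomial (expo u) = (\<Sum>j<b 0. g j * p j)" using in_gens[OF mono_in[OF uv(1)]] by (elim exE)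
  obtain q where q: "monomial (expo v) = (\<Sum>j<b 0. g j * q j)" using in_gens[OF mono_in[OF uv(2)]] by (elim exE)
  \<comment> \<open>To expand \<open>u\<close>, some \<open>g j\<close> has a term of degree
    \<open>d\<close> dividing \<open>u\<close>; nothing in the ideal has degree below
    \<open>l\<close>, so \<open>d = l\<close>.\<close>
  have "expo u \<in> keys (\<Sum>j<b 0. g j * p j)" unfolding p[symmetric] by simp
  then obtain j where j: "j \<in> {..<b 0}" "expo u \<in> keys (g j * p j)" by (rule in_keys_sumE)
  obtain a c where ac: "a \<in> keys (g j)" "expo u = a + c" using j(2) by (rule keys_timesE)
  have "mdeg a = d" using hom_g j(1) ac(1) by (simp add: homogeneous_def)
  moreover have "l \<le> mdeg a" using g_in[of j] j(1) ac(1) up_deg by (simp add: mon_ideal_def mdeg_eq_sum)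
  moreover have "mdeg a \<le> l"
    using arg_cong[OF ac(2), of mdeg] deg[OF uv(1)] by (simp add: mdeg_add mdeg_expo)
  ultimately have d: "d = l" by simp
  have g_keys: "lookup m \<in> M" if m: "m \<in> keys (g j)" "j < b 0" for m j
  proof -
    have "lookup m \<in> up M" using g_in[OF m(2)] m(1) by (simp add: mon_ideal_def)
    then obtain h where h: "h \<in> M" "h \<le> lookup m" by (auto simp: up_def)
    have "sum (lookup m) UNIV = l" using hom_g[OF m(2)] m(1) d by (simp add: homogeneous_def mdeg_eq_sum)
    then have "lookup m = h" using sum_eq_imp_eq[OF h(2)] deg[OF h(1)] by simp
    then show ?thesis using h(1) by simp
  qed
  \<comment> \<open>Weights that turn a syzygy of the \<open>g j\<close> into its coefficient at the
    monomial \<open>u\<close>.\<close>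
  define D where "D = (\<lambda>j. lookup (g j) (expo u))"
  define L where "L = (\<lambda>c. \<Sum>j<b 0. single 0 (D j) * A 0 j c)"
  txt \<open>\<open>L c\<close> is the coefficient of \<open>u\<close> in the \<open>c\<close>-th linear syzygy, and \<open>u * L c\<close> is a
    combination of the other monomials of degree \<open>l\<close>.\<close>
  have L: "lookup (L c) (single z 1) = 0" if c: "c < b 1" and z: "u z < v z" for c z
  proof -
    have "(\<Sum>j<b 0. g j * A 0 j c) = 0"
      unfolding syz[of "\<lambda>j. A 0 j c"]
      by (intro exI[of _ "\<lambda>c'. if c' = c then 1 else 0"]) (use c in \<open>simp add: if_distrib cong: if_cong\<close>)
    then have "(\<Sum>j<b 0. lookup (g j * A 0 j c) (expo u + single z 1)) = 0"
      by (metis lookup_sum lookup_zero)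
    moreover have "lookup (g j * A 0 j c) (expo u + single z 1) = D j * lookup (A 0 j c) (single z 1)"
      if j: "j < b 0" for j
    proof -
      let ?m = "expo u + single z 1"
      have "(if lookup s \<le> lookup ?m then lookup (g j) (?m - s) * lookup (A 0 j c) s else 0)
          = (if s = single z 1 then D j * lookup (A 0 j c) (single z 1) else 0)"
        if s: "s \<in> keys (A 0 j c)" for s
      proof (cases "s = single z 1")
        case True
        then show ?thesis by (simp add: D_def le_fun_def lookup_add)
      next
        case False
        have "mdeg s = 1" using hom_A[OF j c] s by (simp add: homogeneous_def)
        then obtain t where t: "s = single t 1" by (rule mdeg_1E)
        then have tz: "t \<noteq> z" using False by auto
        \<comment> \<open>Another contribution to the monomial \<open>u z\<close> would come from a
          term \<open>u z / t\<close> of \<open>g j\<close>; its exponent vector is in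
          \<open>M\<close>, so it would be an exchange.\<close>
        have "lookup (g j) (?m - s) = 0" if le: "lookup s \<le> lookup ?m"
        proof (rule ccontr)
          assume "lookup (g j) (?m - s) \<noteq> 0"
          then have "lookup (?m - s) \<in> M" using g_keys j by (simp add: in_keys_iff)
          moreover have "lookup (?m - s) = u(z := Suc (u z), t := u t - 1)"
            using tz by (auto simp: t lookup_add lookup_minus lookup_single when_def fun_eq_iff)
          moreover have "0 < u t" using le_funD[OF le, of t] tz by (simp add: t lookup_add lookup_single when_def)
          ultimately have "exchange M u v"
            using tz z unfolding exchange_def by (intro exI[of _ z] exI[of _ t]) simp
          then show False using no by simp
        qed
        then show ?thesis using False by simp
      qed
      then have "lookup (g j * A 0 j c) ?m =
          (\<Sum>s\<in>keys (A 0 j c). if s = single z 1 then D j * lookup (A 0 j c) (single z 1) else 0)"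
        unfolding lookup_times by (intro sum.cong refl)
      then show ?thesis by (simp add: in_keys_iff)
    qed
    ultimately show ?thesis by (simp add: L_def lookup_sum lookup_scalar_times)
  qed
  have hom_L: "homogeneous 1 (L c)" if c: "c < b 1" for c
    unfolding L_def
  proof (rule homogeneous_sum)
    fix j assume "j \<in> {..<b 0}"
    then have "homogeneous (0 + 1) (single 0 (D j) * A 0 j c)"
      by (intro homogeneous_times hom_A c) (auto simp: homogeneous_def mdeg_def)
    then show "homogeneous 1 (single 0 (D j) * A 0 j c)" by simp
  qed
  define \<alpha> where "\<alpha> = expo (\<lambda>x. v x - u x)"
  define \<beta> where "\<beta> = expo (\<lambda>x. u x - v x)"
  have ab: "expo u + \<alpha> = expo v + \<beta>"
    by (rule poly_mapping_eqI) (simp add: lookup_add \<alpha>_def \<beta>_def)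
  define w where "w = (\<lambda>j. monomial \<alpha> * p j - monomial \<beta> * q j)"
  have "(\<Sum>j<b 0. g j * w j) = monomial \<alpha> * monomial (expo u) - monomial \<beta> * monomial (expo v)"
    unfolding p q w_def by (simp add: right_diff_distrib sum_subtractf sum_distrib_left mult.left_commute)
  also have "\<dots> = 0" using ab by (simp add: monomial_times[symmetric] add.commute)
  finally obtain \<zeta> where \<zeta>: "\<forall>r<b 0. w r = (\<Sum>c<b 1. A 0 r c * \<zeta> c)" unfolding syz by (elim exE)
  have "(\<Sum>j<b 0. single 0 (D j) * w j) = (\<Sum>j<b 0. \<Sum>c<b 1. single 0 (D j) * A 0 j c * \<zeta> c)"
    using \<zeta> by (simp add: sum_distrib_left mult.assoc)
  also have "\<dots> = (\<Sum>c<b 1. L c * \<zeta> c)"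
    by (subst sum.swap) (simp add: L_def sum_distrib_right)
  finally have E: "(\<Sum>j<b 0. single 0 (D j) * w j) = (\<Sum>c<b 1. L c * \<zeta> c)" .
  have "(\<Sum>j<b 0. D j * lookup (w j) \<alpha>) = lookup (\<Sum>j<b 0. single 0 (D j) * w j) \<alpha>"
    by (simp add: lookup_sum lookup_scalar_times)
  also have "\<dots> = (\<Sum>c<b 1. lookup (\<zeta> c * L c) \<alpha>)"
    unfolding E by (simp add: lookup_sum mult.commute)
  also have "\<dots> = 0"
  proof (rule sum.neutral, rule ballI)
    fix c assume c: "c \<in> {..<b 1}"
    have "\<not> lookup s \<le> lookup \<alpha>" if s: "s \<in> keys (L c)" for s
    proof
      assume le: "lookup s \<le> lookup \<alpha>"
      have "mdeg s = 1" using hom_L c s by (simp add: homogeneous_def)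
      then obtain t where t: "s = single t 1" by (rule mdeg_1E)
      then have "u t < v t" using le_funD[OF le, of t] by (simp add: \<alpha>_def)
      then show False using L[of c t] c s t by (simp add: in_keys_iff)
    qed
    then show "lookup (\<zeta> c * L c) \<alpha> = 0" by (simp add: lookup_times)
  qed
  finally have sum0: "(\<Sum>j<b 0. D j * lookup (w j) \<alpha>) = 0" .
  have "\<not> lookup \<beta> \<le> lookup \<alpha>"
  proof
    assume le: "lookup \<beta> \<le> lookup \<alpha>"
    have "u x \<le> v x" for x using le_funD[OF le, of x] by (simp add: \<alpha>_def \<beta>_def)
    then have "u \<le> v" by (simp add: le_fun_def)
    then show False using sum_eq_imp_eq[of u v] deg uv by simp
  qed
  \<comment> \<open>At \<open>\<alpha>\<close> the second summand of \<open>w j\<close> vanishes, as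
    \<open>\<beta>\<close> does not divide \<open>\<alpha>\<close>, and the first contributes the
    constant term of \<open>p j\<close>. With the weights \<open>D j\<close> these add up to the
    coefficient of \<open>u\<close> in \<open>u\<close>, which is 1.\<close>
  then have "lookup (w j) \<alpha> = lookup (p j) 0" for j
    using lookup_times_monomial_add(2)[of \<alpha> "p j" 0]
    by (simp add: w_def lookup_minus mult.commute[of "monomial \<beta>"])
      (simp add: monomial_def lookup_times_single)
  then have "(\<Sum>j<b 0. D j * lookup (p j) 0) = 0" using sum0 by simp
  moreover have "(\<Sum>j<b 0. D j * lookup (p j) 0) = lookup (monomial (expo u) :: ('v, 'k) mpoly) (expo u)"
    unfolding p lookup_sum D_def
    using hom_g d deg[OF uv(1)] by (intro sum.cong) (simp_all add: lookup_times_lowest[of l] mdeg_expo)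
  ultimately show False by (simp add: monomial_def)
qed

lemma componentwise_linear_exchange:
  fixes F :: "('v::finite \<Rightarrow> nat) set"
  assumes "componentwise_linear (mon_ideal F :: ('v, 'k::field) mpoly set)"
    and "u \<in> F" "v \<in> F" "u \<noteq> v" "sum u UNIV = sum v UNIV"
  shows "exchange F u v"
proof -
  let ?M = "{f \<in> F. sum f UNIV = sum u UNIV}"
  have "has_linear_resolution (mon_ideal (up ?M) :: ('v, 'k) mpoly set)"
    using assms(1) unfolding componentwise_linear_def ideal_gen_homogeneous_part by blast
  then have "exchange ?M u v"
    by (rule linear_resolution_exchange[where l = "sum u UNIV"]) (use assms in auto)
  then show ?thesis unfolding exchange_def by blast
qed

section \<open>Bipartite graphs with a clique on one side\<close>

lemma sum_indicator_nat: "(\<Sum>x\<in>UNIV. if x \<in> Q then 1 else 0) = card Q" for Q :: "'v::finite set"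
  by (simp add: sum.If_cases)

locale bipartite_clique =
  fixes adj :: "'v::finite \<Rightarrow> 'v \<Rightarrow> bool" and A :: "'v set"
  assumes sym: "symp adj"
    and bip: "adj u v \<Longrightarrow> u \<in> A \<longleftrightarrow> v \<notin> A"
    and nbr: "a \<in> A \<Longrightarrow> \<exists>b. adj a b"
begin

definition cover_exponents :: "nat \<Rightarrow> ('v \<Rightarrow> nat) set" where
  "cover_exponents k = {f. (\<forall>u v. adj u v \<longrightarrow> k \<le> f u + f v) \<and>
     (\<forall>a\<in>A. \<forall>b\<in>A. a \<noteq> b \<longrightarrow> k \<le> f a + f b)}"

lemma symD: "adj a b \<Longrightarrow> adj b a"
  using sym by (auto dest: sympD)

lemma up_closed_cover_exponents: "up_closed (cover_exponents k)"
  unfolding up_closed_def cover_exponents_def le_fun_def mem_Collect_eq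
  by (meson add_mono order_trans)

lemma splittable_cover_exponents:
  assumes "leafy adj"
  shows "splittable {} (cover_exponents k)"
  unfolding cover_exponents_def using sym bip assms nbr by (rule clique_cover_splittable)

text \<open>Exponent vector of \<open>\<Prod>a\<in>A. a\<^bsup>k-1\<^esup>\<close> times the squarefree monomial with support \<open>Q\<close>.\<close>
definition cover_exponent :: "nat \<Rightarrow> 'v set \<Rightarrow> 'v \<Rightarrow> nat" where
  "cover_exponent k Q = (\<lambda>w. (if w \<in> A then k - 1 else 0) + (if w \<in> Q then 1 else 0))"

definition nbrs :: "'v set \<Rightarrow> 'v set" where
  "nbrs S = {w. \<exists>s\<in>S. adj s w}"

text \<open>Isolated survivors are left out, so that either side is a minimal vertex cover of the
  surviving edges.\<close>

definition side :: "'v set \<Rightarrow> bool \<Rightarrow> 'v set" where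
  "side S b = {w. w \<notin> closed_hull adj S \<and> (w \<in> A \<longleftrightarrow> b) \<and> (\<exists>w'. adj w w' \<and> w' \<notin> closed_hull adj S)}"

lemma side_opposite: "w \<in> side S b \<Longrightarrow> adj w w' \<Longrightarrow> w' \<notin> side S b"
  using bip by (auto simp: side_def)

text \<open>Two exponents \<open>k - 1\<close> satisfy the clique conditions if
  \<open>k \<ge> 2\<close>, and an edge of \<open>adj\<close> then lacks just 1, supplied by an
  endpoint in \<open>Q\<close>: \<open>nbrs S\<close> covers the edges that meet the closed
  neighbourhood of \<open>S\<close>, and \<open>side S b\<close> the others.\<close>

lemma cover_exponent_mem:
  assumes "2 \<le> k" and S: "\<And>u v. u \<in> S \<Longrightarrow> v \<in> S \<Longrightarrow> \<not> adj u v" and Q: "nbrs S \<union> side S b \<subseteq> Q"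
  shows "cover_exponent k Q \<in> cover_exponents k"
proof -
  have "k \<le> cover_exponent k Q u + cover_exponent k Q v" if uv: "adj u v" for u v
  proof -
    have "u \<in> Q \<or> v \<in> Q"
    proof (cases "u \<in> closed_hull adj S \<or> v \<in> closed_hull adj S")
      case True
      then have "u \<in> nbrs S \<or> v \<in> nbrs S"
        using uv symD[OF uv] by (auto simp: closed_hull_def nbrs_def)
      then show ?thesis using Q by auto
    next
      case False
      then have "u \<in> side S b \<or> v \<in> side S b"
        using uv symD[OF uv] bip[OF uv] by (auto simp: side_def)
      then show ?thesis using Q by auto
    qed
    then show ?thesis using bip[OF uv] assms(1) by (auto simp: cover_exponent_def)
  qed
  then show ?thesis using assms(1) by (auto simp: cover_exponents_def cover_exponent_def)
qed

text \<open>A decrease at \<open>t\<close> has to be compensated at its neighbours, and increases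
  occur only in \<open>Z\<close>. For \<open>t\<close> in \<open>nbrs S\<close> the edge to
  \<open>S\<close> is tight and \<open>Z\<close> avoids \<open>S\<close>. For other \<open>t\<close>
  off the side, a neighbour outside \<open>A\<close> would have to supply 2, but has at most 1. On
  the side, each surviving neighbour must be increased. An empty \<open>Z\<close> gives minimality,
  a singleton the leaf.\<close>

lemma exponent_below_cover_exponent:
  assumes k: "2 \<le> k" and S: "\<And>u v. u \<in> S \<Longrightarrow> v \<in> S \<Longrightarrow> \<not> adj u v"
    and g: "g \<in> cover_exponents k"
    and le: "\<And>w. w \<notin> Z \<Longrightarrow> g w \<le> cover_exponent k (nbrs S \<union> side S b) w"
      "\<And>w. g w \<le> Suc (cover_exponent k (nbrs S \<union> side S b) w)"
    and t: "g t < cover_exponent k (nbrs S \<union> side S b) t"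
    and Z: "Z \<inter> closed_hull adj S = {}" "Z \<inter> side S b = {}"
  shows "t \<in> side S b \<and> (\<forall>w. adj t w \<longrightarrow> w \<notin> closed_hull adj S \<longrightarrow> w \<in> Z)"
proof -
  let ?u = "cover_exponent k (nbrs S \<union> side S b)"
  have edge: "k \<le> g a + g b" if "adj a b" for a b using g that by (simp add: cover_exponents_def)
  have alive: "w \<notin> nbrs S" if "w \<notin> closed_hull adj S" for w
    using that by (auto simp: nbrs_def closed_hull_def)
  have t_side: "t \<in> side S b"
  proof (rule ccontr)
    assume t_notin: "t \<notin> side S b"
    show False
    proof (cases "t \<in> nbrs S")
      case True
      then obtain s where s: "s \<in> S" "adj s t" by (auto simp: nbrs_def)
      have sN: "s \<in> closed_hull adj S" "s \<notin> nbrs S" using s(1) S by (auto simp: closed_hull_def nbrs_def)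
      then have "g s \<le> ?u s" "s \<notin> side S b" using le(1)[of s] Z by (auto simp: side_def)
      then show False
        using edge[OF s(2)] bip[OF s(2)] sN(2) t k by (auto simp: cover_exponent_def split: if_splits)
    next
      case False
      then have tA: "t \<in> A" "g t \<le> k - 2" using t t_notin k by (auto simp: cover_exponent_def split: if_splits)
      obtain w where w: "adj t w" using nbr[OF tA(1)] by auto
      have "w \<notin> A" using bip[OF w] tA(1) by simp
      have "g w \<le> 1"
      proof (cases "w \<in> Z")
        case True
        then have "w \<notin> nbrs S \<union> side S b" using Z alive by auto
        then show ?thesis using le(2)[of w] \<open>w \<notin> A\<close> by (simp add: cover_exponent_def)
      next
        case False
        then show ?thesis using le(1)[of w] \<open>w \<notin> A\<close> by (auto simp: cover_exponent_def split: if_splits)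
      qed
      then show False using edge[OF w] tA(2) k by linarith
    qed
  qed
  moreover have "w \<in> Z" if w: "adj t w" "w \<notin> closed_hull adj S" for w
  proof (rule ccontr)
    assume "w \<notin> Z"
    then have "g w \<le> ?u w" by (rule le(1))
    moreover have "w \<notin> nbrs S \<union> side S b" using alive[OF w(2)] side_opposite[OF t_side w(1)] by simp
    ultimately show False
      using edge[OF w(1)] bip[OF w(1)] t k by (auto simp: cover_exponent_def split: if_splits)
  qed
  ultimately show ?thesis by blast
qed

lemma cover_exponent_minimal:
  assumes "2 \<le> k" "\<And>u v. u \<in> S \<Longrightarrow> v \<in> S \<Longrightarrow> \<not> adj u v"
  shows "cover_exponent k (nbrs S \<union> side S b) \<in> minimals (cover_exponents k)"
proof -
  let ?u = "cover_exponent k (nbrs S \<union> side S b)"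
  have "g = ?u" if g: "g \<in> cover_exponents k" "g \<le> ?u" for g
  proof (rule ccontr)
    assume "g \<noteq> ?u"
    then have "\<not> ?u \<le> g" using g(2) by (auto intro: order_antisym)
    then obtain t where t: "g t < ?u t" by (auto simp: le_fun_def not_le)
    have "t \<in> side S b \<and> (\<forall>w. adj t w \<longrightarrow> w \<notin> closed_hull adj S \<longrightarrow> w \<in> {})"
      by (rule exponent_below_cover_exponent[OF assms g(1) _ _ t])
        (use le_funD[OF g(2)] in \<open>auto intro: le_SucI\<close>)
    then show False by (auto simp: side_def)
  qed
  then show ?thesis using cover_exponent_mem[OF assms subset_refl] by (simp add: minimals_def)
qed

text \<open>The gained variable \<open>z\<close> is the only increase, so the vertex
  \<open>t\<close> that gives way has \<open>z\<close> as its only surviving neighbour.\<close>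

lemma exchange_imp_leaf:
  assumes k: "2 \<le> k" and S: "\<And>u v. u \<in> S \<Longrightarrow> v \<in> S \<Longrightarrow> \<not> adj u v"
    and ex: "exchange (cover_exponents k) (cover_exponent k (nbrs S \<union> side S b)) (cover_exponent k Q)"
    and Q: "Q \<subseteq> nbrs S \<union> side S b \<union> side S b'"
  shows "has_leaf_outside adj (closed_hull adj S)"
proof -
  let ?u = "cover_exponent k (nbrs S \<union> side S b)"
  obtain z t where zt: "z \<noteq> t" "?u z < cover_exponent k Q z" "0 < ?u t"
    and mem: "?u(z := Suc (?u z), t := ?u t - 1) \<in> cover_exponents k"
    using ex unfolding exchange_def by blast
  have z: "z \<in> side S b'" "z \<notin> side S b"
    using zt(2) Q by (auto simp: cover_exponent_def split: if_splits)
  have "t \<in> side S b \<and> (\<forall>w. adj t w \<longrightarrow> w \<notin> closed_hull adj S \<longrightarrow> w \<in> {z})"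
    by (rule exponent_below_cover_exponent[OF k S mem]) (use zt z in \<open>auto simp: side_def\<close>)
  then obtain y where "t \<notin> closed_hull adj S" "adj t y" "y \<notin> closed_hull adj S"
    "\<forall>w. adj t w \<longrightarrow> w \<notin> closed_hull adj S \<longrightarrow> w = z" by (auto simp: side_def)
  then show ?thesis unfolding has_leaf_outside_def using symD by blast
qed

lemma side_nonempty:
  assumes "adj u v" "u \<notin> closed_hull adj S" "v \<notin> closed_hull adj S"
  shows "\<exists>w. w \<in> side S b"
  using assms symD[OF assms(1)] bip[OF assms(1)] by (cases "u \<in> A \<longleftrightarrow> b") (auto simp: side_def)

lemma side_disjoint: "side S b \<inter> side S (\<not> b) = {}" "nbrs S \<inter> side S b = {}"
  by (auto simp: side_def nbrs_def closed_hull_def)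

text \<open>A surviving edge makes both sides nonempty. Naming the larger side \<open>b\<close>
  allows the smaller one to be padded to the same degree.\<close>

lemma leafyI:
  assumes "\<And>S b. (\<And>u v. u \<in> S \<Longrightarrow> v \<in> S \<Longrightarrow> \<not> adj u v) \<Longrightarrow> card (side S (\<not> b)) \<le> card (side S b) \<Longrightarrow>
    side S b \<noteq> {} \<Longrightarrow> side S (\<not> b) \<noteq> {} \<Longrightarrow> has_leaf_outside adj (closed_hull adj S)"
  shows "leafy adj"
  unfolding leafy_def
proof (intro allI impI)
  fix S assume S: "\<forall>u\<in>S. \<forall>v\<in>S. \<not> adj u v"
  show "has_leaf_outside adj (closed_hull adj S)"
  proof (cases "\<exists>u v. adj u v \<and> u \<notin> closed_hull adj S \<and> v \<notin> closed_hull adj S")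
    case True
    then have ne: "side S b \<noteq> {}" for b using side_nonempty by blast
    show ?thesis
    proof (cases "card (side S False) \<le> card (side S True)")
      case True
      then show ?thesis using assms[of S True] S ne by simp
    next
      case False
      then show ?thesis using assms[of S False] S ne by simp
    qed
  qed (auto simp: has_leaf_outside_def)
qed

lemma linear_quotients_imp_leafy:
  assumes k: "2 \<le> k" and lq: "has_linear_quotients (mon_ideal (cover_exponents k) :: ('v, 'k::field) mpoly set)"
  shows "leafy adj"
proof (rule leafyI)
  fix S b assume S: "\<And>u v. u \<in> S \<Longrightarrow> v \<in> S \<Longrightarrow> \<not> adj u v"
    and ne: "side S b \<noteq> {}" "side S (\<not> b) \<noteq> {}"
  let ?u = "\<lambda>b. cover_exponent k (nbrs S \<union> side S b)"
  obtain w where "w \<in> side S b" using ne(1) by auto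
  then have "?u b w \<noteq> ?u (\<not> b) w" using side_disjoint[of S b] by (auto simp: cover_exponent_def)
  then have "?u b \<noteq> ?u (\<not> b)" by auto
  then have "exchange (cover_exponents k) (?u b) (?u (\<not> b)) \<or> exchange (cover_exponents k) (?u (\<not> b)) (?u b)"
    using linear_quotients_exchange[OF lq up_closed_cover_exponents] cover_exponent_minimal[OF k S] by blast
  then show "has_leaf_outside adj (closed_hull adj S)"
    using exchange_imp_leaf[OF k S, where b = b and b' = "\<not> b"]
      exchange_imp_leaf[OF k S, where b = "\<not> b" and b' = b] by blast
qed

lemma componentwise_linear_imp_leafy:
  assumes k: "2 \<le> k" and lin: "componentwise_linear (mon_ideal (cover_exponents k) :: ('v, 'k::field) mpoly set)"
  shows "leafy adj"
proof (rule leafyI)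
  fix S b assume S: "\<And>u v. u \<in> S \<Longrightarrow> v \<in> S \<Longrightarrow> \<not> adj u v"
    and card: "card (side S (\<not> b)) \<le> card (side S b)"
    and ne: "side S b \<noteq> {}" "side S (\<not> b) \<noteq> {}"
  \<comment> \<open>Componentwise linearity compares monomials of the same degree, so the smaller
    side is padded from the larger one. The padding \<open>E\<close> is already contained in the
    first monomial and cannot be the variable gained.\<close>
  obtain E where E: "E \<subseteq> side S b" "card E = card (side S b) - card (side S (\<not> b))"
    by (metis diff_le_self obtain_subset_with_card_n)
  define Q where "Q = nbrs S \<union> (side S (\<not> b) \<union> E)"
  have "card (side S (\<not> b) \<union> E) = card (side S b)"
    using E card side_disjoint(1)[of S b] by (subst card_Un_disjoint) auto
  then have "card Q = card (nbrs S) + card (side S b)"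
    unfolding Q_def using E side_disjoint[of S b] side_disjoint(2)[of S "\<not> b"]
    by (subst card_Un_disjoint) auto
  also have "\<dots> = card (nbrs S \<union> side S b)"
    using side_disjoint(2)[of S b] by (intro card_Un_disjoint[symmetric]) auto
  finally have sum: "sum (cover_exponent k (nbrs S \<union> side S b)) UNIV = sum (cover_exponent k Q) UNIV"
    unfolding cover_exponent_def sum.distrib sum_indicator_nat by simp
  obtain w where w: "w \<in> side S (\<not> b)" using ne(2) by auto
  then have "cover_exponent k (nbrs S \<union> side S b) w \<noteq> cover_exponent k Q w"
    using side_disjoint(1)[of S b] side_disjoint(2)[of S "\<not> b"] by (auto simp: cover_exponent_def Q_def)
  then have "cover_exponent k (nbrs S \<union> side S b) \<noteq> cover_exponent k Q" by auto
  moreover have "cover_exponent k (nbrs S \<union> side S b) \<in> cover_exponents k"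
    by (rule cover_exponent_mem[OF k S subset_refl])
  moreover have "cover_exponent k Q \<in> cover_exponents k"
    by (rule cover_exponent_mem[OF k S, where b = "\<not> b"]) (auto simp: Q_def)
  ultimately have ex: "exchange (cover_exponents k) (cover_exponent k (nbrs S \<union> side S b)) (cover_exponent k Q)"
    using componentwise_linear_exchange[OF lin] sum by blast
  have "Q \<subseteq> nbrs S \<union> side S b \<union> side S (\<not> b)" using E by (auto simp: Q_def)
  then show "has_leaf_outside adj (closed_hull adj S)"
    using exchange_imp_leaf[OF k S ex] by blast
qed

end

theorem corollary4p11:
  fixes G :: "'v::finite sgraph" and X Y :: "'v set" and as :: "'v list"
  assumes "verts G = UNIV"
    and "star_graph G X Y"
    and "star_shedding_order G X Y as"
  shows "(vertex_decomposable (bipartite_part G as) \<longleftrightarrow>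
            (\<forall>k\<ge>1. has_linear_quotients
               (cover_ideal_symbolic_power G k :: ('v, 'k::field) mpoly set)))
       \<and> ((\<forall>k\<ge>1. has_linear_quotients
               (cover_ideal_symbolic_power G k :: ('v, 'k) mpoly set)) \<longleftrightarrow>
            (\<forall>k\<ge>2. componentwise_linear
               (cover_ideal_symbolic_power G k :: ('v, 'k) mpoly set)))
       \<and> ((\<forall>k\<ge>2. componentwise_linear
               (cover_ideal_symbolic_power G k :: ('v, 'k) mpoly set)) \<longleftrightarrow>
            (\<exists>k\<ge>2. componentwise_linear
               (cover_ideal_symbolic_power G k :: ('v, 'k) mpoly set)))"
proof -
  define A where "A = set as"
  let ?B = "bipartite_part G as"
  have G: "simple_graph G" "X \<union> Y = UNIV" "X \<inter> Y = {}"
    "\<And>u v. u \<in> X \<Longrightarrow> v \<in> X \<Longrightarrow> u \<noteq> v \<Longrightarrow> adjacent G u v"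
    "\<And>u v. u \<in> Y \<Longrightarrow> v \<in> Y \<Longrightarrow> \<not> adjacent G u v"
    using assms(1,2) by (auto simp: star_graph_def)
  have irrefl: "\<not> adjacent G u u" for u using G(1) by (auto simp: simple_graph_def doubleton_eq_iff)
  \<comment> \<open>In the first kind of shedding order the omitted \<open>x\<close> is a neighbour
    outside \<open>A\<close> of every \<open>a\<close>; in the second, every vertex of
    \<open>X\<close> has a neighbour in \<open>Y\<close>.\<close>
  have A: "A \<subseteq> X \<and> (\<forall>u. u \<notin> A \<longrightarrow> (\<forall>v. v \<notin> A \<longrightarrow> \<not> adjacent G u v)) \<and> (\<forall>a\<in>A. \<exists>b. b \<notin> A \<and> adjacent G a b)"
  proof (cases "\<exists>x\<in>X. \<forall>y\<in>Y. \<not> adjacent G x y")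
    case True
    then obtain x where x: "x \<in> X" "\<forall>y\<in>Y. \<not> adjacent G x y" "A = X - {x}"
      using assms(3) by (auto simp: star_shedding_order_def A_def)
    have "\<not> adjacent G u v" if "u \<notin> A" "v \<notin> A" for u v
    proof -
      have "u = x \<or> u \<in> Y" "v = x \<or> v \<in> Y" using that x(3) G(2) by auto
      then show ?thesis using x(2) G(5) irrefl by (metis insert_commute)
    qed
    moreover have "\<exists>b. b \<notin> A \<and> adjacent G a b" if "a \<in> A" for a
      using that x G(4)[of a x] by (intro exI[of _ x]) auto
    ultimately show ?thesis using x(3) by blast
  next
    case False
    then have "A = X" using assms(3) by (auto simp: star_shedding_order_def A_def)
    moreover have "u \<in> Y" if "u \<notin> X" for u using that G(2) by auto
    ultimately show ?thesis using False G(3,5) by blast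
  qed
  have B_adj: "adjacent ?B u v \<longleftrightarrow> adjacent G u v \<and> (u \<in> A \<longleftrightarrow> v \<notin> A)" for u v
  proof
    assume "adjacent G u v \<and> (u \<in> A \<longleftrightarrow> v \<notin> A)"
    then have "adjacent G u v" "adjacent G v u" "u \<in> A \<longleftrightarrow> v \<notin> A" by (auto simp: insert_commute)
    then show "adjacent ?B u v"
      using assms(1) by (cases "u \<in> A") (fastforce simp: bipartite_part_def A_def)+
  qed (auto simp: bipartite_part_def A_def doubleton_eq_iff insert_commute)
  have B_simple: "edges ?B \<subseteq> {{u, v} | u v. True}" by (auto simp: bipartite_part_def)
  have B_verts: "verts ?B = UNIV" using assms(1) by (simp add: bipartite_part_def)
  interpret bipartite_clique "adjacent ?B" A
  proof
    show "symp (adjacent ?B)" by (rule symp_adjacent)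
    show "u \<in> A \<longleftrightarrow> v \<notin> A" if "adjacent ?B u v" for u v using that B_adj by simp
    show "\<exists>b. adjacent ?B a b" if "a \<in> A" for a using A that B_adj by blast
  qed
  have "adjacent G u v \<longleftrightarrow> adjacent ?B u v \<or> u \<in> A \<and> v \<in> A \<and> u \<noteq> v" for u v
    unfolding B_adj using A G(4) irrefl by blast
  then have "edge_exponents G k = cover_exponents k" for k
    unfolding edge_exponents_def cover_exponents_def by blast
  then have J: "(cover_ideal_symbolic_power G k :: ('v, 'k) mpoly set) = mon_ideal (cover_exponents k)" for k
    using cover_ideal_symbolic_power_eq[OF G(1)] by simp
  have "vertex_decomposable ?B \<longleftrightarrow> leafy (adjacent ?B)"
    by (rule vertex_decomposable_iff_leafy[OF B_verts B_simple]) (rule bip)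
  moreover have "has_linear_quotients (mon_ideal (cover_exponents k) :: ('v, 'k) mpoly set)"
    "componentwise_linear (mon_ideal (cover_exponents k) :: ('v, 'k) mpoly set)"
    if "leafy (adjacent ?B)" for k
  proof -
    have "splittable {} (cover_exponents k)" by (rule splittable_cover_exponents[OF that])
    from splittable_quotient_order[OF this] splittable_componentwise_linear[OF this]
    show "has_linear_quotients (mon_ideal (cover_exponents k) :: ('v, 'k) mpoly set)"
      "componentwise_linear (mon_ideal (cover_exponents k) :: ('v, 'k) mpoly set)"
      using quotient_order_linear_quotients up_closed_cover_exponents by blast+
  qed
  moreover have "leafy (adjacent ?B)"
    if "\<forall>k\<ge>1. has_linear_quotients (mon_ideal (cover_exponents k) :: ('v, 'k) mpoly set)"
  proof -
    \<comment> \<open>The power 2 is the least \<open>k\<close> with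
      \<open>2 * (k - 1) \<ge> k\<close>, which the vectors \<open>cover_exponent\<close> need on
      the clique.\<close>
    have "has_linear_quotients (mon_ideal (cover_exponents 2) :: ('v, 'k) mpoly set)" using that by simp
    then show ?thesis by (rule linear_quotients_imp_leafy[OF order_refl])
  qed
  moreover have "leafy (adjacent ?B)"
    if "\<exists>k\<ge>2. componentwise_linear (mon_ideal (cover_exponents k) :: ('v, 'k) mpoly set)"
    using componentwise_linear_imp_leafy that by blast
  ultimately show ?thesis unfolding J by blast
qed

end
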